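(* Let $G$ be a connected graph with $|L_o(G)|\geq 2$. If $w(G)\leq 2|L_o(G)|$, then $\chi(G)\leq 2|L_o(G)|$.
   Context: All graphs are finite, simple and undirected. $L_o(G)$ denotes the set of all odd integers $m$ such that $G$ contains a cycle of length $m$. $w(G)$ denotes the clique number of $G$ (the number of vertices of a largest clique) and $\chi(G)$ the chromatic number. *)

theory Defs
  imports "Graph_Theory.Graph_Theory"
begin

text \<open>Finite simple undirected graphs are modelled by the locale \<open>graph\<close>: finite, loop-free,
  symmetric digraphs without parallel arcs. Each undirected edge is a pair of opposite arcs,
  so \<open>cycle\<close> also accepts the closed walk along an edge and back; requiring length at least 3
  leaves exactly the cycles of the undirected graph.\<close>

definition has_cycle_of_length :: "('a, 'b) pre_digraph \<Rightarrow> nat \<Rightarrow> bool" where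
  "has_cycle_of_length G m \<longleftrightarrow> 3 \<le> m \<and> (\<exists>p. pre_digraph.cycle G p \<and> length p = m)"

definition odd_cycle_lengths :: "('a, 'b) pre_digraph \<Rightarrow> nat set" where
  "odd_cycle_lengths G = {m. odd m \<and> has_cycle_of_length G m}"

definition clique :: "('a, 'b) pre_digraph \<Rightarrow> 'a set \<Rightarrow> bool" where
  "clique G S \<longleftrightarrow> S \<subseteq> verts G \<and> (\<forall>u\<in>S. \<forall>v\<in>S. u \<noteq> v \<longrightarrow> u \<rightarrow>\<^bsub>G\<^esub> v)"

definition clique_number :: "('a, 'b) pre_digraph \<Rightarrow> nat" where
  "clique_number G = Max (card ` {S. clique G S})"

definition proper_coloring :: "('a, 'b) pre_digraph \<Rightarrow> nat \<Rightarrow> ('a \<Rightarrow> nat) \<Rightarrow> bool" where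
  "proper_coloring G k c \<longleftrightarrow>
    c ` verts G \<subseteq> {..<k} \<and> (\<forall>u v. u \<rightarrow>\<^bsub>G\<^esub> v \<longrightarrow> c u \<noteq> c v)"

definition chromatic_number :: "('a, 'b) pre_digraph \<Rightarrow> nat" where
  "chromatic_number G = (LEAST k. \<exists>c. proper_coloring G k c)"

text \<open>For finite graphs the maximum and the minimum above, and the cardinality of
  \<open>odd_cycle_lengths\<close>, are taken over legitimate sets.\<close>

lemma (in graph) finite_cliques: "finite (card ` {S. clique G S})" "card ` {S. clique G S} \<noteq> {}"
proof -
  have "{S. clique G S} \<subseteq> Pow (verts G)" by (auto simp: clique_def)
  then show "finite (card ` {S. clique G S})"
    using finite_verts by (meson finite_Pow_iff finite_imageI finite_subset)
  have "clique G {}" by (simp add: clique_def)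
  then show "card ` {S. clique G S} \<noteq> {}" by blast
qed

lemma (in graph) ex_proper_coloring: "\<exists>k c. proper_coloring G k c"
proof -
  obtain c :: "'a \<Rightarrow> nat" where c: "bij_betw c (verts G) {0..<card (verts G)}"
    using ex_bij_betw_finite_nat[OF finite_verts] by blast
  have "c u \<noteq> c v" if "u \<rightarrow>\<^bsub>G\<^esub> v" for u v
  proof
    assume "c u = c v"
    then have "u = v"
      using adj_in_verts[OF that] c by (auto simp: bij_betw_def dest: inj_onD)
    with that show False using adj_not_same by blast
  qed
  with c have "proper_coloring G (card (verts G)) c"
    by (auto simp: proper_coloring_def bij_betw_def)
  then show ?thesis by blast
qed

lemma (in graph) finite_odd_cycle_lengths: "finite (odd_cycle_lengths G)"
proof -
  have "m \<le> card (verts G)" if "m \<in> odd_cycle_lengths G" for m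
  proof -
    from that obtain p u where p: "awalk u p u" "distinct (tl (awalk_verts u p))" "length p = m"
      by (auto simp: odd_cycle_lengths_def has_cycle_of_length_def cycle_def)
    have "set (tl (awalk_verts u p)) \<subseteq> verts G"
      using p(1) by (auto simp: awalk_def dest: list.set_sel(2)[OF awalk_verts_non_Nil]
          intro: awalk_verts_in_verts)
    then have "length (tl (awalk_verts u p)) \<le> card (verts G)"
      using p(2) finite_verts by (metis card_mono distinct_card)
    then show ?thesis using p(3) by (simp add: length_awalk_verts)
  qed
  then show ?thesis unfolding finite_nat_set_iff_bounded_le by blast
qed

end

theory Submission
  imports Defs
begin

text \<open>The obstacle is parity. Two neighbours of the end of a path give an odd cycle only if
  their positions differ in parity. When both parities occur among at least \<open>2 * k\<close>
  positions, counting differences yields at least \<open>k\<close> odd lengths, so every length is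
  used and the equality pins the configuration down. When all positions have one parity, the
  neighbours alone give no odd cycle; oddness must then be borrowed from the longest odd cycle,
  whose two arcs between any two vertices have opposite parity. This is why the pocket needs two
  exits towards that cycle. Maximising the tail over all longest odd cycles is what allows tails to
  be reversed, rotated or moved: each new free end again belongs to a longest tail, so its
  neighbours are confined as well. The counts \<open>2 * k\<close> and \<open>k\<close> leave almost
  no slack but do not contradict each other directly. Tight patterns survive, and they fall only to
  twins, to a second odd length (available as \<open>2 \<le> k\<close>), or to explicit small
  arithmetic.\<close>

text \<open>Suppose \<open>G\<close> has \<open>k\<close> odd cycle lengths and is not \<open>2k\<close>-colourable, and pass to a
  vertex-critical subgraph: it is 2-connected, has minimum degree at least \<open>2k\<close>, and no vertex
  has its neighbourhood inside that of a non-neighbour. Fix a longest odd cycle \<open>C\<close>, of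
  length \<open>M\<close>, together with a path \<open>e 0, ..., e R\<close> that meets \<open>C\<close> only in \<open>e R\<close>, with \<open>R\<close> as
  large as possible over all choices of \<open>C\<close>. Then all neighbours of \<open>e 0\<close> lie on the path or on
  \<open>C\<close>, and two neighbours of \<open>e 0\<close> at an odd distance \<open>d\<close> along a path from \<open>e 0\<close> close up to an odd
  cycle of length \<open>d + 2\<close>. Since there are \<open>2k\<close> neighbours but only \<open>k\<close> odd lengths, their
  positions are almost determined.

  If \<open>R \<ge> 2\<close> and \<open>e 0\<close> has a second neighbour on \<open>C\<close>, then the path is an ear of \<open>C\<close>; parity
  forces both of its ends to have the same attachments, and counting odd lengths gives a
  contradiction. If \<open>R \<ge> 2\<close> and all neighbours of \<open>e 0\<close> lie on the path, then the part of the path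
  that they span has two exits joined outside it by paths of both parities, so at most \<open>k\<close> lengths
  of paths between the exits are available inside; this leaves few patterns, each with two twin
  vertices or one length too many. If \<open>R = 1\<close>, then \<open>M = 2k + 1\<close>, exactly one vertex lies off
  \<open>C\<close>, and a missing edge would produce twins. If \<open>R = 0\<close>, then \<open>C\<close> is spanning, the graph is a
  circulant, and it is complete. In the last two cases there is a clique on \<open>2k + 1\<close>
  vertices.\<close>

section \<open>Paths and cycles\<close>

text \<open>A path records the set it lives in and its length as an integer. A cycle of length \<open>m\<close> is an
  \<open>m\<close>-periodic map on the integers, so that rotations and reflections are compositions with
  \<open>i \<mapsto> i + d\<close> and \<open>i \<mapsto> - i\<close>.\<close>

locale sgraph =
  fixes V :: "'a set" and E :: "'a \<Rightarrow> 'a \<Rightarrow> bool"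
  assumes fin: "finite V"
    and EV: "E u v \<Longrightarrow> u \<in> V"
    and sym: "E u v \<Longrightarrow> E v u"
    and irr: "\<not> E u u"
begin

definition pth :: "'a set \<Rightarrow> 'a \<Rightarrow> 'a \<Rightarrow> int \<Rightarrow> bool" where
  "pth X u v n \<longleftrightarrow> 0 \<le> n \<and> (\<exists>f. inj_on f {0..n} \<and> f ` {0..n} \<subseteq> X \<and> f 0 = u \<and> f n = v \<and>
     (\<forall>i. 0 \<le> i \<and> i < n \<longrightarrow> E (f i) (f (i + 1))))"

definition cyc :: "(int \<Rightarrow> 'a) \<Rightarrow> int \<Rightarrow> bool" where
  "cyc c m \<longleftrightarrow> 3 \<le> m \<and> (\<forall>i j. c i = c j \<longleftrightarrow> i mod m = j mod m) \<and> (\<forall>i. E (c i) (c (i + 1)))"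

definition OL :: "int set" where
  "OL = {m. odd m \<and> (\<exists>c. cyc c m)}"

lemma EV2: "E u v \<Longrightarrow> v \<in> V" using EV sym by blast

lemma pth_mono: "pth X u v n \<Longrightarrow> X \<subseteq> Y \<Longrightarrow> pth Y u v n"
  unfolding pth_def by blast

lemma pth_ends: "pth X u v n \<Longrightarrow> u \<in> X \<and> v \<in> X"
  unfolding pth_def by auto

lemma pth_nonneg: "pth X u v n \<Longrightarrow> 0 \<le> n"
  unfolding pth_def by auto

lemma pth_zero: "pth X u v 0 \<Longrightarrow> u = v"
  unfolding pth_def by auto

lemma pth_pos: "pth X u v n \<Longrightarrow> u \<noteq> v \<Longrightarrow> 1 \<le> n"
  using pth_nonneg pth_zero by (metis int_one_le_iff_zero_less order_le_less)

lemma pth_refl: "u \<in> X \<Longrightarrow> pth X u u 0"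
  unfolding pth_def by (auto intro!: exI[of _ "\<lambda>_. u"])

lemma pth_sym:
  assumes "pth X u v n" shows "pth X v u n"
proof -
  obtain f where n: "0 \<le> n" and f: "inj_on f {0..n}" "f ` {0..n} \<subseteq> X" "f 0 = u" "f n = v"
     "\<And>i. 0 \<le> i \<Longrightarrow> i < n \<Longrightarrow> E (f i) (f (i + 1))"
    using assms unfolding pth_def by blast
  have "inj_on (\<lambda>i. f (n - i)) {0..n}"
    using f(1) unfolding inj_on_def by fastforce
  moreover have "(\<lambda>i. f (n - i)) ` {0..n} \<subseteq> X" using f(2) by auto
  moreover have "E (f (n - i)) (f (n - (i+1)))" if "0 \<le> i" "i < n" for i
    using f(5)[of "n - (i+1)"] that sym by (auto simp: algebra_simps)
  ultimately show ?thesis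
    unfolding pth_def using n f(3,4) by (intro conjI exI[of _ "\<lambda>i. f (n - i)"]) auto
qed

lemma pth_trans:
  assumes "pth X u v n" "pth Y v w m" "X \<inter> Y \<subseteq> {v}"
  shows "pth (X \<union> Y) u w (n + m)"
proof -
  obtain f where n: "0 \<le> n" and f: "inj_on f {0..n}" "f ` {0..n} \<subseteq> X" "f 0 = u" "f n = v"
     "\<And>i. 0 \<le> i \<Longrightarrow> i < n \<Longrightarrow> E (f i) (f (i + 1))"
    using assms(1) unfolding pth_def by blast
  obtain g where m: "0 \<le> m" and g: "inj_on g {0..m}" "g ` {0..m} \<subseteq> Y" "g 0 = v" "g m = w"
     "\<And>i. 0 \<le> i \<Longrightarrow> i < m \<Longrightarrow> E (g i) (g (i + 1))"
    using assms(2) unfolding pth_def by blast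
  define h where "h = (\<lambda>i. if i \<le> n then f i else g (i - n))"
  have hg: "h i = g (i - n)" if "n \<le> i" for i
    using that f(4) g(3) by (auto simp: h_def)
  have key: False if "0 \<le> i" "i \<le> n" "n < j" "j \<le> n + m" "f i = g (j - n)" for i j
  proof -
    have "f i \<in> X" using f(2) that(1,2) by (simp add: image_subset_iff)
    moreover have "g (j - n) \<in> Y" using g(2) that(3,4) by (simp add: image_subset_iff)
    ultimately have "f i \<in> X" "g (j - n) \<in> Y" by auto
    then have "g (j - n) = v" using that(5) assms(3) by auto
    then have "g (j - n) = g 0" using g(3) by simp
    then show False using inj_onD[OF g(1), of "j-n" 0] that m by auto
  qed
  have "inj_on h {0..n+m}"
  proof (rule inj_onI)
    fix i j assume a: "i \<in> {0..n+m}" "j \<in> {0..n+m}" "h i = h j"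
    consider "i \<le> n" "j \<le> n" | "i \<le> n" "n < j" | "n < i" "j \<le> n" | "n < i" "n < j" by linarith
    then show "i = j"
    proof cases
      case 1 then show ?thesis using a f(1) by (auto simp: h_def inj_on_def)
    next
      case 2 then show ?thesis using a key[of i j] by (auto simp: h_def)
    next
      case 3 then show ?thesis using a key[of j i] by (auto simp: h_def)
    next
      case 4 then show ?thesis using a inj_onD[OF g(1), of "i-n" "j-n"] by (auto simp: h_def)
    qed
  qed
  moreover have "h ` {0..n+m} \<subseteq> X \<union> Y"
  proof -
    have "h i \<in> X \<union> Y" if "0 \<le> i" "i \<le> n+m" for i
      using that f(2) g(2) by (cases "i \<le> n") (auto simp: h_def image_subset_iff)
    then show ?thesis by (intro image_subsetI) (metis atLeastAtMost_iff)
  qed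
  moreover have "h 0 = u" using n f(3) by (simp add: h_def)
  moreover have "h (n+m) = w" using hg[of "n+m"] m g(4) by simp
  moreover have "E (h i) (h (i+1))" if "0 \<le> i" "i < n+m" for i
  proof (cases "i < n")
    case True then show ?thesis using f(5) that by (auto simp: h_def)
  next
    case False
    then have "h i = g (i-n)" "h (i+1) = g (i-n+1)" using hg[of i] hg[of "i+1"] by (auto simp: algebra_simps)
    then show ?thesis using g(5)[of "i-n"] False that by auto
  qed
  ultimately show ?thesis unfolding pth_def using n m by (intro conjI exI[of _ h]) auto
qed

lemma pth_edge: "E u v \<Longrightarrow> pth {u,v} u v 1"
  unfolding pth_def
  by (intro conjI exI[of _ "\<lambda>i. if i = 0 then u else v"]) (use irr in \<open>auto simp: inj_on_def\<close>)

lemma pth_seg: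
  assumes "inj_on p {i..j}" "i \<le> j" "\<And>t. i \<le> t \<Longrightarrow> t < j \<Longrightarrow> E (p t) (p (t+1))"
  shows "pth (p ` {i..j}) (p i) (p j) (j - i)"
  unfolding pth_def
proof (intro conjI exI[of _ "\<lambda>t. p (i + t)"])
  show "inj_on (\<lambda>t. p (i + t)) {0..j - i}"
    using assms(1) unfolding inj_on_def by fastforce
  show "\<forall>t. 0 \<le> t \<and> t < j - i \<longrightarrow> E (p (i + t)) (p (i + (t + 1)))"
    using assms(3) by (metis add.assoc add_increasing2 le_add_same_cancel1 less_diff_eq add.commute)
qed (use assms(2) in auto)

lemma pth_cons:
  assumes "E u v" "pth X v w n" "u \<notin> X"
  shows "pth (insert u X) u w (n + 1)"
proof -
  have "pth ({u,v} \<union> X) u w (1 + n)"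
    by (rule pth_trans[OF pth_edge[OF assms(1)] assms(2)]) (use assms(3) in auto)
  moreover have "{u,v} \<union> X = insert u X" using pth_ends[OF assms(2)] by auto
  ultimately show ?thesis by (simp add: add.commute)
qed

lemma cyc_close:
  assumes "pth X u v n" "E v u" "2 \<le> n"
  shows "\<exists>c. cyc c (n + 1) \<and> range c \<subseteq> X"
proof -
  obtain f where f: "inj_on f {0..n}" "f ` {0..n} \<subseteq> X" "f 0 = u" "f n = v"
     "\<And>i. 0 \<le> i \<Longrightarrow> i < n \<Longrightarrow> E (f i) (f (i + 1))"
    using assms unfolding pth_def by blast
  define c where "c = (\<lambda>i. f (i mod (n+1)))"
  have b: "0 \<le> i mod (n+1)" "i mod (n+1) \<le> n" for i
    using assms(3) pos_mod_bound[of "n+1" i] by auto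
  have "c i = c j \<longleftrightarrow> i mod (n+1) = j mod (n+1)" for i j
    using f(1) b by (auto simp: c_def inj_on_def)
  moreover have "E (c i) (c (i+1))" for i
  proof (cases "i mod (n+1) = n")
    case True
    then have "(i+1) mod (n+1) = 0" by (metis mod_add_left_eq mod_self)
    then show ?thesis using True f(3,4) assms(2) by (simp add: c_def)
  next
    case False
    then have l: "i mod (n+1) < n" using b[of i] by simp
    have "(i+1) mod (n+1) = (i mod (n+1) + 1) mod (n+1)" by (simp add: mod_add_left_eq)
    also have "\<dots> = i mod (n+1) + 1" using l b[of i] by (intro mod_pos_pos_trivial) auto
    finally show ?thesis using f(5)[of "i mod (n+1)"] l b[of i] by (simp add: c_def)
  qed
  moreover have "range c \<subseteq> X" using f(2) b by (auto simp: c_def)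
  ultimately show ?thesis unfolding cyc_def using assms(3) by (intro exI[of _ c]) auto
qed

text \<open>The second path loses its last vertex and is appended to the first; its last edge closes
  the cycle. The bound \<open>3 \<le> n + m\<close> excludes an edge run back and forth.\<close>

lemma cyc_close2:
  assumes "pth X u v n" "pth Y u v m" "X \<inter> Y \<subseteq> {u,v}" "u \<noteq> v" "3 \<le> n + m"
  shows "\<exists>c. cyc c (n + m) \<and> range c \<subseteq> X \<union> Y"
proof -
  obtain g where m: "0 \<le> m" and g: "inj_on g {0..m}" "g ` {0..m} \<subseteq> Y" "g 0 = u" "g m = v"
     "\<And>i. 0 \<le> i \<Longrightarrow> i < m \<Longrightarrow> E (g i) (g (i + 1))"
    using assms(2) unfolding pth_def by blast
  have m1: "1 \<le> m" using pth_pos assms(2,4) by blast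
  have p: "pth (g ` {0..m-1}) u (g (m-1)) (m-1)"
    using pth_seg[of g 0 "m-1"] g m1 by (auto simp: inj_on_def)
  have "v \<notin> g ` {0..m-1}"
  proof
    assume "v \<in> g ` {0..m-1}"
    then obtain x where "x \<in> {0..m-1}" "g x = g m" using g(4) by auto
    then show False using inj_onD[OF g(1), of x m] m1 by auto
  qed
  then have "X \<inter> g ` {0..m-1} \<subseteq> {u}" using assms(3) g(2) m1 by (auto simp: image_subset_iff)
  then have "pth (X \<union> g ` {0..m-1}) v (g (m-1)) (n + (m-1))"
    by (rule pth_trans[OF pth_sym[OF assms(1)] p])
  from cyc_close[OF this, of] have "E (g (m-1)) v \<Longrightarrow> \<exists>c. cyc c (n + (m-1) + 1) \<and> range c \<subseteq> X \<union> g ` {0..m-1}"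
    using assms(5) by simp
  moreover have "E (g (m-1)) v" using g(5)[of "m-1"] g(4) m1 by simp
  ultimately obtain c where "cyc c (n + (m-1) + 1)" "range c \<subseteq> X \<union> g ` {0..m-1}"
    by blast
  moreover have "g ` {0..m-1} \<subseteq> Y" using g(2) by (auto simp: image_subset_iff)
  ultimately show ?thesis by (intro exI[of _ c]) (auto simp: algebra_simps)
qed

lemma cyc_seg:
  assumes "cyc c m" "i \<le> j" "j < i + m"
  shows "pth (c ` {i..j}) (c i) (c j) (j - i)"
proof (rule pth_seg)
  have "a = b" if "a \<in> {i..j}" "b \<in> {i..j}" "a mod m = b mod m" for a b
  proof -
    have "m dvd a - b" using that(3) by (simp add: mod_eq_dvd_iff)
    moreover have "\<bar>a - b\<bar> < m" using that assms by auto
    ultimately show ?thesis using dvd_imp_le_int[of "a-b" m] by fastforce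
  qed
  then show "inj_on c {i..j}" using assms(1) by (auto simp: cyc_def inj_on_def)
qed (use assms in \<open>auto simp: cyc_def\<close>)

lemma cyc_in_V: "cyc c m \<Longrightarrow> range c \<subseteq> V"
  unfolding cyc_def by (metis EV image_subsetI)

lemma cyc_shift: "cyc c m \<Longrightarrow> cyc (\<lambda>i. c (i + d)) m"
  unfolding cyc_def
proof (intro conjI allI; (elim conjE)?)
  fix i j assume "\<forall>i j. (c i = c j) = (i mod m = j mod m)"
  then show "(c (i + d) = c (j + d)) = (i mod m = j mod m)" by (simp add: mod_eq_dvd_iff)
next
  fix i assume "\<forall>i. E (c i) (c (i+1))"
  then have "E (c (i + d)) (c (i + d + 1))" by blast
  then show "E (c (i + d)) (c (i + 1 + d))" by (simp add: algebra_simps)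
qed

lemma cyc_reflect: "cyc c m \<Longrightarrow> cyc (\<lambda>i. c (- i)) m"
  unfolding cyc_def
proof (intro conjI allI; (elim conjE)?)
  fix i j assume a: "\<forall>i j. (c i = c j) = (i mod m = j mod m)"
  show "(c (- i) = c (- j)) = (i mod m = j mod m)"
    using a by (simp add: mod_eq_dvd_iff) (metis dvd_minus_iff minus_diff_eq uminus_add_conv_diff minus_diff_commute)
next
  fix i assume "\<forall>i. E (c i) (c (i+1))"
  then have "E (c (- (i + 1))) (c (- (i + 1) + 1))" by blast
  moreover have "- (i + 1) + 1 = - i" by simp
  ultimately show "E (c (- i)) (c (- (i + 1)))" using sym by metis
qed

lemma finite_OL: "finite OL"
proof -
  have "m \<le> int (card V)" if "cyc c m" for c m
  proof -
    have m: "3 \<le> m" using that by (simp add: cyc_def)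
    have "inj_on c {0..m-1}"
      using that by (auto simp: cyc_def inj_on_def)
    then have "card {0..m-1} \<le> card V"
      using cyc_in_V[OF that] fin by (meson card_inj_on_le image_subset_iff range_subsetD subset_iff)
    then show ?thesis using m by simp
  qed
  then have "OL \<subseteq> {3..int (card V)}" unfolding OL_def by (auto simp: cyc_def)
  then show ?thesis using finite_subset by blast
qed

lemma OL_ge3: "m \<in> OL \<Longrightarrow> 3 \<le> m" by (auto simp: OL_def cyc_def)
lemma OL_odd: "m \<in> OL \<Longrightarrow> odd m" by (auto simp: OL_def)

lemma cyc_period: "cyc c m \<Longrightarrow> c (i + m) = c i"
  by (simp add: cyc_def)

text \<open>The carrier of \<open>pth\<close> may be larger than the path. Cutting it down to the
  image makes initial and final pieces avoid the opposite end, as rerouting requires.\<close>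

lemma pth_exact:
  assumes "pth X u v n"
  shows "\<exists>Y\<subseteq>X. pth Y u v n \<and>
    (\<forall>w\<in>Y. (w \<noteq> u \<longrightarrow> (\<exists>m. pth (Y - {u}) w v m)) \<and> (w \<noteq> v \<longrightarrow> (\<exists>m. pth (Y - {v}) u w m)))"
proof -
  obtain f where n: "0 \<le> n" and f: "inj_on f {0..n}" "f ` {0..n} \<subseteq> X" "f 0 = u" "f n = v"
     "\<And>i. 0 \<le> i \<Longrightarrow> i < n \<Longrightarrow> E (f i) (f (i + 1))"
    using assms unfolding pth_def by blast
  have 1: "pth (f ` {0..n}) u v n" using pth_seg[of f 0 n] n f by auto
  have 2: "\<exists>m. pth (f ` {0..n} - {u}) w v m" if "w \<in> f ` {0..n}" "w \<noteq> u" for w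
  proof -
    obtain i where i: "i \<in> {0..n}" "w = f i" using \<open>w \<in> _\<close> by auto
    with \<open>w \<noteq> u\<close> f(3) have "i \<noteq> 0" by auto
    have "pth (f ` {i..n}) (f i) (f n) (n - i)"
      using f i by (intro pth_seg) (auto simp: inj_on_def)
    moreover have "f t \<noteq> u" if "t \<in> {i..n}" for t
      using inj_onD[OF f(1), of t 0] that i \<open>i \<noteq> 0\<close> f(3) n by auto
    then have "f ` {i..n} \<subseteq> f ` {0..n} - {u}" using i(1) by fastforce
    ultimately have "pth (f ` {0..n} - {u}) (f i) (f n) (n - i)" using pth_mono by blast
    then show ?thesis using i f(4) by blast
  qed
  have 3: "\<exists>m. pth (f ` {0..n} - {v}) u w m" if "w \<in> f ` {0..n}" "w \<noteq> v" for w
  proof -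
    obtain i where i: "i \<in> {0..n}" "w = f i" using \<open>w \<in> _\<close> by auto
    with \<open>w \<noteq> v\<close> f(4) have "i \<noteq> n" by auto
    have "pth (f ` {0..i}) (f 0) (f i) (i - 0)"
      using f i by (intro pth_seg) (auto simp: inj_on_def)
    moreover have "f t \<noteq> v" if "t \<in> {0..i}" for t
      using inj_onD[OF f(1), of t n] that i \<open>i \<noteq> n\<close> f(4) n by auto
    then have "f ` {0..i} \<subseteq> f ` {0..n} - {v}" using i(1) by fastforce
    ultimately have "pth (f ` {0..n} - {v}) (f 0) (f i) (i - 0)" using pth_mono by blast
    then show ?thesis using i f(3) by blast
  qed
  show ?thesis using 1 2 3 f(2) by (intro exI[of _ "f ` {0..n}"] conjI ballI impI) auto
qed

lemma pth_suffix:
  assumes "pth X u v n"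
  shows "\<exists>Y. Y \<subseteq> X \<and> pth Y u v n \<and> (\<forall>w\<in>Y. w \<noteq> u \<longrightarrow> (\<exists>m. pth (Y - {u}) w v m))"
proof -
  obtain Y where "Y \<subseteq> X" "pth Y u v n" "\<forall>w\<in>Y. (w \<noteq> u \<longrightarrow> (\<exists>m. pth (Y - {u}) w v m)) \<and>
      (w \<noteq> v \<longrightarrow> (\<exists>m. pth (Y - {v}) u w m))"
    using pth_exact[OF assms] by (elim exE conjE) (rule that; assumption)
  then show ?thesis by (intro exI[of _ Y] conjI) simp_all
qed

lemma pth_prefix:
  assumes "pth X u v n"
  shows "\<exists>Y. Y \<subseteq> X \<and> pth Y u v n \<and> (\<forall>w\<in>Y. w \<noteq> v \<longrightarrow> (\<exists>m. pth (Y - {v}) u w m))"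
proof -
  obtain Y where "Y \<subseteq> X" "pth Y u v n" "\<forall>w\<in>Y. (w \<noteq> u \<longrightarrow> (\<exists>m. pth (Y - {u}) w v m)) \<and>
      (w \<noteq> v \<longrightarrow> (\<exists>m. pth (Y - {v}) u w m))"
    using pth_exact[OF assms] by (elim exE conjE) (rule that; assumption)
  then show ?thesis by (intro exI[of _ Y] conjI) simp_all
qed

lemma pth_first_hit:
  assumes "pth X u v n" "v \<in> T"
  shows "\<exists>Y w m. Y \<subseteq> X \<and> pth Y u w m \<and> Y \<inter> T = {w}"
proof -
  obtain f where n: "0 \<le> n" and f: "inj_on f {0..n}" "f ` {0..n} \<subseteq> X" "f 0 = u" "f n = v"
     "\<And>i. 0 \<le> i \<Longrightarrow> i < n \<Longrightarrow> E (f i) (f (i + 1))"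
    using assms(1) unfolding pth_def by blast
  define j where "j = (LEAST j. f (int j) \<in> T)"
  have ex: "f (int (nat n)) \<in> T" using n f(4) assms(2) by simp
  have jT: "f (int j) \<in> T" unfolding j_def by (rule LeastI) (rule ex)
  have jn: "int j \<le> n" using Least_le[of "\<lambda>j. f (int j) \<in> T" "nat n", OF ex] n by (simp add: j_def)
  have jl: "f i \<notin> T" if "0 \<le> i" "i < int j" for i
    using not_less_Least[of "nat i" "\<lambda>j. f (int j) \<in> T"] that by (simp add: j_def)
  have "pth (f ` {0..int j}) (f 0) (f (int j)) (int j - 0)"
    using f jn by (intro pth_seg) (auto simp: inj_on_def)
  moreover have "f ` {0..int j} \<inter> T = {f (int j)}"
    using jT jl by (auto simp: order_le_less)
  moreover have "f ` {0..int j} \<subseteq> X" using f(2) jn by auto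
  ultimately show ?thesis using f(3) by blast
qed

text \<open>Makes the set reachable inside \<open>X\<close> closed under edges: if \<open>y\<close>
  already lies on the path, the path is cut there instead of being prolonged.\<close>

lemma pth_extend:
  assumes "pth X u x n" "E x y" "y \<in> X"
  shows "\<exists>m. pth X u y m"
proof -
  obtain Y where Y: "Y \<subseteq> X" "pth Y u x n" and
    p: "\<And>w. w \<in> Y \<Longrightarrow> w \<noteq> x \<Longrightarrow> \<exists>m. pth (Y - {x}) u w m"
    using pth_exact[OF assms(1)] by blast
  show ?thesis
  proof (cases "y \<in> Y")
    case True
    then show ?thesis using p[of y] assms(2) irr Y pth_mono by (metis Diff_subset subset_trans)
  next
    case False
    have "pth (insert y Y) y u (n + 1)" by (rule pth_cons[OF sym[OF assms(2)] pth_sym[OF Y(2)] False])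
    then have "pth X y u (n + 1)" using Y(1) assms(3) pth_mono by (metis insert_subset)
    then show ?thesis using pth_sym by blast
  qed
qed

section \<open>Vertex-critical subgraphs\<close>

definition colb :: "nat \<Rightarrow> 'a set \<Rightarrow> bool" where
  "colb q W \<longleftrightarrow> (\<exists>c. (\<forall>v\<in>W. c v < q) \<and> (\<forall>u\<in>W. \<forall>v\<in>W. E u v \<longrightarrow> c u \<noteq> c v))"

definition vcrit :: "nat \<Rightarrow> 'a set \<Rightarrow> bool" where
  "vcrit q W \<longleftrightarrow> W \<subseteq> V \<and> \<not> colb q W \<and> (\<forall>v\<in>W. colb q (W - {v}))"

lemma colb_subset: "colb q W \<Longrightarrow> U \<subseteq> W \<Longrightarrow> colb q U"
  unfolding colb_def by blast

lemma colb_insert: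
  assumes "\<And>x. x \<in> W - {v} \<Longrightarrow> c x < q"
    "\<And>x w. x \<in> W - {v} \<Longrightarrow> w \<in> W - {v} \<Longrightarrow> E x w \<Longrightarrow> c x \<noteq> c w"
    "a < q" "\<And>x. x \<in> W \<Longrightarrow> E v x \<Longrightarrow> c x \<noteq> a"
  shows "colb q W"
  unfolding colb_def
proof (intro exI[of _ "c(v := a)"] conjI ballI impI)
  fix x assume "x \<in> W" then show "(c(v := a)) x < q" using assms(1)[of x] assms(3) by auto
next
  fix x y assume *: "x \<in> W" "y \<in> W" "E x y"
  then have "x \<noteq> y" using irr by blast
  then consider "x = v" "y \<noteq> v" | "y = v" "x \<noteq> v" | "x \<noteq> v" "y \<noteq> v" by blast
  then show "(c(v := a)) x \<noteq> (c(v := a)) y"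
  proof cases
    case 1 then show ?thesis using assms(4)[of y] * by auto
  next
    case 2 then show ?thesis using assms(4)[of x] * sym[of x y] by auto
  next
    case 3 then show ?thesis using assms(2)[of x y] * by auto
  qed
qed

lemma ex_vcrit:
  assumes "W \<subseteq> V" "\<not> colb q W" shows "\<exists>U\<subseteq>W. vcrit q U"
proof -
  have "finite W" using assms(1) fin finite_subset by blast
  then show ?thesis using assms
  proof (induction W rule: finite_psubset_induct)
    case (psubset W)
    show ?case
    proof (cases "\<exists>v\<in>W. \<not> colb q (W - {v})")
      case True
      then obtain v where "v \<in> W" "\<not> colb q (W - {v})" by blast
      then have "\<exists>U\<subseteq>W - {v}. vcrit q U" using psubset.prems by (intro psubset.IH) auto
      then show ?thesis by blast
    next
      case False
      then show ?thesis using psubset.prems unfolding vcrit_def by blast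
    qed
  qed
qed

lemma vcrit_colouring:
  assumes "vcrit q W" "v \<in> W"
  shows "\<exists>c. (\<forall>x\<in>W - {v}. c x < q) \<and> (\<forall>x\<in>W - {v}. \<forall>w\<in>W - {v}. E x w \<longrightarrow> c x \<noteq> c w)"
proof -
  have "colb q (W - {v})" using assms unfolding vcrit_def by blast
  then show ?thesis unfolding colb_def .
qed

lemma vcrit_deg:
  assumes "vcrit q W" "v \<in> W" shows "q \<le> card {u \<in> W. E v u}"
proof (rule ccontr)
  assume "\<not> q \<le> card {u \<in> W. E v u}"
  obtain c where c0: "\<forall>x\<in>W - {v}. c x < q"
    "\<forall>x\<in>W - {v}. \<forall>w\<in>W - {v}. E x w \<longrightarrow> c x \<noteq> c w"
    using vcrit_colouring[OF assms] by blast
  note c = c0[rule_format]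
  have fW: "finite W" using assms(1) fin finite_subset unfolding vcrit_def by blast
  have "card (c ` {u \<in> W. E v u}) < card {..<q}"
    using \<open>\<not> _\<close> card_image_le[of "{u \<in> W. E v u}" c] fW by simp
  moreover have "finite (c ` {u \<in> W. E v u})" using fW by simp
  ultimately have "\<not> {..<q} \<subseteq> c ` {u \<in> W. E v u}" using card_mono linorder_not_less by blast
  then obtain a0 where "a0 < q" "a0 \<notin> c ` {u \<in> W. E v u}" by auto
  then have a: "a0 < q" "\<And>u. u \<in> W \<Longrightarrow> E v u \<Longrightarrow> c u \<noteq> a0" by auto
  have "colb q W" by (rule colb_insert[OF c a])
  then show False using assms(1) unfolding vcrit_def by blast
qed

text \<open>A colouring of \<open>W - {u}\<close> would extend to \<open>u\<close> by the colour of
  \<open>v\<close>, which no neighbour of \<open>u\<close> can have.\<close>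

lemma vcrit_no_twin:
  assumes "vcrit q W" "u \<in> W" "v \<in> W" "u \<noteq> v" "\<not> E u v"
  shows "\<not> {x \<in> W. E u x} \<subseteq> {x \<in> W. E v x}"
proof
  assume sub: "{x \<in> W. E u x} \<subseteq> {x \<in> W. E v x}"
  obtain c where c0: "\<forall>x\<in>W - {u}. c x < q"
    "\<forall>x\<in>W - {u}. \<forall>w\<in>W - {u}. E x w \<longrightarrow> c x \<noteq> c w"
    using vcrit_colouring[OF assms(1,2)] by blast
  note c = c0[rule_format]
  have n: "c x \<noteq> c v" if "x \<in> W" "E u x" for x
  proof -
    have "E x v" using sub that sym by auto
    moreover have "x \<noteq> u" using that(2) irr by auto
    ultimately show ?thesis using c(2)[of x v] that(1) assms(3,4) by auto
  qed
  have "c v < q" using c(1) assms by blast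
  then have "colb q W" by (intro colb_insert[OF c _ n])
  then show False using assms(1) unfolding vcrit_def by blast
qed

text \<open>Colourings of the two sides are glued after a renaming of colours that makes them agree
  at \<open>z\<close>. Since \<open>z\<close> may lie outside \<open>W\<close>, this excludes
  disconnectedness as well as cut vertices.\<close>

lemma vcrit_not_separated:
  assumes "vcrit q W" "W - {z} = A \<union> B" "A \<inter> B = {}" "A \<noteq> {}" "B \<noteq> {}"
    and sep: "\<And>a b. a \<in> A \<Longrightarrow> b \<in> B \<Longrightarrow> \<not> E a b"
  shows False
proof -
  obtain a b where ab: "a \<in> A" "b \<in> B" using assms by blast
  have "colb q (W - {a})" "colb q (W - {b})" using assms(1,2) ab unfolding vcrit_def by blast+
  moreover have "W - B \<subseteq> W - {b}" "W - A \<subseteq> W - {a}" using ab by auto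
  ultimately have "colb q (W - B)" "colb q (W - A)" using colb_subset by blast+
  then obtain c d where c: "\<And>u. u \<in> W - B \<Longrightarrow> c u < q"
    "\<And>u w. u \<in> W - B \<Longrightarrow> w \<in> W - B \<Longrightarrow> E u w \<Longrightarrow> c u \<noteq> c w"
    and d: "\<And>u. u \<in> W - A \<Longrightarrow> d u < q"
    "\<And>u w. u \<in> W - A \<Longrightarrow> w \<in> W - A \<Longrightarrow> E u w \<Longrightarrow> d u \<noteq> d w"
    unfolding colb_def by blast
  \<comment> \<open>The transposition of the two colours that \<open>z\<close> receives.\<close>
  define t where "t = (\<lambda>i. if i = d z then c z else if i = c z then d z else i)"
  have tinj: "t i = t j \<Longrightarrow> i = j" for i j by (auto simp: t_def split: if_splits)
  have tz: "t (d z) = c z" by (simp add: t_def)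
  have tq: "t i < q" if "i < q" "z \<in> W" for i
    using that c(1)[of z] d(1)[of z] assms(2) by (auto simp: t_def)
  define e where "e = (\<lambda>x. if x \<in> A then c x else if z \<in> W then t (d x) else d x)"
  have eA: "e x = c x" if "x \<in> W - B" for x
    using that assms(2) tz by (auto simp: e_def)
  have eB: "e x = (if z \<in> W then t (d x) else d x)" if "x \<in> W - A" for x
    using that by (auto simp: e_def)
  have "e x < q" if "x \<in> W" for x

  proof (cases "x \<in> A")
    case True
    then have "x \<in> W - B" using that assms(3) by blast
    then show ?thesis using eA c(1) by simp
  next
    case False
    then have "x \<in> W - A" using that by blast
    then show ?thesis using eB d(1) tq by simp
  qed
  moreover have "e x \<noteq> e y" if "x \<in> W" "y \<in> W" "E x y" for x y
  proof -
    have "x \<in> W - B \<and> y \<in> W - B \<or> x \<in> W - A \<and> y \<in> W - A"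
      using that assms(2,3) sep sym by blast
    then show ?thesis
    proof
      assume "x \<in> W - B \<and> y \<in> W - B"
      then show ?thesis using c(2)[of x y] eA[of x] eA[of y] that(3) by simp
    next
      assume "x \<in> W - A \<and> y \<in> W - A"
      then show ?thesis using d(2)[of x y] eB[of x] eB[of y] tinj[of "d x" "d y"] that(3) by auto
    qed
  qed
  ultimately have "colb q W" unfolding colb_def by blast
  then show False using assms(1) unfolding vcrit_def by blast
qed

lemma vcrit_connected:
  assumes "vcrit q W" "u \<in> W - {z}" "v \<in> W - {z}"
  shows "\<exists>n. pth (W - {z}) u v n"
proof (rule ccontr)
  assume no: "\<not> ?thesis"
  define A where "A = {x \<in> W - {z}. \<exists>n. pth (W - {z}) u x n}"
  show False
  proof (rule vcrit_not_separated[OF assms(1), of z A "(W - {z}) - A"])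
    have "u \<in> A" using assms(2) pth_refl[OF assms(2)] unfolding A_def by auto
    then show "A \<noteq> {}" by auto
    have "v \<notin> A" using no unfolding A_def by auto
    then show "W - {z} - A \<noteq> {}" using assms(3) by auto
    show "\<not> E a b" if "a \<in> A" "b \<in> W - {z} - A" for a b
    proof
      assume e: "E a b"
      obtain n where "pth (W - {z}) u a n" using \<open>a \<in> A\<close> unfolding A_def by auto
      from pth_extend[OF this e] that(2) show False unfolding A_def by auto
    qed
  qed (auto simp: A_def)
qed

lemma pth_colour_parity:
  assumes "pth X u v n" "\<And>x y. x \<in> X \<Longrightarrow> y \<in> X \<Longrightarrow> E x y \<Longrightarrow> c x \<noteq> c y" "\<And>x. x \<in> X \<Longrightarrow> c x < (2::nat)"
  shows "even n \<longleftrightarrow> c u = c v"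
proof -
  obtain f where n: "0 \<le> n" and f: "inj_on f {0..n}" "f ` {0..n} \<subseteq> X" "f 0 = u" "f n = v"
     "\<And>i. 0 \<le> i \<Longrightarrow> i < n \<Longrightarrow> E (f i) (f (i + 1))"
    using assms(1) unfolding pth_def by blast
  have "int i \<le> n \<Longrightarrow> even i \<longleftrightarrow> c u = c (f (int i))" for i
  proof (induction i)
    case 0 then show ?case using f(3) by simp
  next
    case (Suc i)
    have "f (int i) \<in> X" "f (int i + 1) \<in> X" "u \<in> X" using f(2,3) Suc.prems n by (auto simp: image_subset_iff)
    moreover have "E (f (int i)) (f (int i + 1))" using f(5) Suc.prems by simp
    ultimately have "c (f (int i)) \<noteq> c (f (int i + 1))" "c (f (int i)) < 2" "c (f (int i + 1)) < 2" "c u < 2"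
      using assms(2,3) by blast+
    moreover have "even i \<longleftrightarrow> c u = c (f (int i))" using Suc by simp
    ultimately show ?case by (auto simp: add.commute)
  qed
  from this[of "nat n"] show ?thesis using n f(4) by (simp add: even_nat_iff)
qed

text \<open>In a critical subgraph for two colours, a vertex \<open>v\<close> sees both colours of a
  colouring of the rest. A path joining two neighbours of different colours is odd, and
  \<open>v\<close> closes it to an odd cycle.\<close>

lemma odd_cycle_if_not_bipartite:
  assumes "W \<subseteq> V" "\<not> colb 2 W" shows "OL \<noteq> {}"
proof -
  obtain U where U: "U \<subseteq> W" "vcrit 2 U" using ex_vcrit[OF assms] by blast
  have "colb 2 {}" unfolding colb_def by simp
  then have "U \<noteq> {}" using U(2) unfolding vcrit_def by blast
  then obtain v where v: "v \<in> U" by blast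
  obtain c where c0: "\<forall>x\<in>U - {v}. c x < (2::nat)"
    "\<forall>x\<in>U - {v}. \<forall>w\<in>U - {v}. E x w \<longrightarrow> c x \<noteq> c w"
    using vcrit_colouring[OF U(2) v] by blast
  note c = c0[rule_format]
  have "\<exists>x\<in>U. E v x \<and> c x = a" if "a < 2" for a
  proof (rule ccontr)
    assume n: "\<not> ?thesis"
    have "colb 2 U" by (rule colb_insert[OF c that]) (use n in auto)
    then show False using U(2) unfolding vcrit_def by blast
  qed
  from this[of 0] this[of 1] obtain x y where
    xy: "x \<in> U" "E v x" "c x = 0" "y \<in> U" "E v y" "c y = 1" by auto
  then have "x \<in> U - {v}" "y \<in> U - {v}" using irr by auto
  then obtain n where n: "pth (U - {v}) x y n" using vcrit_connected[OF U(2)] by blast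
  have "odd n" using pth_colour_parity[OF n, of c] c xy by auto
  have "x \<noteq> y" using xy(3,6) by auto
  then have "1 \<le> n" using pth_pos[OF n] by blast
  have "pth (insert v (U - {v})) v y (n + 1)" by (rule pth_cons[OF xy(2) n]) simp
  from cyc_close[OF this sym[OF xy(5)]] obtain d where "cyc d (n + 1 + 1)" using \<open>1 \<le> n\<close> by auto
  then have "n + 1 + 1 \<in> OL" using \<open>odd n\<close> unfolding OL_def by auto
  then show ?thesis by blast
qed

end

section \<open>Two disjoint paths\<close>

locale two_connected = sgraph +
  assumes conn: "u \<in> V - {z} \<Longrightarrow> v \<in> V - {z} \<Longrightarrow> \<exists>n. pth (V - {z}) u v n"
begin

definition fork :: "'a \<Rightarrow> 'a set \<Rightarrow> 'a set \<Rightarrow> 'a \<Rightarrow> 'a set \<Rightarrow> 'a \<Rightarrow> bool" where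
  "fork u X Y a Z b \<longleftrightarrow> a \<noteq> b \<and> (\<exists>l. pth Y u a l) \<and> (\<exists>m. pth Z u b m) \<and> Y \<inter> Z = {u} \<and>
     Y \<inter> X = {a} \<and> Z \<inter> X = {b} \<and> Y \<subseteq> V \<and> Z \<subseteq> V"

text \<open>A path of length 0 is allowed, so a common vertex of \<open>Z\<close> and
  \<open>C\<close> can serve as one of the two paths.\<close>

definition link :: "'a set \<Rightarrow> 'a set \<Rightarrow> 'a set \<Rightarrow> 'a \<Rightarrow> 'a \<Rightarrow> 'a set \<Rightarrow> 'a \<Rightarrow> 'a \<Rightarrow> bool" where
  "link Z C P a c Q b d \<longleftrightarrow> a \<noteq> b \<and> c \<noteq> d \<and> (\<exists>l. pth P a c l) \<and> (\<exists>m. pth Q b d m) \<and> P \<inter> Q = {} \<and>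
    P \<inter> Z = {a} \<and> P \<inter> C = {c} \<and> Q \<inter> Z = {b} \<and> Q \<inter> C = {d} \<and> P \<subseteq> V \<and> Q \<subseteq> V"

text \<open>Menger's theorem for two paths, by induction along a path from \<open>u\<close> to
  \<open>X\<close>: a fork at the next vertex \<open>u'\<close> is moved back to \<open>u\<close>.
  One leg is prolonged by the edge from \<open>u\<close> to \<open>u'\<close>; the other is entered
  by a path that avoids \<open>u'\<close>.\<close>

lemma fan:
  assumes "pth V u x (int n)" "x \<in> X" "u \<notin> X" "X \<subseteq> V" "\<And>z. \<exists>y\<in>X. y \<noteq> z"
  shows "\<exists>a b Y Z. fork u X Y a Z b"
  using assms(1,3)
proof (induction n arbitrary: u)
  case 0
  then have "u = x" using pth_zero[of V u x] by simp
  then show ?case using 0 assms(2) by simp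
next
  case (Suc n)
  have uV: "u \<in> V" using Suc.prems pth_ends by blast
  obtain f where f: "inj_on f {0..int (Suc n)}" "f ` {0..int (Suc n)} \<subseteq> V" "f 0 = u" "f (int (Suc n)) = x"
     "\<And>i. 0 \<le> i \<Longrightarrow> i < int (Suc n) \<Longrightarrow> E (f i) (f (i + 1))"
    using Suc.prems(1) unfolding pth_def by blast
  define u' where "u' = f 1"
  have E: "E u u'" using f(3) f(5)[of 0] by (simp add: u'_def)
  have ne: "u \<noteq> u'" using E irr by auto
  have u'V: "u' \<in> V" using E EV2 by blast
  have "pth (f ` {1..int (Suc n)}) (f 1) (f (int (Suc n))) (int (Suc n) - 1)"
    using f by (intro pth_seg) (auto simp: inj_on_def)
  then have p': "pth V u' x (int n)" using f(2,4) pth_mono[of "f ` {1..int (Suc n)}"]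
    by (simp add: u'_def image_subset_iff)
  show ?case
  proof (cases "u' \<in> X")
    case True
    obtain y where y: "y \<in> X" "y \<noteq> u'" using assms(5) by blast
    then obtain l where l: "pth (V - {u'}) u y l" using conn[of u u' y] uV ne assms(4) by auto
    obtain Y b m where Y: "Y \<subseteq> V - {u'}" "pth Y u b m" "Y \<inter> X = {b}"
      using pth_first_hit[OF l y(1)] by metis
    have "u' \<noteq> b" "{u,u'} \<inter> Y = {u}" using Y pth_ends[OF Y(2)] by auto
    moreover have "{u,u'} \<inter> X = {u'}" using True Suc.prems by auto
    ultimately have "fork u X {u,u'} u' Y b" unfolding fork_def
      using Y pth_edge[OF E] uV u'V by auto
    then show ?thesis by blast
  next
    case False
    from Suc.IH[OF p' False] obtain a b Q R where Q: "fork u' X Q a R b" by (elim exE)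
    obtain l m where lm: "pth Q u' a l" "pth R u' b m" using Q unfolding fork_def by (elim exE conjE) (rule that; assumption)
    have Qp: "a \<noteq> b" "Q \<inter> R = {u'}" "Q \<inter> X = {a}" "R \<inter> X = {b}" "Q \<subseteq> V" "R \<subseteq> V"
      using Q unfolding fork_def by auto
    obtain Q' where Q': "Q' \<subseteq> Q" "pth Q' u' a l" "\<forall>w\<in>Q'. w \<noteq> u' \<longrightarrow> (\<exists>m. pth (Q' - {u'}) w a m)"
      using pth_suffix[OF lm(1)] by (elim exE conjE) (rule that; assumption)
    obtain R' where R': "R' \<subseteq> R" "pth R' u' b m" "\<forall>w\<in>R'. w \<noteq> u' \<longrightarrow> (\<exists>m. pth (R' - {u'}) w b m)"
      using pth_suffix[OF lm(2)] by (elim exE conjE) (rule that; assumption)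
    have X: "Q' \<inter> X = {a}" "R' \<inter> X = {b}" "Q' \<inter> R' = {u'}" "Q' \<subseteq> V" "R' \<subseteq> V"
      using Qp Q'(1) R'(1) pth_ends[OF Q'(2)] pth_ends[OF R'(2)] by auto
    have RQ: "R' \<inter> Q' = {u'}" using X(3) by auto
    have ux: "u \<notin> X" by fact
    \<comment> \<open>\<open>S\<close> leads from \<open>u\<close> to the leg \<open>Q'\<close> and
      follows it to \<open>a\<close>; the edge to \<open>u'\<close> and then \<open>R'\<close> form
      the other leg. The legs are variables because the step is also used with them
      exchanged.\<close>
    have step: "\<exists>a b Y Z. fork u X Y a Z b"
      if QQ: "w \<in> Q'" "w \<noteq> u'" "\<exists>i. pth S u w i" "S \<inter> (Q' \<union> R' \<union> X) = {w}" "S \<subseteq> V - {u'}" "u \<notin> R'"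
        "a \<noteq> b" "pth R' u' b m" "\<forall>w\<in>Q'. w \<noteq> u' \<longrightarrow> (\<exists>m. pth (Q' - {u'}) w a m)"
        "Q' \<inter> X = {a}" "R' \<inter> X = {b}" "Q' \<inter> R' = {u'}" "Q' \<subseteq> V" "R' \<subseteq> V"
      for w S a b Q' R' m
    proof -
      obtain i where i: "pth S u w i" using QQ(3) by (elim exE)
      obtain m1 where m1: "pth (Q' - {u'}) w a m1" using QQ(1,2,9) by auto
      have "S \<inter> (Q' - {u'}) \<subseteq> {w}" using QQ(4) by auto
      then have 1: "pth (S \<union> (Q' - {u'})) u a (i + m1)" using pth_trans[OF i m1] by blast
      have "w \<notin> R'" using QQ(1,2,12) by auto
      then have 2: "(S \<union> (Q' - {u'})) \<inter> insert u R' = {u}"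
        using QQ(4,6,12) pth_ends[OF i] by auto
      have "S \<inter> X \<subseteq> {a}" using QQ(1,4,10) by auto
      then have 3: "(S \<union> (Q' - {u'})) \<inter> X = {a}" using QQ(10) False by auto
      have 4: "pth (insert u R') u b (m + 1)" using pth_cons[OF E QQ(8) QQ(6)] .
      have 5: "insert u R' \<inter> X = {b}" "S \<union> (Q' - {u'}) \<subseteq> V" "insert u R' \<subseteq> V"
        using ux uV QQ(5,11,13,14) by auto
      have "fork u X (S \<union> (Q' - {u'})) a (insert u R') b"
        unfolding fork_def using 1 2 3 4 5 QQ(7) by blast
      then show ?thesis by blast
    qed
    consider "u \<in> Q'" | "u \<in> R'" "u \<notin> Q'" | "u \<notin> Q'" "u \<notin> R'" by blast
    then show ?thesis
    proof cases
      case 1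
      have p: "\<exists>i. pth {u} u u i" using pth_refl by blast
      have "u \<notin> R'" using 1 X(3) ne by auto
      then show ?thesis
        by (intro step[of u Q' "{u}" R' a b m]) (use p 1 ne uV X Qp(1) R'(2) Q'(3) in auto)
    next
      case 2
      have p: "\<exists>i. pth {u} u u i" using pth_refl by blast
      show ?thesis
        by (intro step[of u R' "{u}" Q' b a l]) (use p 2 ne uV X RQ Qp(1) Q'(2) R'(3) in auto)
    next
      case 3
      have "a \<in> V - {u'}" using X False assms(4) by auto
      then obtain j where j: "pth (V - {u'}) u a j" using conn[of u u' a] uV ne by auto
      have "a \<in> Q' \<union> R' \<union> X" using X by auto
      from pth_first_hit[OF j this] obtain S w i where S: "S \<subseteq> V - {u'}" "pth S u w i" "S \<inter> (Q' \<union> R' \<union> X) = {w}"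
        by metis
      have wu: "w \<noteq> u'" "u \<in> S" "w \<in> S" using S(1) pth_ends[OF S(2)] by auto
      have S': "S \<inter> (R' \<union> Q' \<union> X) = {w}" using S(3) by auto
      consider "w \<in> Q'" | "w \<in> R'" "w \<notin> Q'" | "w \<in> X" "w \<notin> Q'" "w \<notin> R'" using S(3) by auto
      then show ?thesis
      proof cases
        case 1
        have p: "\<exists>i. pth S u w i" using S(2) by blast
        show ?thesis
          by (rule step[of w Q' S R' a b m]) (use p 1 wu S(1,3) 3 X Qp(1) R'(2) Q'(3) in simp_all)
      next
        case 2
        have p: "\<exists>i. pth S u w i" using S(2) by blast
        show ?thesis
          by (rule step[of w R' S Q' b a l]) (use p 2 wu S(1) S' 3 X RQ Qp(1) Q'(2) R'(3) in simp_all)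
      next
        case c: 3
        have "S \<inter> insert u R' = {u}" "S \<inter> X = {w}" using S(3) c wu ux by auto
        moreover have "insert u R' \<inter> X = {b}" "S \<subseteq> V" "insert u R' \<subseteq> V" "w \<noteq> b"
          using S(1) c X ux uV by auto
        moreover have "pth (insert u R') u b (m + 1)" using pth_cons[OF E R'(2)] 3 by blast
        ultimately have "fork u X S w (insert u R') b" unfolding fork_def using S(2) by blast
        then show ?thesis by blast
      qed
    qed
  qed
qed

text \<open>The legs of a fan from a vertex \<open>u\<close> of \<open>C\<close> to \<open>Z\<close>
  are followed from \<open>Z\<close> and stopped at their first vertex in \<open>C\<close>. If both
  stop at \<open>u\<close>, a path from another vertex of \<open>C\<close> that avoids
  \<open>u\<close> supplies a different end for one of them.\<close>

lemma two_disjoint_paths: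
  assumes "C \<subseteq> V" "Z \<subseteq> V" "C \<inter> Z = {}" "\<And>z. \<exists>y\<in>C. y \<noteq> z" "\<And>z. \<exists>y\<in>Z. y \<noteq> z"
  shows "\<exists>a b c d P Q. link Z C P a c Q b d"
proof -
  obtain u where u: "u \<in> C" using assms(4) by blast
  obtain z where z: "z \<in> Z" "z \<noteq> u" using assms(5) by blast
  have "\<exists>n. pth V u z n"
  proof (cases "\<exists>y\<in>V. y \<noteq> u \<and> y \<noteq> z")
    case True
    then obtain y where "y \<noteq> u" "y \<noteq> z" by blast
    then show ?thesis using conn[of u y z] u z assms(1,2) pth_mono[of "V - {y}" u z _ V] by blast
  next
    case False
    then show ?thesis using assms u z by (metis disjoint_iff subsetD)
  qed
  then obtain n where "pth V u z n" by blast
  then have "pth V u z (int (nat n))" using pth_nonneg by fastforce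
  moreover have "u \<notin> Z" using u assms by blast
  ultimately obtain a b Y1 Y2 where "fork u Z Y1 a Y2 b"
    using fan[of u z "nat n" Z] z assms(2,5) by blast
  then obtain l1 l2 where Y: "a \<noteq> b" "pth Y1 u a l1" "pth Y2 u b l2" "Y1 \<inter> Y2 = {u}"
     "Y1 \<inter> Z = {a}" "Y2 \<inter> Z = {b}" "Y1 \<subseteq> V" "Y2 \<subseteq> V" unfolding fork_def by auto
  obtain P c l where P: "P \<subseteq> Y1" "pth P a c l" "P \<inter> C = {c}"
    using pth_first_hit[OF pth_sym[OF Y(2)] u] by metis
  obtain Q d m where Q: "Q \<subseteq> Y2" "pth Q b d m" "Q \<inter> C = {d}"
    using pth_first_hit[OF pth_sym[OF Y(3)] u] by metis
  have PZ: "P \<inter> Z = {a}" "Q \<inter> Z = {b}" "P \<subseteq> V" "Q \<subseteq> V"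
    using P(1) Q(1) Y pth_ends[OF P(2)] pth_ends[OF Q(2)] by auto
  show ?thesis
  proof (cases "c = d")
    case False
    have "P \<inter> Q \<subseteq> {u}" using P(1) Q(1) Y(4) by auto
    then have "P \<inter> Q = {}" using P(3) Q(3) u False by auto
    then have "link Z C P a c Q b d" unfolding link_def using P Q PZ Y(1) False by auto
    then show ?thesis by blast
  next
    case True
    have "c \<in> Y1 \<inter> Y2" using P(1) Q(1) pth_ends[OF P(2)] pth_ends[OF Q(2)] True by auto
    then have cu: "c = u" "d = u" using True Y(4) by auto
    obtain P' where P': "P' \<subseteq> P" "pth P' a u l" "\<forall>w\<in>P'. w \<noteq> u \<longrightarrow> (\<exists>m. pth (P' - {u}) a w m)"
      using pth_prefix[OF P(2)[unfolded cu]] by (elim exE conjE) (rule that; assumption)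
    obtain Q' where Q': "Q' \<subseteq> Q" "pth Q' b u m" "\<forall>w\<in>Q'. w \<noteq> u \<longrightarrow> (\<exists>m. pth (Q' - {u}) b w m)"
      using pth_prefix[OF Q(2)[unfolded cu]] by (elim exE conjE) (rule that; assumption)
    have PQ: "P' \<subseteq> Y1" "Q' \<subseteq> Y2" using P'(1) Q'(1) P(1) Q(1) by auto
    have X: "P' \<inter> Z = {a}" "P' \<inter> C = {u}" "Q' \<inter> Z = {b}" "Q' \<inter> C = {u}" "P' \<inter> Q' = {u}" "P' \<subseteq> V" "Q' \<subseteq> V"
      using P'(1) Q'(1) P(3) Q(3) PZ cu Y(4) PQ pth_ends[OF P'(2)] pth_ends[OF Q'(2)] by auto
    obtain e where e: "e \<in> C" "e \<noteq> u" using assms(4) by blast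
    have au: "a \<noteq> u" "b \<noteq> u" using X u assms(3) by auto
    have "e \<in> V - {u}" "a \<in> V - {u}" using e assms(1) X au by auto
    then obtain j where j: "pth (V - {u}) e a j" using conn[of e u a] by auto
    have "a \<in> Z \<union> P' \<union> Q'" using X by auto
    from pth_first_hit[OF j this] obtain R w i where R: "R \<subseteq> V - {u}" "pth R e w i" "R \<inter> (Z \<union> P' \<union> Q') = {w}"
      by metis
    obtain S f h where S: "S \<subseteq> R" "pth S w f h" "S \<inter> C = {f}"
      using pth_first_hit[OF pth_sym[OF R(2)] e(1)] by metis
    have w0: "w \<in> S" "f \<in> S" "f \<in> C" using pth_ends[OF S(2)] S(3) by auto
    have w: "w \<in> S" "w \<noteq> u" "f \<noteq> u" "f \<in> C" using S(1) R(1) w0 by auto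
    have SX: "S \<inter> (Z \<union> P' \<union> Q') = {w}" "S \<subseteq> V" using S(1) R(1,3) w by auto
    have step: "link Z C ((P' - {u}) \<union> S) a f Q' b u"
      if h: "w \<in> P'" "\<forall>w\<in>P'. w \<noteq> u \<longrightarrow> (\<exists>m. pth (P' - {u}) a w m)" "\<exists>m. pth Q' b u m"
       "P' \<inter> Z = {a}" "P' \<inter> C = {u}" "Q' \<inter> Z = {b}" "Q' \<inter> C = {u}" "P' \<inter> Q' = {u}" "P' \<subseteq> V" "Q' \<subseteq> V"
       "a \<noteq> b" "a \<noteq> u" "S \<inter> (Z \<union> P' \<union> Q') = {w}"
      for P' a Q' b
    proof -
      obtain m1 where m1: "pth (P' - {u}) a w m1" using h(1,2) w(2) by auto
      have "(P' - {u}) \<inter> S \<subseteq> {w}" using h(13) by auto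
      then have 1: "pth ((P' - {u}) \<union> S) a f (m1 + h)" using pth_trans[OF m1 S(2)] by blast
      have "w \<notin> Q'" using h(1,8) w(2) by auto
      then have 2: "((P' - {u}) \<union> S) \<inter> Q' = {}" using h(8,13) by auto
      have "S \<inter> Z \<subseteq> {a}" using h(1,4,13) by auto
      then have 3: "((P' - {u}) \<union> S) \<inter> Z = {a}" using h(4,12) by auto
      have 4: "((P' - {u}) \<union> S) \<inter> C = {f}" using S(3) h(5) by auto
      show ?thesis unfolding link_def using 1 2 3 4 h w(3) SX(2) by auto
    qed
    have SX2: "S \<inter> (Z \<union> Q' \<union> P') = {w}" using SX by auto
    consider "w \<in> P'" | "w \<in> Q'" | "w \<in> Z" "w \<notin> P'" "w \<notin> Q'" using SX by auto
    then show ?thesis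
    proof cases
      case 1
      have "link Z C ((P' - {u}) \<union> S) a f Q' b u"
        by (rule step) (use 1 P' Q' X Y(1) au SX in auto)
      then show ?thesis by blast
    next
      case 2
      have "link Z C ((Q' - {u}) \<union> S) b f P' a u"
        by (rule step) (use 2 P' Q' X Y(1) au SX2 in auto)
      then show ?thesis by blast
    next
      case 3
      have "S \<inter> Q' = {}" "w \<noteq> b" "S \<inter> Z = {w}" using SX 3 X by auto
      then have "link Z C S w f Q' b u" unfolding link_def using S(2,3) Q'(2) X w(3) SX(2) by auto
      then show ?thesis by blast
    qed
  qed
qed

end

section \<open>Longest odd cycles\<close>

text \<open>What a vertex-critical subgraph of a counterexample satisfies; the locale is refuted by
  \<open>odd_critical_False\<close>.\<close>

locale odd_critical = two_connected V E for V :: "'a set" and E +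
  fixes k :: nat
  assumes k2: "2 \<le> k"
    and card_OL: "card OL \<le> k"
    and OL_ne: "OL \<noteq> {}"
    and mindeg: "v \<in> V \<Longrightarrow> 2 * k \<le> card {u. E v u}"
    and no_twin: "u \<in> V \<Longrightarrow> v \<in> V \<Longrightarrow> u \<noteq> v \<Longrightarrow> \<not> E u v \<Longrightarrow> \<not> {x. E u x} \<subseteq> {x. E v x}"
    and no_clique: "S \<subseteq> V \<Longrightarrow> card S = 2 * k + 1 \<Longrightarrow> \<exists>u\<in>S. \<exists>v\<in>S. u \<noteq> v \<and> \<not> E u v"
begin

definition M :: int where "M = Max OL"

lemma M_OL: "M \<in> OL" unfolding M_def using finite_OL OL_ne by (rule Max_in)
lemma OL_le: "m \<in> OL \<Longrightarrow> m \<le> M" unfolding M_def using finite_OL by (rule Max_ge)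
lemma M3: "3 \<le> M" using M_OL OL_ge3 by blast
lemma M_odd: "odd M" using M_OL OL_odd by blast

lemma cyc_OL: "cyc c m \<Longrightarrow> odd m \<Longrightarrow> m \<in> OL" unfolding OL_def by blast

text \<open>Counterpart of \<open>pth\<close> with named vertices, for arguments about positions.
  Values outside \<open>{0..n}\<close> are arbitrary.\<close>

definition ipath :: "(int \<Rightarrow> 'a) \<Rightarrow> int \<Rightarrow> bool" where
  "ipath p n \<longleftrightarrow> 0 \<le> n \<and> inj_on p {0..n} \<and> (\<forall>i. 0 \<le> i \<and> i < n \<longrightarrow> E (p i) (p (i + 1)))"

lemma ipath_seg:
  assumes "ipath p n" "0 \<le> i" "i \<le> j" "j \<le> n"
  shows "pth (p ` {i..j}) (p i) (p j) (j - i)"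
proof (rule pth_seg)
  show "inj_on p {i..j}" using assms inj_on_subset[of p "{0..n}" "{i..j}"] unfolding ipath_def by auto
qed (use assms in \<open>auto simp: ipath_def\<close>)

lemma ipath_eq: "ipath p n \<Longrightarrow> 0 \<le> i \<Longrightarrow> i \<le> n \<Longrightarrow> 0 \<le> j \<Longrightarrow> j \<le> n \<Longrightarrow> p i = p j \<longleftrightarrow> i = j"
  unfolding ipath_def inj_on_def by auto

lemma ipath_edge: "ipath p n \<Longrightarrow> 0 \<le> i \<Longrightarrow> i < n \<Longrightarrow> E (p i) (p (i + 1))"
  unfolding ipath_def by auto

lemma star_cyc:
  assumes "ipath p n" "E (p 0) (p a)" "E (p 0) (p b)" "0 < a" "a < b" "b \<le> n"
  shows "\<exists>c. cyc c (b - a + 2) \<and> range c \<subseteq> p ` {0..n}"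
proof -
  have s: "pth (p ` {a..b}) (p a) (p b) (b - a)" using ipath_seg assms by simp
  have "p 0 \<noteq> p x" if "x \<in> {a..b}" for x
    using ipath_eq[OF assms(1), of 0 x] assms that by auto
  then have "p 0 \<notin> p ` {a..b}" by (metis imageE)
  from pth_cons[OF assms(2) s this] have "pth (insert (p 0) (p ` {a..b})) (p 0) (p b) (b - a + 1)" .
  from cyc_close[OF this sym[OF assms(3)]] assms obtain c where
    "cyc c (b - a + 1 + 1)" "range c \<subseteq> insert (p 0) (p ` {a..b})" by auto
  moreover have "insert (p 0) (p ` {a..b}) \<subseteq> p ` {0..n}" using assms by auto
  moreover have "b - a + 1 + 1 = b - a + 2" by simp
  ultimately show ?thesis by (metis subset_trans)
qed

lemma star:
  assumes "ipath p n" "E (p 0) (p a)" "E (p 0) (p b)" "0 < a" "0 < b" "a \<le> n" "b \<le> n" "odd (a - b)"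
  shows "\<bar>a - b\<bar> + 2 \<in> OL"
proof -
  consider "a < b" | "b < a" using assms(8) by fastforce
  then show ?thesis
  proof cases
    case 1
    then obtain c where "cyc c (b - a + 2)" using star_cyc[OF assms(1,2,3)] assms by auto
    moreover have "odd (b - a + 2)" using assms(8) by simp
    ultimately show ?thesis using cyc_OL 1 by (auto simp: abs_if)
  next
    case 2
    then obtain c where "cyc c (a - b + 2)" using star_cyc[OF assms(1,3,2)] assms by auto
    moreover have "odd (a - b + 2)" using assms(8) by simp
    ultimately show ?thesis using cyc_OL 2 by (auto simp: abs_if)
  qed
qed

lemma star1:
  assumes "ipath p n" "E (p 0) (p a)" "0 < a" "a \<le> n" "even a"
  shows "a + 1 \<in> OL"
proof -
  have "1 < a" using assms(3,5) by (cases "a = 1") auto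
  moreover have "E (p 0) (p 1)" using ipath_edge[OF assms(1), of 0] assms(3,4) by simp
  ultimately show ?thesis using star[OF assms(1,2), of 1] assms by (simp add: add.commute)
qed

text \<open>The even neighbour positions \<open>a\<close> give the lengths \<open>a + 1\<close>, the odd ones \<open>b\<close> the lengths
  \<open>n - b + 2\<close>; as there are \<open>2k\<close> positions and at most \<open>k\<close> lengths, both maps are onto.\<close>

lemma good_vertex:
  assumes p: "ipath p n" and nb: "{u. E (p 0) u} \<subseteq> p ` {1..n}" and last: "E (p 0) (p n)" and "even n" "0 < n"
  shows "n = M - 1"
    and "\<And>a. 0 < a \<Longrightarrow> a < M \<Longrightarrow> even a \<Longrightarrow> E (p 0) (p a) \<longleftrightarrow> a + 1 \<in> OL"
    and "\<And>b. 0 < b \<Longrightarrow> b < M \<Longrightarrow> odd b \<Longrightarrow> E (p 0) (p b) \<longleftrightarrow> M - b + 1 \<in> OL"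
    and "\<And>a b. a + 1 \<in> OL \<Longrightarrow> b + 1 \<in> OL \<Longrightarrow> \<bar>a + b - M\<bar> + 2 \<in> OL"
    and "card OL = k"
proof -
  define A where "A = {a. 0 < a \<and> a \<le> n \<and> even a \<and> E (p 0) (p a)}"
  define B where "B = {a. 0 < a \<and> a \<le> n \<and> odd a \<and> E (p 0) (p a)}"
  have f: "finite A" "finite B" by (rule finite_subset[of _ "{0..n}"]; auto simp: A_def B_def)+
  have A: "(\<lambda>a. a + 1) ` A \<subseteq> OL" using star1[OF p] by (auto simp: A_def)
  have "n - b + 2 \<in> OL" if "b \<in> B" for b
    using star[OF p last, of b] that assms(4,5) by (auto simp: B_def)
  then have B: "(\<lambda>b. n - b + 2) ` B \<subseteq> OL" by auto
  have cA: "card A \<le> card OL" using card_mono[OF finite_OL A] by (simp add: card_image)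
  have cB: "card B \<le> card OL"
    using card_mono[OF finite_OL B] by (simp add: card_image inj_on_def)
  have "p ` (A \<union> B) = {u. E (p 0) u}" using nb by (fastforce simp: A_def B_def)
  moreover have "p 0 \<in> V" using last EV by blast
  ultimately have "2 * k \<le> card (p ` (A \<union> B))" using mindeg by simp
  also have "\<dots> \<le> card A + card B" using card_image_le[of "A \<union> B" p] card_Un_le[of A B] f by simp
  finally have c: "card A = card OL" "card B = card OL" "card OL = k" using cA cB card_OL by linarith+
  then show "card OL = k" by simp
  have A': "(\<lambda>a. a + 1) ` A = OL"
    using card_subset_eq[OF finite_OL A] c by (simp add: card_image)
  have B': "(\<lambda>b. n - b + 2) ` B = OL"
    using card_subset_eq[OF finite_OL B] c by (simp add: card_image inj_on_def)
  \<comment> \<open>Position \<open>n\<close> contributes the length \<open>n + 1\<close>, and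
    \<open>M\<close> must come from an even position up to \<open>n\<close>; hence
    \<open>n = M - 1\<close>.\<close>
  have "n \<in> A" using assms by (simp add: A_def)
  then have "n + 1 \<in> OL" using A' by auto
  moreover have "M \<in> (\<lambda>a. a + 1) ` A" using M_OL A' by simp
  then have "M \<le> n + 1" by (auto simp: A_def)
  ultimately show n: "n = M - 1" using OL_le[of "n + 1"] by simp
  show 1: "E (p 0) (p a) \<longleftrightarrow> a + 1 \<in> OL" if "0 < a" "a < M" "even a" for a
  proof -
    have "E (p 0) (p a) \<longleftrightarrow> a \<in> A" using that n by (auto simp: A_def)
    also have "\<dots> \<longleftrightarrow> a + 1 \<in> OL" unfolding A'[symmetric] by (simp add: image_iff)
    finally show ?thesis .
  qed
  show 2: "E (p 0) (p b) \<longleftrightarrow> M - b + 1 \<in> OL" if "0 < b" "b < M" "odd b" for b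
  proof -
    have "E (p 0) (p b) \<longleftrightarrow> b \<in> B" using that n by (auto simp: B_def)
    also have "\<dots> \<longleftrightarrow> n - b + 2 \<in> OL" unfolding B'[symmetric] by (simp add: image_iff)
    finally show ?thesis using n by (simp add: algebra_simps)
  qed
  show "\<bar>a + b - M\<bar> + 2 \<in> OL" if ab: "a + 1 \<in> OL" "b + 1 \<in> OL" for a b
  proof -
    have *: "even x \<and> 0 < x \<and> x < M" if "x + 1 \<in> OL" for x
      using OL_odd[OF that] OL_ge3[OF that] OL_le[OF that] by simp
    have "E (p 0) (p a)" using 1 *[OF ab(1)] ab by blast
    \<comment> \<open>The closure property comes from the odd cycle through the even position
      \<open>a\<close> and the odd position \<open>M - b\<close>.\<close>
    moreover have "odd (M - b)" "0 < M - b" "M - b < M" using *[OF ab(2)] M_odd by auto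
    then have "E (p 0) (p (M - b))" using 2[of "M - b"] ab(2) by simp
    moreover have "odd (a - (M - b))" using *[OF ab(1)] *[OF ab(2)] M_odd by simp
    ultimately have "\<bar>a - (M - b)\<bar> + 2 \<in> OL"
      using star[OF p, of a "M - b"] *[OF ab(1)] *[OF ab(2)] n by auto
    then show ?thesis by (simp add: algebra_simps)
  qed
qed

lemma two_arcs:
  assumes "cyc c m" "u \<in> range c" "v \<in> range c" "u \<noteq> v"
  shows "\<exists>g. 1 \<le> g \<and> g < m \<and> pth (range c) u v g \<and> pth (range c) u v (m - g)"
proof -
  have m: "3 \<le> m" using assms(1) by (simp add: cyc_def)
  obtain i j' where i: "u = c i" and j': "v = c j'" using assms by auto
  define j where "j = i + (j' - i) mod m"
  have "j mod m = j' mod m" by (simp add: j_def mod_add_right_eq)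
  then have j: "v = c j" using j' assms(1) by (simp add: cyc_def)
  have b: "0 \<le> (j' - i) mod m" "(j' - i) mod m < m" using m by auto
  have ij: "i < j" "j < i + m" using b i j assms(4) by (auto simp: j_def order_le_less)
  have mono: "pth (c ` S) x y t \<Longrightarrow> pth (range c) x y t" for S x y t
    by (rule pth_mono) auto
  have "pth (range c) u v (j - i)"
    using mono[OF cyc_seg[OF assms(1), of i j]] ij i j by auto
  moreover have "pth (c ` {j..i+m}) (c j) (c (i+m)) (i + m - j)"
    using cyc_seg[OF assms(1), of j "i+m"] ij by auto
  then have "pth (range c) v u (i + m - j)" using cyc_period[OF assms(1)] i j mono by auto
  then have "pth (range c) u v (i + m - j)" by (rule pth_sym)
  moreover have "i + m - j = m - (j - i)" by simp
  ultimately show ?thesis using ij by (intro exI[of _ "j - i"]) auto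
qed

text \<open>The two arcs have opposite parity, and so have the two paths. Each path closes up to an
  odd cycle with an arc of its own; together these cycles have length \<open>s + t + M\<close>, so
  one is longer than \<open>M\<close>. The two paths may overlap each other.\<close>

lemma no_long_ears:
  assumes c: "cyc c M" and uv: "u \<in> range c" "v \<in> range c" "u \<noteq> v"
    and X: "pth X u v s" "X \<inter> range c \<subseteq> {u,v}" and Y: "pth Y u v t" "Y \<inter> range c \<subseteq> {u,v}"
    and st: "odd (s + t)" "M + 2 \<le> s + t"
  shows False
proof -
  obtain g where g: "1 \<le> g" "g < M" "pth (range c) u v g" "pth (range c) u v (M - g)"
    using two_arcs[OF c uv] by blast
  have s1: "1 \<le> s" "1 \<le> t" using pth_pos[OF X(1) uv(3)] pth_pos[OF Y(1) uv(3)] by auto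
  have cl: "x + y \<le> M" if h: "pth Z u v x" "Z \<inter> range c \<subseteq> {u,v}" "pth (range c) u v y" "odd (x + y)" "1 \<le> x" "1 \<le> y"
    for Z x y
  proof -
    have "3 \<le> x + y" using h(4-6) by (cases "x + y = 2") auto
    then obtain d where "cyc d (x + y)" using cyc_close2[OF h(1,3) _ uv(3)] h(2) by auto
    then show ?thesis using cyc_OL h(4) OL_le by blast
  qed
  show False
  proof (cases "odd (s + g)")
    case True
    then have "odd (t + (M - g))" using st(1) M_odd by auto
    then show False using cl[OF X g(3)] cl[OF Y g(4)] True s1 g(1,2) st(2) by auto
  next
    case False
    then have "odd (t + g)" "odd (s + (M - g))" using st(1) M_odd by auto
    then show False using cl[OF Y g(3)] cl[OF X g(4)] s1 g(1,2) st(2) by auto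
  qed
qed

lemma cyc_two_points: "cyc c m \<Longrightarrow> \<exists>y\<in>range c. y \<noteq> z"
proof -
  assume c: "cyc c m"
  then have "c 0 \<noteq> c 1" using irr unfolding cyc_def by (metis add_0)
  then show ?thesis by (metis rangeI)
qed

text \<open>Otherwise two connections between the cycles, one of them possibly the common vertex,
  extend the two arcs of \<open>d\<close> to paths as in \<open>no_long_ears\<close>: their lengths
  sum to \<open>M\<close> plus twice the total length of the connections.\<close>

lemma longest_odd_cycles_meet:
  assumes c: "cyc c M" and d: "cyc d M"
  shows "\<not> range c \<inter> range d \<subseteq> {z}"
proof
  assume sub: "range c \<inter> range d \<subseteq> {z}"
  show False
  proof (cases "range c \<inter> range d = {}")
    case True
    have "\<exists>a b x y P Q. link (range d) (range c) P a x Q b y"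
      using two_disjoint_paths[OF cyc_in_V[OF c] cyc_in_V[OF d] True] cyc_two_points[OF c] cyc_two_points[OF d] by blast
    then obtain a b x y P Q where "link (range d) (range c) P a x Q b y" by (elim exE)
    then have ne: "a \<noteq> b" "x \<noteq> y" "P \<inter> Q = {}" "P \<inter> range d = {a}" "P \<inter> range c = {x}"
       "Q \<inter> range d = {b}" "Q \<inter> range c = {y}" and ex: "\<exists>l. pth P a x l" "\<exists>m. pth Q b y m"
      unfolding link_def by auto
    obtain l m where P: "pth P a x l" and Q: "pth Q b y m" using ex by (elim exE)
    have in': "x \<in> range c" "y \<in> range c" "a \<in> range d" "b \<in> range d" using ne by auto
    then have "a \<noteq> x" "b \<noteq> y" using True by auto
    then have lm: "1 \<le> l" "1 \<le> m" using pth_pos P Q by blast+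
    obtain h where h: "1 \<le> h" "h < M" "pth (range d) a b h" "pth (range d) a b (M - h)"
      using two_arcs[OF d in'(3,4) ne(1)] by blast
    have ear: "pth (P \<union> range d \<union> Q) x y (l + t + m)" if "pth (range d) a b t" for t
    proof -
      have "pth (P \<union> range d) x b (l + t)" using pth_trans[OF pth_sym[OF P] that] ne(4) by simp
      moreover have "(P \<union> range d) \<inter> Q \<subseteq> {b}" using ne(3,6) by auto
      ultimately show ?thesis using pth_trans[OF _ Q] by blast
    qed
    have int: "(P \<union> range d \<union> Q) \<inter> range c \<subseteq> {x,y}" using ne(5,7) True by auto
    show False
      by (rule no_long_ears[OF c in'(1,2) ne(2) ear[OF h(3)] int ear[OF h(4)] int])
        (use lm M_odd in \<open>auto\<close>)
  next
    case False
    then have z: "range c \<inter> range d = {z}" using sub by auto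
    obtain a0 where a0: "a0 \<in> range d" "a0 \<noteq> z" using cyc_two_points[OF d] by blast
    obtain x0 where x0: "x0 \<in> range c" "x0 \<noteq> z" using cyc_two_points[OF c] by blast
    have "a0 \<in> V - {z}" "x0 \<in> V - {z}" using a0 x0 cyc_in_V[OF c] cyc_in_V[OF d] by auto
    then obtain j where j: "pth (V - {z}) a0 x0 j" using conn by blast
    obtain Y x i where Y: "Y \<subseteq> V - {z}" "pth Y a0 x i" "Y \<inter> range c = {x}"
      using pth_first_hit[OF j x0(1)] by metis
    obtain P a l where P: "P \<subseteq> Y" "pth P x a l" "P \<inter> range d = {a}"
      using pth_first_hit[OF pth_sym[OF Y(2)] a0(1)] by metis
    have xa: "x \<in> range c" "a \<in> range d" "x \<noteq> z" "a \<noteq> z" "x \<in> P"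
      using P(1,3) Y(1,3) pth_ends[OF P(2)] by auto
    then have "x \<noteq> a" using z by auto
    then have l: "1 \<le> l" using pth_pos P by blast
    have zz: "z \<in> range c" "z \<in> range d" using z by auto
    obtain h where h: "1 \<le> h" "h < M" "pth (range d) a z h" "pth (range d) a z (M - h)"
      using two_arcs[OF d xa(2) zz(2) xa(4)] by blast
    have ear: "pth (P \<union> range d) x z (l + t)" if "pth (range d) a z t" for t
      using pth_trans[OF P(2) that] P(3) by simp
    have int: "(P \<union> range d) \<inter> range c \<subseteq> {x,z}" using P(1) Y(3) z by auto
    show False
      by (rule no_long_ears[OF c xa(1) zz(1) xa(3) ear[OF h(3)] int ear[OF h(4)] int])
        (use l M_odd in \<open>auto\<close>)
  qed
qed

end

section \<open>Tails and ears\<close>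

text \<open>Used with \<open>P a\<close> for \<open>a + 1 \<in> OL\<close> and \<open>r\<close> for
  the number of vertices of an ear. Rule \<open>3\<close> creates a gap without elements, rule
  \<open>1\<close> fills everything above an element that is at least \<open>r\<close>; so elements
  other than \<open>M - 1\<close> lie below \<open>r\<close>, and rule \<open>2\<close> then
  determines them.\<close>

lemma good_vertex_arith:
  fixes P :: "int \<Rightarrow> bool"
  assumes M: "odd M" and P: "\<And>a. P a \<Longrightarrow> even a \<and> 2 \<le> a \<and> a \<le> M - 1"
    and top: "P (M - 1)" and ex: "P a0" "a0 < M - 1"
    and cl: "\<And>a b. P a \<Longrightarrow> P b \<Longrightarrow> P (\<bar>a + b - M\<bar> + 1)"
    and r: "2 \<le> r" "r \<le> M - 2"
    and 1: "\<And>a. P a \<Longrightarrow> r \<le> a \<Longrightarrow> a < M - 1 \<Longrightarrow> P (a + 2)"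
    and 2: "\<And>a. P a \<Longrightarrow> a < r \<Longrightarrow> P (2 * r + 2 - a)"
    and 3: "\<And>a. P a \<Longrightarrow> a < M - r \<Longrightarrow> P (a + 2 * r)"
  shows False
proof -
  have M5: "5 \<le> M" using P[OF ex(1)] ex(2) M by presburger
  \<comment> \<open>Adding \<open>2 * r\<close> would lead above \<open>M - 1\<close>.\<close>
  have gap: False if "P a" "M - 1 - 2 * r < a" "a < M - r" for a
    using P[OF 3[OF that(1,3)]] that by simp
  have step: "a + 2 * int n \<le> M - 1 \<Longrightarrow> P (a + 2 * int n)" if "P a" "r \<le> a" for a n
  proof (induction n)
    case (Suc n) then show ?case using 1[of "a + 2 * int n"] that by (simp add: algebra_simps)
  qed (use that in simp)
  have block: "P b" if "P a" "r \<le> a" "even b" "a \<le> b" "b \<le> M - 1" for a b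
  proof -
    have "b = a + 2 * int (nat ((b - a) div 2))" using that P[OF that(1)] by auto
    then show ?thesis using step[OF that(1,2), of "nat ((b - a) div 2)"] that(5) by simp
  qed
  \<comment> \<open>The largest even number below \<open>M - r\<close>, a position inside the
    gap.\<close>
  define g where "g = (if even r then M - r - 1 else M - r - 2)"
  have g: "even g" "M - 1 - 2 * r < g" "g < M - r" using M r by (auto simp: g_def)
  have high: "M - r \<le> a" if "P a" "r \<le> a" for a
  proof (rule ccontr)
    assume "\<not> M - r \<le> a"
    then have "a \<le> g" using P[OF that(1)] M by (auto simp: g_def) presburger
    then show False using block[OF that g(1)] gap g(2,3) r by simp
  qed
  have low: "a < r" if "P a" "a < M - 1" for a
  proof (rule ccontr)
    assume "\<not> a < r"
    moreover have "even (M - 3)" "a \<le> M - 3" using M P[OF that(1)] that(2) by presburger+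
    \<comment> \<open>Closure with \<open>b = M - 3\<close> lowers an element by two, so all even
      positions would be elements.\<close>
    ultimately have "P (M - 3)" using block[OF that(1), of "M - 3"] by simp
    then have down: "P (a - 2)" if "P a" "4 \<le> a" for a
      using cl[of a "M - 3"] that by (simp add: abs_if split: if_splits)
    have all': "2 \<le> M - 1 - 2 * int n \<Longrightarrow> P (M - 1 - 2 * int n)" for n
    proof (induction n)
      case (Suc n) then show ?case using down[of "M - 1 - 2 * int n"] by (simp add: algebra_simps)
    qed (use top in simp)
    have all: "P b" if "even b" "2 \<le> b" "b \<le> M - 1" for b
    proof -
      have "b = M - 1 - 2 * int (nat ((M - 1 - b) div 2))" using that M by auto
      then show ?thesis using all'[of "nat ((M - 1 - b) div 2)"] that by simp
    qed
    show False
    proof (cases "2 \<le> g")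
      case True then show ?thesis using gap[OF all[OF g(1) True]] g r by simp
    next
      case False
      then have "r = M - 2" using r M unfolding g_def by (cases "even r") (simp; presburger)+
      then have "P (2 * r + 2 - 2)" using 2[OF all[of 2]] M5 by simp
      then show False using P[of "2 * r"] \<open>r = M - 2\<close> M5 by simp
    qed
  qed
  have f: "a0 < r" using low ex by blast
  \<comment> \<open>The reflected element exceeds \<open>r\<close>, so it is \<open>M - 1\<close>.
    Hence \<open>a0\<close> is the only possible element below \<open>M - 1\<close>, and closure
    applied to \<open>a0\<close> twice has to reproduce it.\<close>
  have "P (2 * r + 2 - a0)" using 2 ex(1) f by blast
  then have a0: "2 * r + 2 - a0 = M - 1" using low[of "2 * r + 2 - a0"] P[of "2 * r + 2 - a0"] f by fastforce
  have hi: "M - r \<le> a0"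
  proof (rule ccontr)
    assume "\<not> M - r \<le> a0"
    then have Q: "P (a0 + 2 * r)" using 3 ex(1) by simp
    have "a0 + 2 * r = M - 1"
      using low[OF Q] P[OF Q] P[OF ex(1)] r by (cases "a0 + 2 * r < M - 1") auto
    then show False using a0 M by presburger
  qed
  have Q: "P (\<bar>a0 + a0 - M\<bar> + 1)" using cl ex(1) by blast
  show False
  proof (cases "\<bar>a0 + a0 - M\<bar> + 1 < M - 1")
    case True
    have "\<bar>a0 + a0 - M\<bar> + 1 < r" using low[OF Q True] .
    then have "2 * r + 2 - (\<bar>a0 + a0 - M\<bar> + 1) = M - 1"
      using low[of "2 * r + 2 - (\<bar>a0 + a0 - M\<bar> + 1)"] 2[OF Q] P[of "2 * r + 2 - (\<bar>a0 + a0 - M\<bar> + 1)"] by fastforce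
    then show False using a0 hi f ex(2) by (auto simp: abs_if split: if_splits)
  next
    case False
    then show False using P[OF Q] P[OF ex(1)] ex(2) M by (auto simp: abs_if split: if_splits)
  qed
qed

section \<open>Parity of distances between two periodic sets of attachments\<close>

lemma ex_least_int:
  fixes Q :: "int \<Rightarrow> bool"
  assumes "Q x" "a < x"
  obtains y where "Q y" "a < y" "y \<le> x" "\<And>u. a < u \<Longrightarrow> u < y \<Longrightarrow> \<not> Q u"
proof -
  define n where "n = (LEAST n. Q (a + 1 + int n))"
  have e: "Q (a + 1 + int (nat (x - a - 1)))" using assms by simp
  have 1: "Q (a + 1 + int n)" unfolding n_def by (rule LeastI) (rule e)
  have 2: "n \<le> nat (x - a - 1)" unfolding n_def by (rule Least_le) (rule e)
  have 3: "\<not> Q u" if "a < u" "u < a + 1 + int n" for u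
    using not_less_Least[of "nat (u - a - 1)" "\<lambda>n. Q (a + 1 + int n)"] that by (simp add: n_def)
  show ?thesis using that[of "a + 1 + int n"] 1 2 3 assms(2) by auto
qed

text \<open>\<open>P\<close> and \<open>Q\<close> will be the positions on the cycle of the neighbours of the two ends of an ear with
  \<open>r\<close> vertices.\<close>

locale near =
  fixes P Q :: "int \<Rightarrow> bool" and M r :: int
  assumes oddM: "odd M" and perP: "P (i + M) \<longleftrightarrow> P i" and perQ: "Q (i + M) \<longleftrightarrow> Q i"
    and PQ: "P i \<Longrightarrow> Q j \<Longrightarrow> i < j \<Longrightarrow> j < i + M \<Longrightarrow> (\<And>u. i < u \<Longrightarrow> u < j \<Longrightarrow> \<not> Q u) \<Longrightarrow> even (j - i - r)"
    and QP: "Q i \<Longrightarrow> P j \<Longrightarrow> i < j \<Longrightarrow> j < i + M \<Longrightarrow> (\<And>u. i < u \<Longrightarrow> u < j \<Longrightarrow> \<not> P u) \<Longrightarrow> even (j - i - r)"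
begin

lemma flip: "near Q P M r"
  by unfold_locales (use oddM perP perQ PQ QP in blast)+

text \<open>Alternating jumps to the next element of \<open>Q\<close> and of \<open>P\<close> all
  have the parity of \<open>r\<close>; a pair of jumps does not change the parity of the distance
  left. The assumption handles a jump that lands on \<open>x\<close> as an element of
  \<open>P\<close>.\<close>

lemma all_distances:
  assumes "even r \<or> (\<forall>i. \<not> (P i \<and> Q i))"
  shows "P s \<Longrightarrow> Q x \<Longrightarrow> s < x \<Longrightarrow> x < s + M \<Longrightarrow> even (x - s - r)"
proof (induction "nat (x - s)" arbitrary: s rule: less_induct)
  case less
  obtain x' where x': "Q x'" "s < x'" "x' \<le> x" "\<And>u. s < u \<Longrightarrow> u < x' \<Longrightarrow> \<not> Q u"
    using ex_least_int[of Q x s] less.prems by metis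
  have e1: "even (x' - s - r)" using PQ[OF less.prems(1) x'(1,2) _ x'(4)] x'(3) less.prems by simp
  show ?case
  proof (cases "x' = x")
    case True then show ?thesis using e1 by simp
  next
    case False
    have "P (s + M)" using perP less.prems by blast
    then obtain s' where s': "P s'" "x' < s'" "s' \<le> s + M" "\<And>u. x' < u \<Longrightarrow> u < s' \<Longrightarrow> \<not> P u"
      using ex_least_int[of P "s + M" x'] x' less.prems by (metis order_le_less_trans)
    have e2: "even (s' - x' - r)" using QP[OF x'(1) s'(1,2) _ s'(4)] s'(3) x'(2) by simp
    consider "s' < x" | "s' = x" | "x < s'" by linarith
    then show ?thesis
    proof cases
      case 1
      have "even (x - s' - r)" using less.hyps[of s'] 1 s'(1,2) x'(2) less.prems by auto
      moreover have "x - s - r = (x' - s - r) + (s' - x' - r) + (x - s' - r) + 2 * r" by simp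
      ultimately show ?thesis using e1 e2 by (metis dvd_add dvd_triv_left)
    next
      case 2
      then have "even r" using assms less.prems(2) s'(1) by blast
      moreover have "x - s - r = (x' - s - r) + (s' - x' - r) + r" using 2 by simp
      ultimately show ?thesis using e1 e2 by (metis dvd_add)
    next
      case 3
      have "even (s' - x - r)"
        using QP[OF less.prems(2) s'(1) 3] s'(3,4) x'(3) less.prems(3) by simp
      moreover have "x - s - r = (x' - s - r) + (s' - x' - r) - (s' - x - r)" by simp
      ultimately show ?thesis using e1 e2 by (metis dvd_add dvd_diff)
    qed
  qed
qed

text \<open>Otherwise the distances from \<open>s\<close> to \<open>x\<close> and from
  \<open>x\<close> to \<open>s + M\<close> would both have the parity of \<open>r\<close>, and
  \<open>M\<close> would be even.\<close>

lemma meet_odd: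
  assumes "P s" "Q x" "s < x" "x < s + M"
  shows "odd r \<and> (\<exists>i. P i \<and> Q i)"
proof (rule ccontr)
  assume n: "\<not> ?thesis"
  interpret f: near Q P M r by (rule flip)
  have "even (x - s - r)" using all_distances[OF _ assms] n by blast
  moreover have "even (s + M - x - r)"
    using f.all_distances[of x "s + M"] n assms perP by auto
  moreover have "M = (x - s - r) + (s + M - x - r) + 2 * r" by simp
  ultimately show False using oddM by (metis dvd_add dvd_triv_left)
qed

text \<open>The next element \<open>x\<close> of \<open>Q\<close> after \<open>u\<close> is also the
  next one after \<open>z\<close>. So \<open>u - z\<close>, \<open>x - u\<close> and
  \<open>x - z\<close> would all be odd; if \<open>x\<close> is \<open>z\<close> one turn later,
  \<open>M\<close> would be even.\<close>

lemma next_both: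
  assumes "odd r" "P z" "Q z" "P u" "\<not> Q u" "z < u" "u < z + M"
    "\<And>y. z < y \<Longrightarrow> y < u \<Longrightarrow> \<not> P y \<and> \<not> Q y"
  shows False
proof -
  have e1: "even (u - z - r)" using QP assms by blast
  have "Q (z + M)" using perQ assms by blast
  then obtain x where x: "Q x" "u < x" "x \<le> z + M" "\<And>y. u < y \<Longrightarrow> y < x \<Longrightarrow> \<not> Q y"
    using ex_least_int[of Q "z + M" u] assms(7) by metis
  have e2: "even (x - u - r)" using PQ[OF assms(4) x(1,2) _ x(4)] x(3) assms by simp
  show False
  proof (cases "x = z + M")
    case True
    then have "M = (u - z - r) + (x - u - r) + 2 * r" by simp
    then show False using e1 e2 oddM by (metis dvd_add dvd_triv_left)
  next
    case False
    have "\<not> Q y" if "z < y" "y < x" for y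
      using that assms(5,8) x(4) by (metis linorder_neqE)
    then have "even (x - z - r)" using PQ[OF assms(2) x(1)] False x assms(6) by simp
    moreover have "r = (x - z - r) - (u - z - r) - (x - u - r)" by simp
    ultimately show False using e1 e2 assms(1) by (metis dvd_diff)
  qed
qed

text \<open>Take a common element and a later position where \<open>P\<close> and \<open>Q\<close>
  differ, as close together as possible. Nothing lies between them, which \<open>next_both\<close>
  excludes.\<close>

lemma both_iff:
  assumes "odd r" "P z0" "Q z0" "0 < M"
  shows "P i \<longleftrightarrow> Q i"
proof (rule ccontr)
  assume ne: "P i \<noteq> Q i"
  interpret f: near Q P M r by (rule flip)
  have shift: "P (a - int n * M) = P a \<and> Q (a - int n * M) = Q a" for a n
  proof (induction n)
    case (Suc n)
    have e: "a - int (Suc n) * M + M = a - int n * M" by (simp add: algebra_simps)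
    show ?case using Suc perP[of "a - int (Suc n) * M"] perQ[of "a - int (Suc n) * M"] unfolding e by blast
  qed simp
  define D where "D = (\<lambda>n::nat. 0 < n \<and> (\<exists>z u. int n = u - z \<and> P z \<and> Q z \<and> P u \<noteq> Q u))"
  \<comment> \<open>Enough periods to bring the common element to the left of
    \<open>i\<close>.\<close>
  define N where "N = nat (\<bar>z0 - i\<bar> + 1)"
  define z1 where "z1 = z0 - int N * M"
  have "int N * 1 \<le> int N * M" using assms(4) by (intro mult_left_mono) auto
  moreover have "z0 - i < int N" by (simp add: N_def)
  ultimately have "z1 < i" unfolding z1_def by linarith
  then have "D (nat (i - z1))" unfolding D_def
    using shift[of z0] assms ne by (auto simp: z1_def)
  then have DL: "D (LEAST n. D n)" by (rule LeastI)
  then obtain z u where zu: "int (LEAST n. D n) = u - z" "P z" "Q z" "P u \<noteq> Q u" "z < u"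
    unfolding D_def by auto
  have min: "\<not> D n" if "int n < u - z" for n using not_less_Least[of n D] that zu(1) by simp
  have none: "\<not> P y \<and> \<not> Q y" if "z < y" "y < u" for y
  proof (rule ccontr)
    assume a: "\<not> (\<not> P y \<and> \<not> Q y)"
    show False
    proof (cases "P y = Q y")
      case True
      then have "D (nat (u - y))" unfolding D_def using a zu that by auto
      then show False using min[of "nat (u - y)"] that by simp
    next
      case False
      then have "D (nat (y - z))" unfolding D_def using zu that by auto
      then show False using min[of "nat (y - z)"] that by simp
    qed
  qed
  have "u < z + M"
  proof (rule ccontr)
    assume "\<not> u < z + M"
    then have "z + M < u \<or> z + M = u" by linarith
    then show False using none[of "z + M"] assms(4) perP[of z] perQ[of z] zu by auto
  qed
  then show False
    using next_both[OF assms(1) zu(2,3) _ _ zu(5) _ none] f.next_both[OF assms(1) zu(3,2) _ _ zu(5)] none zu(4) by blast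
qed

end

section \<open>Longest tails, ears and the parity condition at the ends of an ear\<close>

context odd_critical
begin

text \<open>Indexed from the free end, so that the vertex whose neighbours are studied is always
  \<open>e 0\<close>.\<close>

definition tail :: "(int \<Rightarrow> 'a) \<Rightarrow> (int \<Rightarrow> 'a) \<Rightarrow> int \<Rightarrow> bool" where
  "tail c e r \<longleftrightarrow> cyc c M \<and> ipath e r \<and> e r \<in> range c \<and> (\<forall>i. 0 \<le> i \<and> i < r \<longrightarrow> e i \<notin> range c)"

definition R :: int where "R = Max {r. \<exists>c e. tail c e r}"

lemma ipath_V: "ipath p n \<Longrightarrow> 1 \<le> n \<Longrightarrow> 0 \<le> i \<Longrightarrow> i \<le> n \<Longrightarrow> p i \<in> V"
proof -
  assume a: "ipath p n" "1 \<le> n" "0 \<le> i" "i \<le> n"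
  show "p i \<in> V"
  proof (cases "i < n")
    case True then show ?thesis using a ipath_edge[OF a(1), of i] EV by blast
  next
    case False then show ?thesis using a ipath_edge[OF a(1), of "i - 1"] EV2 by auto
  qed
qed

lemma tail_length: "tail c e r \<Longrightarrow> 0 \<le> r \<and> r \<le> int (card V)"
proof -
  assume t: "tail c e r"
  then have p: "ipath e r" by (simp add: tail_def)
  have "r \<le> int (card V)"
  proof (cases "1 \<le> r")
    case True
    then have "e ` {0..r} \<subseteq> V" using ipath_V[OF p] by auto
    moreover have "inj_on e {0..r}" using p by (simp add: ipath_def)
    ultimately have "card {0..r} \<le> card V" using fin card_inj_on_le by blast
    then show ?thesis using True by simp
  qed auto
  then show ?thesis using p by (simp add: ipath_def)
qed

lemma finite_tails: "finite {r. \<exists>c e. tail c e r}"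
  by (rule finite_subset[of _ "{0..int (card V)}"]) (use tail_length in auto)

lemma tail_le: "tail c e r \<Longrightarrow> r \<le> R"
  unfolding R_def by (rule Max_ge[OF finite_tails]) auto

lemma ex_longest: "\<exists>c. cyc c M"
  using M_OL unfolding OL_def by blast

lemma ex_tail: "\<exists>c e. tail c e R"
proof -
  obtain c where c: "cyc c M" using ex_longest by blast
  then have "tail c (\<lambda>_. c 0) 0" unfolding tail_def ipath_def by auto
  then have "{r. \<exists>c e. tail c e r} \<noteq> {}" by blast
  from Max_in[OF finite_tails this] show ?thesis unfolding R_def by auto
qed

lemma R_nonneg: "0 \<le> R" using ex_tail tail_length by blast

lemma tail_nbrs:
  assumes t: "tail c e R" and E: "E (e 0) u"
  shows "u \<in> e ` {0..R} \<or> u \<in> range c"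
proof (rule ccontr)
  assume n: "\<not> ?thesis"
  have p: "ipath e R" using t by (simp add: tail_def)
  define f where "f = (\<lambda>i. if i = 0 then u else e (i - 1))"
  have "ipath f (R + 1)" unfolding ipath_def
  proof (intro conjI allI impI)
    show "0 \<le> R + 1" using R_nonneg by simp
    show "inj_on f {0..R + 1}"
    proof (rule inj_onI)
      fix i j assume a: "i \<in> {0..R+1}" "j \<in> {0..R+1}" "f i = f j"
      have ne: "e x \<noteq> u" if "0 \<le> x" "x \<le> R" for x using n that by auto
      show "i = j"
      proof (cases "i = 0 \<or> j = 0")
        case True
        then show ?thesis using a ne[of "i - 1"] ne[of "j - 1"] by (auto simp: f_def split: if_splits)
      next
        case False
        then show ?thesis using a ipath_eq[OF p, of "i - 1" "j - 1"] by (auto simp: f_def)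
      qed
    qed
    fix i assume "0 \<le> i \<and> i < R + 1"
    then show "E (f i) (f (i + 1))"
      using ipath_edge[OF p, of "i - 1"] sym[OF E] by (cases "i = 0") (auto simp: f_def)
  qed
  then have "tail c f (R + 1)" using t n R_nonneg by (auto simp: tail_def f_def)
  then show False using tail_le by fastforce
qed

text \<open>The conditions on neighbours record that both ends of the ear are ends of a longest tail.\<close>

definition ear :: "(int \<Rightarrow> 'a) \<Rightarrow> (int \<Rightarrow> 'a) \<Rightarrow> bool" where
  "ear c e \<longleftrightarrow> cyc c M \<and> ipath e (R - 1) \<and> (\<forall>i. 0 \<le> i \<and> i < R \<longrightarrow> e i \<notin> range c) \<and>
     (\<forall>u. E (e 0) u \<longrightarrow> u \<in> e ` {0..R - 1} \<or> u \<in> range c) \<and>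
     (\<forall>u. E (e (R - 1)) u \<longrightarrow> u \<in> e ` {0..R - 1} \<or> u \<in> range c)"

lemma ipath_rev: "ipath p n \<Longrightarrow> ipath (\<lambda>i. p (n - i)) n"
proof -
  assume p: "ipath p n"
  have "inj_on (\<lambda>i. p (n - i)) {0..n}"
    using ipath_eq[OF p] by (intro inj_onI) auto
  moreover have "E (p (n - i)) (p (n - (i + 1)))" if "0 \<le> i" "i < n" for i
    using ipath_edge[OF p, of "n - (i + 1)"] that sym by (auto simp: algebra_simps)
  ultimately show ?thesis using p by (auto simp: ipath_def)
qed

lemma ear_rev: assumes "ear c e" shows "ear c (\<lambda>i. e (R - 1 - i))"
proof -
  have "(\<lambda>i. e (R - 1 - i)) ` {0..R - 1} = e ` {0..R - 1}"
  proof
    show "e ` {0..R - 1} \<subseteq> (\<lambda>i. e (R - 1 - i)) ` {0..R - 1}"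
    proof
      fix x assume "x \<in> e ` {0..R - 1}"
      then obtain i where "i \<in> {0..R-1}" "x = e i" by auto
      then show "x \<in> (\<lambda>i. e (R - 1 - i)) ` {0..R - 1}" by (intro image_eqI[of _ _ "R - 1 - i"]) auto
    qed
  qed auto
  then show ?thesis using assms ipath_rev[of e "R - 1"] unfolding ear_def by auto
qed

lemma ear_shift: assumes "ear c e" shows "ear (\<lambda>i. c (i + d)) e"
proof -
  have "range (\<lambda>i. c (i + d)) = range c" by (auto simp: image_iff) (metis diff_add_cancel)
  then show ?thesis using assms cyc_shift unfolding ear_def by simp
qed

lemma ear_reflect: assumes "ear c e" shows "ear (\<lambda>i. c (- i)) e"
proof -
  have "range (\<lambda>i. c (- i)) = range c" by (auto simp: image_iff) (metis minus_minus)
  then show ?thesis using assms cyc_reflect unfolding ear_def by simp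
qed

text \<open>Read backwards and ended by \<open>c s\<close>, the path is again a longest tail, with
  free end \<open>e (R - 1)\<close>; so maximality confines the neighbours of both ends.\<close>

lemma tail_ear:
  assumes t: "tail c e R" and R1: "1 \<le> R" and s: "E (e 0) (c s)"
  shows "ear c e"
proof -
  have c: "cyc c M" and p: "ipath e R" and x: "e R \<in> range c"
    and out: "\<And>i. 0 \<le> i \<Longrightarrow> i < R \<Longrightarrow> e i \<notin> range c" using t by (auto simp: tail_def)
  have p': "ipath e (R - 1)" using p R1 inj_on_subset[of e "{0..R}" "{0..R-1}"] by (auto simp: ipath_def)
  define f where "f = (\<lambda>i. if i = R then c s else e (R - 1 - i))"
  have "ipath f R" unfolding ipath_def
  proof (intro conjI allI impI)
    show "inj_on f {0..R}"
    proof (rule inj_onI)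
      fix i j assume a: "i \<in> {0..R}" "j \<in> {0..R}" "f i = f j"
      have "e (R - 1 - x) \<noteq> c s" if "x \<in> {0..R}" "x \<noteq> R" for x using out[of "R-1-x"] that by fastforce
      then show "i = j" using a ipath_eq[OF p, of "R - 1 - i" "R - 1 - j"]
        by (auto simp: f_def split: if_splits)
    qed
    fix i assume i: "0 \<le> i \<and> i < R"
    show "E (f i) (f (i + 1))"
    proof (cases "i + 1 = R")
      case True
      then have z: "R - 1 - i = 0" "i \<noteq> R" by auto
      show ?thesis using s True by (simp add: f_def z)
    next
      case False
      then have "E (e (R - 1 - (i + 1))) (e (R - 1 - (i + 1) + 1))" using i by (intro ipath_edge[OF p]) auto
      moreover have "R - 1 - (i + 1) + 1 = R - 1 - i" by simp
      ultimately have "E (e (R - 1 - i)) (e (R - 1 - (i + 1)))" using sym by metis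
      moreover have "f i = e (R - 1 - i)" "f (i + 1) = e (R - 1 - (i + 1))" using False i by (auto simp: f_def)
      ultimately show ?thesis by metis
    qed
  qed (use R1 in simp)
  then have tf: "tail c f R" using c out by (auto simp: tail_def f_def)
  have nb: "u \<in> e ` {0..R - 1} \<or> u \<in> range c" if h: "E (e 0) u" for u
  proof -
    consider i where "i \<in> {0..R}" "u = e i" | "u \<in> range c" using tail_nbrs[OF t h] by auto
    then show ?thesis
    proof cases
      case 1 then show ?thesis using x by (cases "i = R") auto
    qed simp
  qed
  have nb2: "u \<in> e ` {0..R - 1} \<or> u \<in> range c" if h: "E (e (R - 1)) u" for u
  proof -
    have "f 0 = e (R - 1)" using R1 by (simp add: f_def)
    then consider i where "i \<in> {0..R}" "u = f i" | "u \<in> range c" using tail_nbrs[OF tf, of u] h by auto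
    then show ?thesis
    proof cases
      case 1
      then have "u = c s \<or> R - 1 - i \<in> {0..R - 1} \<and> u = e (R - 1 - i)" by (auto simp: f_def)
      then show ?thesis by blast
    qed simp
  qed
  show ?thesis unfolding ear_def using c p' out nb nb2 by blast
qed

lemma cyc_rep: "cyc c m \<Longrightarrow> u \<in> range c \<Longrightarrow> \<exists>t. 0 \<le> t \<and> t < m \<and> u = c t"
proof -
  assume c: "cyc c m" and "u \<in> range c"
  then obtain i where "u = c i" by auto
  then have "u = c (i mod m)" "0 < m" using c by (auto simp: cyc_def)
  then show ?thesis by (intro exI[of _ "i mod m"]) auto
qed

lemma cyc_eq: "cyc c m \<Longrightarrow> 0 \<le> i \<Longrightarrow> i < m \<Longrightarrow> 0 \<le> j \<Longrightarrow> j < m \<Longrightarrow> c i = c j \<longleftrightarrow> i = j"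
  by (simp add: cyc_def)

text \<open>If \<open>R + t\<close> were even, the ear followed by \<open>c 0, ..., c t\<close>
  would satisfy \<open>good_vertex\<close>, so \<open>R + t = M - 1\<close>. The rest of the cycle
  is then an arc of length \<open>R + 1\<close> that meets this path only in its ends; cycles
  through that arc give the rules of \<open>good_vertex_arith\<close>.\<close>

lemma ear_gap:
  assumes ear: "ear c e" and R2: "2 \<le> R" and x: "E (e (R - 1)) (c 0)"
    and t: "0 < t" "t < M" "E (e 0) (c t)" and last: "\<And>u. t < u \<Longrightarrow> u < M \<Longrightarrow> \<not> E (e 0) (c u)"
  shows "odd (R + t)"
proof (rule ccontr)
  assume ev: "\<not> odd (R + t)"
  have c: "cyc c M" and p': "ipath e (R - 1)" and out: "\<And>i. 0 \<le> i \<Longrightarrow> i < R \<Longrightarrow> e i \<notin> range c"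
    and nb: "\<And>u. E (e 0) u \<Longrightarrow> u \<in> e ` {0..R - 1} \<or> u \<in> range c"
    using ear unfolding ear_def by auto
  define p where "p = (\<lambda>i. if i < R then e i else c (i - R))"
  have p: "ipath p (R + t)" unfolding ipath_def
  proof (intro conjI allI impI)
    show "inj_on p {0..R + t}"
    proof (rule inj_onI)
      fix i j assume a: "i \<in> {0..R+t}" "j \<in> {0..R+t}" "p i = p j"
      consider "i < R" "j < R" | "i < R" "R \<le> j" | "R \<le> i" "j < R" | "R \<le> i" "R \<le> j" by linarith
      then show "i = j"
      proof cases
        case 1 then show ?thesis using a ipath_eq[OF p', of i j] by (auto simp: p_def)
      next
        case 2 then have "e i \<in> range c" using a by (auto simp: p_def)
        then show ?thesis using out[of i] 2 a by simp
      next
        case 3 then have "e j \<in> range c" using a by (auto simp: p_def) (metis rangeI)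
        then show ?thesis using out[of j] 3 a by simp
      next
        case 4 then show ?thesis using a cyc_eq[OF c, of "i - R" "j - R"] t by (auto simp: p_def)
      qed
    qed
    fix i assume i: "0 \<le> i \<and> i < R + t"
    consider "i < R - 1" | "i = R - 1" | "R \<le> i" by linarith
    then show "E (p i) (p (i + 1))"
    proof cases
      case 1 then show ?thesis using ipath_edge[OF p', of i] i by (auto simp: p_def)
    next
      case 2 then show ?thesis using x by (simp add: p_def)
    next
      case 3
      have "E (c (i - R)) (c (i - R + 1))" using c by (simp add: cyc_def)
      then show ?thesis using 3 by (simp add: p_def algebra_simps)
    qed
  qed (use R2 t in simp)
  have p0: "p 0 = e 0" using R2 by (simp add: p_def)
  have nbp: "{u. E (p 0) u} \<subseteq> p ` {1..R + t}"
  proof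
    fix u assume "u \<in> {u. E (p 0) u}"
    then have u: "E (e 0) u" using p0 by simp
    from nb[OF this] show "u \<in> p ` {1..R + t}"
    proof
      assume "u \<in> e ` {0..R - 1}"
      then obtain i where i: "i \<in> {0..R-1}" "u = e i" by auto
      then have "i \<noteq> 0" using u irr by auto
      then show ?thesis using i t by (intro image_eqI[of _ _ i]) (auto simp: p_def)
    next
      assume "u \<in> range c"
      then obtain s where s: "0 \<le> s" "s < M" "u = c s" using cyc_rep[OF c] by blast
      then have "s \<le> t" using last[of s] u by fastforce
      then show ?thesis using s R2 by (intro image_eqI[of _ _ "R + s"]) (auto simp: p_def)
    qed
  qed
  have pn: "E (p 0) (p (R + t))" using p0 t by (simp add: p_def)
  have gv: "R + t = M - 1"
    "\<And>a. 0 < a \<Longrightarrow> a < M \<Longrightarrow> even a \<Longrightarrow> E (p 0) (p a) \<longleftrightarrow> a + 1 \<in> OL"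
    "\<And>b. 0 < b \<Longrightarrow> b < M \<Longrightarrow> odd b \<Longrightarrow> E (p 0) (p b) \<longleftrightarrow> M - b + 1 \<in> OL"
    "\<And>a b. a + 1 \<in> OL \<Longrightarrow> b + 1 \<in> OL \<Longrightarrow> \<bar>a + b - M\<bar> + 2 \<in> OL"
    "card OL = k"
    using good_vertex[OF p nbp pn] ev t R2 by auto
  have p: "ipath p (M - 1)" using p gv(1) by simp
  have top: "E (p 0) (p (M - 1))" using pn gv(1) by simp
  have PR: "p R = c 0" "p (M - 1) = c t"   proof -
    have t': "t = M - 1 - R" using gv(1) by simp
    show "p (M - 1) = c t" using t unfolding t' by (simp add: p_def)
  qed (simp add: p_def)
  define K where "K = c ` {t..M}"
  have K: "pth K (p R) (p (M - 1)) (R + 1)"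
  proof -
    have "pth K (c t) (c M) (M - t)" unfolding K_def using cyc_seg[OF c, of t M] t by simp
    moreover have "c M = c 0" using cyc_period[OF c, of 0] by simp
    moreover have "M - t = R + 1" using gv(1) by simp
    ultimately show ?thesis using PR pth_sym by metis
  qed
  have Kp: "i = R \<or> i = M - 1" if "p i \<in> K" "0 \<le> i" "i \<le> M - 1" for i
  proof -
    obtain s where s: "s \<in> {t..M}" "p i = c s" using \<open>p i \<in> K\<close> unfolding K_def by auto
    have iR: "R \<le> i"
    proof (rule ccontr)
      assume "\<not> R \<le> i"
      then have "e i \<in> range c" using s by (simp add: p_def)
      then show False using out[of i] that \<open>\<not> R \<le> i\<close> by simp
    qed
    then have "c (i - R) = c s" using s by (simp add: p_def)
    then have "(i - R) mod M = s mod M" using c by (simp add: cyc_def)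
    moreover have "(i - R) mod M = i - R" using iR that R2 by simp
    ultimately show ?thesis using s(1) gv(1) that(3) t by (cases "s = M") auto
  qed
  have RM: "R < M - 1" using gv(1) t by simp
  have K_cyc: "x + (R + 1) \<in> OL"
    if h: "pth Y (p R) (p (M - 1)) x" "Y \<subseteq> p ` S" "S \<subseteq> {0..M - 1}" "odd (x + (R + 1))" "1 \<le> x" for Y S x
  proof -
    have "Y \<inter> K \<subseteq> {p R, p (M - 1)}" using h(2,3) Kp by (auto simp: subset_iff)
    moreover have "p R \<noteq> p (M - 1)" using ipath_eq[OF p, of R "M - 1"] RM R2 by simp
    ultimately obtain d where "cyc d (x + (R + 1))"
      using cyc_close2[OF h(1) K] h(5) R2 by auto
    then show ?thesis using cyc_OL h(4) by blast
  qed
  have two: "pth {p 0, p a, p b} (p a) (p b) 2" if "E (p 0) (p a)" "E (p 0) (p b)" "0 < a" "0 < b" "a \<le> M - 1" "b \<le> M - 1" "a \<noteq> b" for a b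
  proof -
    have "{p a, p 0} \<inter> {p 0, p b} \<subseteq> {p 0}" using ipath_eq[OF p, of a b] that by auto
    from pth_trans[OF pth_edge[OF sym[OF that(1)]] pth_edge[OF that(2)] this]
    have "pth ({p a, p 0} \<union> {p 0, p b}) (p a) (p b) 2" by simp
    then show ?thesis by (rule pth_mono) auto
  qed
  have ine: "p i \<noteq> p j" if "0 \<le> i" "i \<le> M - 1" "0 \<le> j" "j \<le> M - 1" "i \<noteq> j" for i j
    using ipath_eq[OF p] that by simp
  have A: "even a \<and> 2 \<le> a \<and> a \<le> M - 1" if "a + 1 \<in> OL" for a
    using OL_odd[OF that] OL_ge3[OF that] OL_le[OF that] by simp
  have EA: "E (p 0) (p a)" if "a + 1 \<in> OL" for a using gv(2)[of a] A[OF that] that by auto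
  \<comment> \<open>From \<open>p R\<close> along the path to \<open>p a\<close>, through
    \<open>p 0\<close> to \<open>p (M - 1)\<close>, and back through \<open>K\<close>. The next rule
    is the same with \<open>a\<close> on the other side of \<open>R\<close>.\<close>
  have r1: "a + 2 + 1 \<in> OL" if a: "a + 1 \<in> OL" "R \<le> a" "a < M - 1" for a
  proof -
    have s: "pth (p ` {R..a}) (p R) (p a) (a - R)" using ipath_seg[OF p] a R2 by simp
    have "p ` {R..a} \<inter> {p 0, p a, p (M - 1)} \<subseteq> {p a}" using ine a R2 by fastforce
    from pth_trans[OF s two[OF EA[OF a(1)] top] this] have "pth (p ` {R..a} \<union> {p 0, p a, p (M - 1)}) (p R) (p (M - 1)) (a - R + 2)"
      using a A[OF a(1)] by auto
    moreover have "p ` {R..a} \<union> {p 0, p a, p (M - 1)} \<subseteq> p ` ({R..a} \<union> {0, a, M - 1})" by auto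
    ultimately have "a - R + 2 + (R + 1) \<in> OL"
      by (rule K_cyc) (use a A[OF a(1)] R2 in auto)
    then show ?thesis by (simp add: algebra_simps)
  qed
  have r2: "2 * R + 2 - a + 1 \<in> OL" if a: "a + 1 \<in> OL" "a < R" for a
  proof -
    have "pth (p ` {a..R}) (p a) (p R) (R - a)" using ipath_seg[OF p, of a R] a A[OF a(1)] RM by simp
    then have s: "pth (p ` {a..R}) (p R) (p a) (R - a)" by (rule pth_sym)
    have "p ` {a..R} \<inter> {p 0, p a, p (M - 1)} \<subseteq> {p a}" using ine a A[OF a(1)] RM by fastforce
    from pth_trans[OF s two[OF EA[OF a(1)] top] this] have "pth (p ` {a..R} \<union> {p 0, p a, p (M - 1)}) (p R) (p (M - 1)) (R - a + 2)"
      using a A[OF a(1)] RM by auto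
    moreover have "p ` {a..R} \<union> {p 0, p a, p (M - 1)} \<subseteq> p ` ({a..R} \<union> {0, a, M - 1})" by auto
    ultimately have "R - a + 2 + (R + 1) \<in> OL"
      by (rule K_cyc) (use a A[OF a(1)] R2 RM in auto)
    then show ?thesis by (simp add: algebra_simps)
  qed
  \<comment> \<open>From \<open>p R\<close> back to \<open>p 0\<close>, over the chord to the odd
    position \<open>b\<close>, on to \<open>p (M - 1)\<close>, and back through
    \<open>K\<close>.\<close>
  have r3: "a + 2 * R + 1 \<in> OL" if a: "a + 1 \<in> OL" "a < M - R" for a
  proof -
    define b where "b = M - a"
    have b: "odd b" "R < b" "b < M - 1" using A[OF a(1)] a(2) M_odd by (auto simp: b_def)
    have Eb: "E (p 0) (p b)" using gv(3)[of b] b a R2 by (auto simp: b_def)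
    have "pth (p ` {0..R}) (p 0) (p R) (R - 0)" using ipath_seg[OF p, of 0 R] R2 RM by simp
    then have s: "pth (p ` {0..R}) (p R) (p 0) R" using pth_sym by simp
    have s2: "pth (p ` {b..M - 1}) (p b) (p (M - 1)) (M - 1 - b)" using ipath_seg[OF p] b R2 by simp
    have n0: "p 0 \<notin> p ` {b..M - 1}"
    proof
      assume "p 0 \<in> p ` {b..M - 1}"
      then obtain y where "y \<in> {b..M-1}" "p 0 = p y" by auto
      then show False using ine[of 0 y] b R2 by auto
    qed
    have s3: "pth (insert (p 0) (p ` {b..M - 1})) (p 0) (p (M - 1)) (M - 1 - b + 1)"
      by (rule pth_cons[OF Eb s2 n0])
    have "p ` {0..R} \<inter> insert (p 0) (p ` {b..M - 1}) \<subseteq> {p 0}" using ine b by fastforce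
    from pth_trans[OF s s3 this] have "pth (p ` {0..R} \<union> insert (p 0) (p ` {b..M - 1})) (p R) (p (M - 1)) (R + (M - 1 - b + 1))" .
    moreover have "p ` {0..R} \<union> insert (p 0) (p ` {b..M - 1}) \<subseteq> p ` ({0..R} \<union> {b..M - 1})" using R2 by auto
    ultimately have "R + (M - 1 - b + 1) + (R + 1) \<in> OL"
      by (rule K_cyc) (use b M_odd R2 RM in auto)
    moreover have "R + (M - 1 - b + 1) + (R + 1) = a + 2 * R + 1" by (simp add: b_def)
    ultimately show ?thesis by metis
  qed
  \<comment> \<open>The second odd length supplies the element below \<open>M - 1\<close> that the
    arithmetic starts from.\<close>
  have "\<exists>m\<in>OL. m \<noteq> M"
  proof (rule ccontr)
    assume "\<not> ?thesis"
    then have "OL \<subseteq> {M}" by auto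
    then have "card OL \<le> card {M}" by (intro card_mono) auto
    then show False using gv(5) k2 by simp
  qed
  then obtain m where m: "m \<in> OL" "m \<noteq> M" by blast
  then have m': "(m - 1) + 1 \<in> OL" "m - 1 < M - 1" using OL_le[OF m(1)] by auto
  have cl: "\<bar>a + b - M\<bar> + 1 + 1 \<in> OL" if "a + 1 \<in> OL" "b + 1 \<in> OL" for a b
    using gv(4)[OF that] by (simp add: algebra_simps)
  show False
    by (rule good_vertex_arith[of M "\<lambda>a. a + 1 \<in> OL" "m - 1" R])
      (use M_odd A M_OL m' cl R2 RM r1 r2 r3 in auto)
qed

end

text \<open>Differences with \<open>Max B\<close> subtracted and differences taken from
  \<open>Max A\<close> share at most one value.\<close>

lemma card_differences:
  fixes A B :: "int set"
  assumes "finite A" "finite B" "A \<noteq> {}" "B \<noteq> {}"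
  shows "card A + card B \<le> card ((\<lambda>(a, b). a - b) ` (A \<times> B)) + 1"
proof -
  define D where "D = (\<lambda>(a, b). a - b) ` (A \<times> B)"
  define X where "X = (\<lambda>a. a - Max B) ` A"
  define Y where "Y = (\<lambda>b. Max A - b) ` B"
  have M: "Max A \<in> A" "Max B \<in> B" using assms by auto
  have le: "a \<le> Max A" if "a \<in> A" for a using that assms by auto
  have le': "b \<le> Max B" if "b \<in> B" for b using that assms by auto
  have sub: "X \<union> Y \<subseteq> D" using M by (auto simp: X_def Y_def D_def image_iff)
  have "X \<inter> Y \<subseteq> {Max A - Max B}"
  proof
    fix z assume "z \<in> X \<inter> Y"
    then obtain a b where "a \<in> A" "b \<in> B" "z = a - Max B" "z = Max A - b" by (auto simp: X_def Y_def)
    then show "z \<in> {Max A - Max B}" using le[of a] le'[of b] by simp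
  qed
  then have "card (X \<inter> Y) \<le> 1" using card_mono[of "{Max A - Max B}" "X \<inter> Y"] by simp
  moreover have "card X = card A" "card Y = card B" by (simp_all add: X_def Y_def card_image inj_on_def)
  moreover have "card X + card Y = card (X \<union> Y) + card (X \<inter> Y)"
    using assms by (intro card_Un_Int) (auto simp: X_def Y_def)
  moreover have "card (X \<union> Y) \<le> card D" using sub assms by (intro card_mono) (auto simp: D_def)
  ultimately show ?thesis unfolding D_def by linarith
qed

lemma card_abs_differences:
  fixes A B :: "int set"
  assumes "finite A" "finite B" "A \<noteq> {}" "B \<noteq> {}"
  shows "card A + card B \<le> 2 * card ((\<lambda>(a, b). \<bar>a - b\<bar>) ` (A \<times> B)) + 1"
proof -
  define D where "D = (\<lambda>(a, b). \<bar>a - b\<bar>) ` (A \<times> B)"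
  have f: "finite D" using assms by (simp add: D_def)
  have "(\<lambda>(a, b). a - b) ` (A \<times> B) \<subseteq> D \<union> uminus ` D"
    by (auto simp: D_def image_iff abs_if split: if_splits) fastforce+
  then have "card ((\<lambda>(a, b). a - b) ` (A \<times> B)) \<le> card (D \<union> uminus ` D)" using f by (intro card_mono) auto
  also have "\<dots> \<le> card D + card D" using card_Un_le[of D "uminus ` D"] card_image_le[OF f, of uminus] by linarith
  finally show ?thesis using card_differences[OF assms] unfolding D_def by linarith
qed

context odd_critical
begin

text \<open>\<open>ear_gap\<close> for the cycle run backwards from \<open>c i\<close>: its last
  neighbour of \<open>e 0\<close> is the first one after \<open>c i\<close> in the original
  direction.\<close>

lemma ear_near:
  assumes ear: "ear c e" and R2: "2 \<le> R" and i: "E (e (R - 1)) (c i)" and j: "E (e 0) (c j)"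
    and ij: "i < j" "j < i + M" and none: "\<And>u. i < u \<Longrightarrow> u < j \<Longrightarrow> \<not> E (e 0) (c u)"
  shows "even (j - i - R)"
proof -
  have c: "cyc c M" using ear by (simp add: ear_def)
  define d where "d = (\<lambda>u. c (i + M - u))"
  have "d = (\<lambda>u. c (- u + (i + M)))" by (auto simp: d_def algebra_simps)
  then have "ear d e" using ear_reflect[OF ear_shift[OF ear, of "i + M"]] by simp
  moreover have "E (e (R - 1)) (d 0)" using i cyc_period[OF c] by (simp add: d_def)
  moreover have "E (e 0) (d (i + M - j))" using j by (simp add: d_def)
  moreover have "\<not> E (e 0) (d u)" if "i + M - j < u" "u < M" for u
    using none[of "i + M - u"] that by (simp add: d_def)
  ultimately have "odd (R + (i + M - j))"
    using ear_gap[of d e "i + M - j"] R2 ij by auto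
  then show ?thesis using M_odd by auto
qed

lemma ear_near_locale:
  assumes ear: "ear c e" and R2: "2 \<le> R"
  shows "near (\<lambda>i. E (e 0) (c i)) (\<lambda>i. E (e (R - 1)) (c i)) M R"
proof
  have c: "cyc c M" using ear by (simp add: ear_def)
  show "odd M" by (rule M_odd)
  show "E (e 0) (c (i + M)) = E (e 0) (c i)" "E (e (R - 1)) (c (i + M)) = E (e (R - 1)) (c i)" for i
    using cyc_period[OF c] by simp_all
  show "even (j - i - R)" if "E (e (R - 1)) (c i)" "E (e 0) (c j)" "i < j" "j < i + M"
    "\<And>u. i < u \<Longrightarrow> u < j \<Longrightarrow> \<not> E (e 0) (c u)" for i j
    using ear_near[OF ear R2] that by blast
  show "even (j - i - R)" if "E (e 0) (c i)" "E (e (R - 1)) (c j)" "i < j" "j < i + M"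
    "\<And>u. i < u \<Longrightarrow> u < j \<Longrightarrow> \<not> E (e (R - 1)) (c u)" for i j
    using ear_near[OF ear_rev[OF ear] R2, of i j] that by simp
qed

lemma ext_arc:
  assumes c: "cyc c M" and X: "pth X (c i) (c j) l" "X \<inter> range c \<subseteq> {c i, c j}" and ij: "i < j" "j < i + M"
  shows "odd (j - i + l) \<Longrightarrow> j - i + l \<in> OL" and "odd (M - (j - i) + l) \<Longrightarrow> M - (j - i) + l \<in> OL"
proof -
  have ne: "c i \<noteq> c j"
  proof
    assume "c i = c j"
    then have "M dvd j - i" using c by (simp add: cyc_def mod_eq_dvd_iff dvd_diff_commute)
    then show False using ij zdvd_imp_le[of M "j - i"] by simp
  qed
  have l: "1 \<le> l" using pth_pos[OF X(1) ne] .
  have cl: "x + l \<in> OL" if a: "pth (range c) (c i) (c j) x" "odd (x + l)" "1 \<le> x" for x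
  proof -
    have "3 \<le> l + x" using a l by (cases "x + l = 2") auto
    then obtain d where "cyc d (l + x)" using cyc_close2[OF X(1) a(1) X(2) ne] by auto
    then show ?thesis using cyc_OL a(2) by (simp add: add.commute)
  qed
  have mono: "pth (c ` S) x y t \<Longrightarrow> pth (range c) x y t" for S x y t
    by (rule pth_mono) auto
  show "j - i + l \<in> OL" if "odd (j - i + l)"
    using cl[OF mono[OF cyc_seg[OF c, of i j]]] that ij by simp
  have "pth (range c) (c j) (c (i + M)) (i + M - j)" using mono[OF cyc_seg[OF c, of j "i + M"]] ij by simp
  then have "pth (range c) (c i) (c j) (M - (j - i))"
    using pth_sym cyc_period[OF c, of i] by (simp add: algebra_simps)
  then show "M - (j - i) + l \<in> OL" if "odd (M - (j - i) + l)"
    using cl that ij by simp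
qed

text \<open>\<open>b = 0\<close> stands for the ear without a chord; a chord to \<open>e b\<close>
  replaces \<open>b\<close> edges by one.\<close>

lemma ear_path:
  assumes ear: "ear c e" and b: "0 \<le> b" "b \<le> R - 1" "b = 0 \<or> E (e 0) (e b)"
    and i: "E (e 0) (c i)" and j: "E (e (R - 1)) (c j)" and ne: "c i \<noteq> c j"
  shows "\<exists>X. pth X (c i) (c j) (if b = 0 then R + 1 else R + 2 - b) \<and> X \<inter> range c \<subseteq> {c i, c j}"
proof -
  have p: "ipath e (R - 1)" and out: "\<And>i. 0 \<le> i \<Longrightarrow> i < R \<Longrightarrow> e i \<notin> range c"
    using ear unfolding ear_def by auto
  have s: "pth (e ` {b..R-1}) (e b) (e (R - 1)) (R - 1 - b)" using ipath_seg[OF p] b by simp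
  have s2: "pth (e ` {b..R-1} \<union> {e 0}) (e 0) (e (R - 1)) (if b = 0 then R - 1 else R - b)"
  proof (cases "b = 0")
    case True
    have "pth (e ` {b..R-1} \<union> {e 0}) (e b) (e (R - 1)) (R - 1 - b)" by (rule pth_mono[OF s]) auto
    then show ?thesis using True by simp
  next
    case False
    have "e 0 \<noteq> e x" if "x \<in> {b..R-1}" for x using ipath_eq[OF p, of 0 x] that b False by auto
    then have "e 0 \<notin> e ` {b..R-1}" by (metis imageE)
    then show ?thesis using pth_cons[OF _ s, of "e 0"] b(3) False by (simp add: algebra_simps)
  qed
  define Y where "Y = e ` {b..R-1} \<union> {e 0}"
  have "z \<notin> range c" if z: "z \<in> Y" for z
  proof -
    obtain x where "0 \<le> x" "x < R" "z = e x"
    proof (cases "z = e 0")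
      case True then show ?thesis using that[of 0] R_nonneg b by auto
    next
      case False
      then obtain x where "x \<in> {b..R-1}" "z = e x" using z by (auto simp: Y_def)
      then show ?thesis using that[of x] b by auto
    qed
    then show ?thesis using out by simp
  qed
  then have Y: "Y \<inter> range c = {}" by auto
  have 1: "pth (insert (c i) Y) (c i) (e (R - 1)) ((if b = 0 then R - 1 else R - b) + 1)"
    by (rule pth_cons[OF sym[OF i] s2[folded Y_def]]) (use Y in auto)
  have 2: "pth (insert (c j) (insert (c i) Y)) (c j) (c i) ((if b = 0 then R - 1 else R - b) + 1 + 1)"
    by (rule pth_cons[OF sym[OF j] pth_sym[OF 1]]) (use Y ne in auto)
  have eq: "(if b = 0 then R - 1 else R - b) + 1 + 1 = (if b = 0 then R + 1 else R + 2 - b)" by simp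
  have "pth (insert (c j) (insert (c i) Y)) (c i) (c j) (if b = 0 then R + 1 else R + 2 - b)"
    using pth_sym[OF 2] unfolding eq .
  moreover have "insert (c j) (insert (c i) Y) \<inter> range c \<subseteq> {c i, c j}" using Y by auto
  ultimately show ?thesis by blast
qed

lemma cyc_ne: "cyc c m \<Longrightarrow> i < j \<Longrightarrow> j < i + m \<Longrightarrow> c i \<noteq> c j"
proof
  assume c: "cyc c m" and ij: "i < j" "j < i + m" and "c i = c j"
  then have "m dvd j - i" by (simp add: cyc_def mod_eq_dvd_iff dvd_diff_commute)
  then show False using ij zdvd_imp_le[of m "j - i"] by simp
qed

lemma path_via:
  assumes "E v x" "E v y" "x \<noteq> y" shows "pth {x, v, y} x y 2"
proof -
  have "{x, v} \<inter> {v, y} \<subseteq> {v}" using assms(3) by auto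
  from pth_trans[OF pth_edge[OF sym[OF assms(1)]] pth_edge[OF assms(2)] this]
  show ?thesis by (simp add: insert_commute)
qed

end

section \<open>Ears with equal attachments\<close>

locale twin_ear = odd_critical V E k for V :: "'a set" and E k +
  fixes c e :: "int \<Rightarrow> 'a"
  assumes ear: "ear c e" and R2: "2 \<le> R" and Rodd: "odd R"
    and twin: "\<And>i. E (e (R - 1)) (c i) \<longleftrightarrow> E (e 0) (c i)"
    and S0: "E (e 0) (c 0)" and S_ex: "\<exists>s. E (e 0) (c s) \<and> c s \<noteq> c 0"
begin

definition S :: "int \<Rightarrow> bool" where "S i \<longleftrightarrow> E (e 0) (c i)"
text \<open>As \<open>M\<close> is odd, exactly one of the two arcs between two attachments is even;
  these are the lengths of such arcs. \<open>EE\<close> keeps those with an end at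
  \<open>c 0\<close>.\<close>

definition EV :: "int \<Rightarrow> bool" where "EV d \<longleftrightarrow> even d \<and> 0 < d \<and> d < M \<and> (\<exists>i. S i \<and> S (i + d))"
definition EE :: "int set" where "EE = {d. even d \<and> 0 < d \<and> d < M \<and> (S d \<or> S (- d))}"
definition DD :: "int set" where "DD = {d. 0 < d \<and> d < M \<and> S d}"
definition AA :: "int set" where "AA = {a. 0 < a \<and> a < R \<and> even a \<and> E (e 0) (e a)}"
definition BB :: "int set" where "BB = {a. 0 < a \<and> a < R \<and> odd a \<and> E (e 0) (e a)}"

lemma R3: "3 \<le> R" using R2 Rodd by presburger

lemma c: "cyc c M" using ear by (simp add: ear_def)
lemma p: "ipath e (R - 1)" using ear by (simp add: ear_def)
lemma out: "0 \<le> i \<Longrightarrow> i < R \<Longrightarrow> e i \<notin> range c" using ear by (simp add: ear_def)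

lemma S_per: "S (i + M) \<longleftrightarrow> S i" using cyc_period[OF c] by (simp add: S_def)

lemma S_gap:
  assumes "S i" "S j" "i < j" "j < i + M" "\<And>u. i < u \<Longrightarrow> u < j \<Longrightarrow> \<not> S u"
  shows "odd (j - i)"
  using ear_near[OF ear R2, of i j] assms twin Rodd by (auto simp: S_def)

lemma fins: "finite EE" "finite DD" "finite AA" "finite BB"
  by (rule finite_subset[of _ "{0..M + R}"]; use M3 R_nonneg in \<open>auto simp: EE_def DD_def AA_def BB_def\<close>)+

lemma EE_EV: "d \<in> EE \<Longrightarrow> EV d"
proof -
  assume d: "d \<in> EE"
  then have "S d \<or> S (- d)" by (simp add: EE_def)
  then have "S 0 \<and> S (0 + d) \<or> S (- d) \<and> S (- d + d)" using S0 by (auto simp: S_def)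
  then show "EV d" using d unfolding EV_def EE_def by blast
qed

text \<open>The arc complementary to \<open>d\<close> is odd and closes up with even detours:
  through \<open>e 0\<close>, through both ends of the ear with an attachment in between, along the
  ear, and along the ear with an odd chord. An even chord makes the detour odd, so it fits the even
  arc \<open>d\<close>.\<close>

lemma EV_OL:
  assumes "EV d"
  shows "M - d + 2 \<in> OL" "M - d + 4 \<in> OL" "M - d + (R + 1) \<in> OL"
    "\<And>b. b \<in> BB \<Longrightarrow> M - d + (R + 2 - b) \<in> OL"
    "\<And>a. a \<in> AA \<Longrightarrow> d + (R + 2 - a) \<in> OL"
proof -
  obtain i where i: "S i" "S (i + d)" and d: "even d" "0 < d" "d < M" using assms by (auto simp: EV_def)
  have ij: "i < i + d" "i + d < i + M" using d by auto
  have ne: "c i \<noteq> c (i + d)" using cyc_ne[OF c ij] .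
  have E: "E (e 0) (c i)" "E (e 0) (c (i + d))" "E (e (R - 1)) (c i)" "E (e (R - 1)) (c (i + d))"
    using i twin by (auto simp: S_def)
  have e0: "e 0 \<notin> range c" "e (R - 1) \<notin> range c" using out R2 by auto
  then have ec: "e 0 \<noteq> c t" "c t \<noteq> e 0" "e (R - 1) \<noteq> c t" "c t \<noteq> e (R - 1)" for t by (metis rangeI)+
  have "pth {c i, e 0, c (i + d)} (c i) (c (i + d)) 2" using path_via E ne by blast
  moreover have "{c i, e 0, c (i + d)} \<inter> range c \<subseteq> {c i, c (i + d)}" using e0 by auto
  ultimately show "M - d + 2 \<in> OL" using ext_arc(2)[OF c _ _ ij] d M_odd by auto
  obtain X where X: "pth X (c i) (c (i + d)) (R + 1)" "X \<inter> range c \<subseteq> {c i, c (i + d)}"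
    using ear_path[OF ear, of 0 i "i + d"] E R2 ne by auto
  show "M - d + (R + 1) \<in> OL" using ext_arc(2)[OF c X ij] d M_odd Rodd by auto
  have path: "\<exists>X. pth X (c i) (c (i + d)) (R + 2 - b) \<and> X \<inter> range c \<subseteq> {c i, c (i + d)}"
    if "0 < b" "b < R" "E (e 0) (e b)" for b
    using ear_path[OF ear, of b i "i + d"] E ne that by auto
  show "M - d + (R + 2 - b) \<in> OL" if b: "b \<in> BB" for b
  proof -
    obtain X where X: "pth X (c i) (c (i + d)) (R + 2 - b)" "X \<inter> range c \<subseteq> {c i, c (i + d)}"
      using path[of b] b by (auto simp: BB_def)
    show ?thesis using ext_arc(2)[OF c X ij] d M_odd Rodd b by (auto simp: BB_def)
  qed
  show "d + (R + 2 - a) \<in> OL" if a: "a \<in> AA" for a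
  proof -
    obtain X where X: "pth X (c i) (c (i + d)) (R + 2 - a)" "X \<inter> range c \<subseteq> {c i, c (i + d)}"
      using path[of a] a by (auto simp: AA_def)
    show ?thesis using ext_arc(1)[OF c X ij] d M_odd Rodd a by (auto simp: AA_def)
  qed
  \<comment> \<open>Consecutive attachments are at odd distance, so an even arc has a third
    attachment inside.\<close>
  obtain m where m: "S m" "i < m" "m < i + d" using S_gap[OF i ij] d by auto
  have em: "E (e 0) (c m)" "E (e (R - 1)) (c m)" using m twin by (auto simp: S_def)
  have n1: "c i \<noteq> c m" "c m \<noteq> c (i + d)" using cyc_ne[OF c, of i m] cyc_ne[OF c, of m "i + d"] m d by auto
  have e01: "e 0 \<noteq> e (R - 1)" using ipath_eq[OF p, of 0 "R - 1"] R2 by simp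
  have q: "pth {c i, e 0, c m} (c i) (c m) 2" "pth {c m, e (R - 1), c (i + d)} (c m) (c (i + d)) 2"
    using path_via E em n1 by blast+
  have "{c i, e 0, c m} \<inter> {c m, e (R - 1), c (i + d)} \<subseteq> {c m}" using ec e01 n1 ne by auto
  from pth_trans[OF q this] have 4: "pth ({c i, e 0, c m} \<union> {c m, e (R - 1), c (i + d)}) (c i) (c (i + d)) 4" by simp
  have "pth (c ` {i + d..i + M}) (c (i + d)) (c (i + M)) (M - d)"
    using cyc_seg[OF c, of "i + d" "i + M"] d by simp
  then have arc: "pth (c ` {i + d..i + M}) (c i) (c (i + d)) (M - d)"
    using cyc_period[OF c, of i] pth_sym by simp
  have "c m \<noteq> c t" if "t \<in> {i + d..i + M}" for t
  proof (cases "t = i + M")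
    case True then show ?thesis using n1 cyc_period[OF c, of i] by simp
  next
    case False then show ?thesis using cyc_ne[OF c, of m t] m that by auto
  qed
  then have "c m \<notin> c ` {i + d..i + M}" by (metis imageE)
  moreover have "e 0 \<notin> c ` {i + d..i + M}" "e (R - 1) \<notin> c ` {i + d..i + M}" using e0 by auto
  ultimately have "({c i, e 0, c m} \<union> {c m, e (R - 1), c (i + d)}) \<inter> c ` {i + d..i + M} \<subseteq> {c i, c (i + d)}" by blast
  then obtain f where "cyc f (4 + (M - d))" using cyc_close2[OF 4 arc _ ne] d by auto
  moreover have "odd (4 + (M - d))" using d M_odd by simp
  ultimately have "4 + (M - d) \<in> OL" using cyc_OL by blast
  then show "M - d + 4 \<in> OL" by (simp add: add.commute)
qed

lemma EV_ge: "EV d \<Longrightarrow> R + 1 \<le> d"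
  using OL_le[OF EV_OL(3)] by fastforce

lemma EV_I:
  assumes "S i" "S j" "i < j" "j < i + M"
  shows "even (j - i) \<Longrightarrow> EV (j - i)" and "odd (j - i) \<Longrightarrow> EV (M - (j - i))"
proof -
  show "EV (j - i)" if "even (j - i)" unfolding EV_def using assms that by (auto intro!: exI[of _ i])
  have "S (j + (M - (j - i)))" using S_per[of i] assms(1) by (simp add: algebra_simps)
  then show "EV (M - (j - i))" if "odd (j - i)" unfolding EV_def using assms that M_odd by (auto intro!: exI[of _ j])
qed

lemma DD_ne: "DD \<noteq> {}"
proof -
  obtain s where s: "E (e 0) (c s)" "c s \<noteq> c 0" using S_ex by blast
  have "c (s mod M) = c s" using c by (simp add: cyc_def)
  then have "S (s mod M)" "s mod M \<noteq> 0" using s by (auto simp: S_def)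
  moreover have "0 \<le> s mod M" "s mod M < M" using M3 by auto
  ultimately have "s mod M \<in> DD" unfolding DD_def by auto
  then show ?thesis by blast
qed

text \<open>Consecutive attachments are at odd distance, so along the cycle the number of attachments
  has the parity of the distance travelled.\<close>

lemma count_parity:
  "int n \<le> M \<Longrightarrow> S (int n) \<Longrightarrow> even (card {u. 0 < u \<and> u \<le> int n \<and> S u}) \<longleftrightarrow> even n"
proof (induction n rule: less_induct)
  case (less n)
  show ?case
  proof (cases "n = 0")
    case True
    then have e: "{u. 0 < u \<and> u \<le> int n \<and> S u} = {}" by auto
    show ?thesis unfolding e using True by simp
  next
    case False
    define W where "W = {u. 0 \<le> u \<and> u < int n \<and> S u}"
    have fW: "finite W" by (rule finite_subset[of _ "{0..int n}"]) (auto simp: W_def)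
    have "0 \<in> W" using S0 False by (simp add: W_def S_def)
    then have mW: "Max W \<in> W" using fW Max_in by blast
    have mx: "u \<le> Max W" if "u \<in> W" for u using that fW by simp
    obtain m where m: "Max W = int m" using mW zero_le_imp_eq_int by (auto simp: W_def)
    have m': "m < n" "S (int m)" using mW m by (auto simp: W_def)
    have none: "\<not> S u" if "int m < u" "u < int n" for u using mx[of u] m that by (auto simp: W_def)
    have "int n < int m + M"
    proof (rule ccontr)
      assume "\<not> ?thesis"
      then have "m = 0" "int n = M" using less.prems m' by auto
      then show False using none DD_ne by (auto simp: DD_def)
    qed
    then have "odd (int n - int m)" using S_gap[OF m'(2) less.prems(2)] m' none by auto
    then have od: "odd n \<longleftrightarrow> even m" by auto
    have IH: "even (card {u. 0 < u \<and> u \<le> int m \<and> S u}) \<longleftrightarrow> even m"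
      using less.IH[of m] m' less.prems by auto
    have "{u. 0 < u \<and> u \<le> int n \<and> S u} = insert (int n) {u. 0 < u \<and> u \<le> int m \<and> S u}"
    proof
      show "{u. 0 < u \<and> u \<le> int n \<and> S u} \<subseteq> insert (int n) {u. 0 < u \<and> u \<le> int m \<and> S u}"
      proof
        fix x assume x: "x \<in> {u. 0 < u \<and> u \<le> int n \<and> S u}"
        then have "x \<le> int m \<or> x = int n" using none[of x] by (cases "int m < x"; cases "x < int n") auto
        then show "x \<in> insert (int n) {u. 0 < u \<and> u \<le> int m \<and> S u}" using x by auto
      qed
      show "insert (int n) {u. 0 < u \<and> u \<le> int m \<and> S u} \<subseteq> {u. 0 < u \<and> u \<le> int n \<and> S u}"
        using m' less.prems False by auto
    qed
    moreover have "finite {u. 0 < u \<and> u \<le> int m \<and> S u}"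
      by (rule finite_subset[of _ "{0..int m}"]) auto
    ultimately have "card {u. 0 < u \<and> u \<le> int n \<and> S u} = Suc (card {u. 0 < u \<and> u \<le> int m \<and> S u})"
      using m'(1) by simp
    then show ?thesis using IH od by auto
  qed
qed

lemma even_DD: "even (card DD)"
proof -
  have "S M" using S_per[of 0] S0 by (simp add: S_def)
  then have "even (card {u. 0 < u \<and> u \<le> M \<and> S u}) \<longleftrightarrow> even (nat M)"
    using count_parity[of "nat M"] M3 by simp
  then have "odd (card {u. 0 < u \<and> u \<le> M \<and> S u})" using M_odd M3 by (simp add: even_nat_iff)
  moreover have "{u. 0 < u \<and> u \<le> M \<and> S u} = insert M DD" using \<open>S M\<close> M3 by (auto simp: DD_def)
  moreover have "M \<notin> DD" by (simp add: DD_def)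
  ultimately show ?thesis using fins by simp
qed

text \<open>Each attachment other than \<open>c 0\<close> is reached from \<open>c 0\<close> by one
  even arc, and each length occurs at most once per direction.\<close>

lemma card_DD: "card DD \<le> 2 * card EE" "card DD = 2 * card EE \<Longrightarrow> d \<in> EE \<Longrightarrow> S d \<and> S (- d)"
proof -
  define P where "P = {d \<in> EE. S d}"
  define Q where "Q = {d \<in> EE. S (- d)}"
  have per: "S (M - d) \<longleftrightarrow> S (- d)" for d using S_per[of "- d"] by (simp add: algebra_simps)
  have D: "DD = P \<union> (\<lambda>d. M - d) ` Q"
  proof
    show "DD \<subseteq> P \<union> (\<lambda>d. M - d) ` Q"
    proof
      fix d assume d: "d \<in> DD"
      show "d \<in> P \<union> (\<lambda>d. M - d) ` Q"
      proof (cases "even d")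
        case True then show ?thesis using d by (auto simp: DD_def P_def EE_def)
      next
        case False
        then have "M - d \<in> Q" using d M_odd per[of "M - d"] by (auto simp: DD_def Q_def EE_def)
        then show ?thesis by (intro UnI2 image_eqI[of _ _ "M - d"]) auto
      qed
    qed
    show "P \<union> (\<lambda>d. M - d) ` Q \<subseteq> DD" using per by (auto simp: DD_def P_def Q_def EE_def)
  qed
  have f: "finite P" "finite Q" using fins by (auto simp: P_def Q_def)
  have "P \<inter> (\<lambda>d. M - d) ` Q = {}" using M_odd by (auto simp: P_def Q_def EE_def)
  then have cD: "card DD = card P + card Q"
    unfolding D using f by (simp add: card_Un_disjoint card_image inj_on_def)
  have le: "card P \<le> card EE" "card Q \<le> card EE"
    by (rule card_mono; use fins in \<open>auto simp: P_def Q_def\<close>)+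
  then show "card DD \<le> 2 * card EE" using cD by simp
  show "S d \<and> S (- d)" if "card DD = 2 * card EE" "d \<in> EE"
  proof -
    have "card P = card EE" "card Q = card EE" using that cD le by auto
    then have "P = EE" "Q = EE" using card_subset_eq[OF fins(1)] by (auto simp: P_def Q_def)
    then show ?thesis using that(2) by (auto simp: P_def Q_def)
  qed
qed

lemma degree: "2 * k \<le> card AA + card BB + card DD + 1"
proof -
  have sub: "{u. E (e 0) u} \<subseteq> e ` (AA \<union> BB) \<union> c ` insert 0 DD"
  proof
    fix u assume "u \<in> {u. E (e 0) u}"
    then have u: "E (e 0) u" by simp
    then consider i where "i \<in> {0..R-1}" "u = e i" | "u \<in> range c" using ear unfolding ear_def by auto
    then show "u \<in> e ` (AA \<union> BB) \<union> c ` insert 0 DD"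
    proof cases
      case 1
      then have "i \<noteq> 0" using u irr by auto
      then show ?thesis using 1 u by (auto simp: AA_def BB_def)
    next
      case 2
      then obtain t where t: "0 \<le> t" "t < M" "u = c t" using cyc_rep[OF c] by blast
      then have "t \<in> insert 0 DD" using u by (auto simp: DD_def S_def)
      then show ?thesis using t by blast
    qed
  qed
  have "e 0 \<in> V" using S0 EV by blast
  then have "2 * k \<le> card {u. E (e 0) u}" by (rule mindeg)
  also have "\<dots> \<le> card (e ` (AA \<union> BB) \<union> c ` insert 0 DD)" using sub fins by (intro card_mono) auto
  also have "\<dots> \<le> card (e ` (AA \<union> BB)) + card (c ` insert 0 DD)" by (rule card_Un_le)
  also have "\<dots> \<le> card (AA \<union> BB) + card (insert 0 DD)" using fins by (intro add_mono card_image_le) auto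
  also have "\<dots> \<le> card AA + card BB + (card DD + 1)"
    using card_Un_le[of AA BB] card_insert_le_m1[of "card DD + 1" DD 0] by (intro add_mono) auto
  finally show ?thesis by simp
qed

lemma EE_ne: "EE \<noteq> {}"
proof -
  have "0 < card DD" using DD_ne fins by (simp add: card_gt_0_iff)
  then show ?thesis using card_DD(1) by auto
qed

lemma one_BB: "1 \<in> BB"
  using ipath_edge[OF p, of 0] R3 by (simp add: BB_def)

text \<open>\<open>Sg\<close> collects even detour lengths, and differences of \<open>Sg\<close> and
  \<open>EE\<close> give odd cycle lengths. Against the degree bound this forces
  \<open>BB = {1}\<close>, then \<open>R = 3\<close>, and makes every count tight.\<close>

lemma no_even_chord_case:
  assumes "AA = {}" shows False
proof -
  define n where "n = card EE"
  define Sg where "Sg = (\<lambda>b. R + 2 - b) ` BB \<union> {2, 4}"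
  define T where "T = (\<lambda>(s, E). s - E) ` (Sg \<times> EE)"
  have fS: "finite Sg" "Sg \<noteq> {}" using fins by (auto simp: Sg_def)
  have fT: "finite T" using fS fins by (simp add: T_def)
  have "M + (s - E) \<in> OL" if "s \<in> Sg" "E \<in> EE" for s E
  proof -
    have ev: "EV E" using EE_EV that(2) .
    from that(1) consider b where "b \<in> BB" "s = R + 2 - b" | "s = 2" | "s = 4" by (auto simp: Sg_def)
    then have "M - E + s \<in> OL" using EV_OL[OF ev] by cases auto
    then show ?thesis by (simp add: algebra_simps)
  qed
  then have sub: "(\<lambda>t. M + t) ` T \<subseteq> OL" by (auto simp: T_def)
  have cT: "card ((\<lambda>t. M + t) ` T) = card T" by (simp add: card_image inj_on_def)
  have kT: "card T \<le> k" using card_mono[OF finite_OL sub] cT card_OL by simp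
  have ST: "card Sg + n \<le> card T + 1"
    using card_differences[OF fS(1) fins(1) fS(2) EE_ne] by (simp add: T_def n_def)
  have cB: "card ((\<lambda>b. R + 2 - b) ` BB) = card BB" by (simp add: card_image inj_on_def)
  have 2: "2 \<notin> (\<lambda>b. R + 2 - b) ` BB" by (auto simp: BB_def)
  have "card (insert 2 ((\<lambda>b. R + 2 - b) ` BB)) \<le> card Sg"
    using fins by (intro card_mono) (auto simp: Sg_def)
  then have S1: "card BB + 1 \<le> card Sg" using 2 cB fins by simp
  have S2: "card BB + 2 \<le> card Sg" if "R - 2 \<notin> BB"
  proof -
    have "4 \<notin> (\<lambda>b. R + 2 - b) ` BB"
    proof
      assume "4 \<in> (\<lambda>b. R + 2 - b) ` BB"
      then obtain b where "b \<in> BB" "4 = R + 2 - b" by blast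
      moreover from this have "b = R - 2" by simp
      ultimately show False using that by simp
    qed
    then have "card Sg = card BB + 2" unfolding Sg_def using 2 cB fins by simp
    then show ?thesis by simp
  qed
  have deg: "2 * k \<le> card BB + card DD + 1" using degree assms by simp
  have DDn: "card DD \<le> 2 * n" using card_DD(1) by (simp add: n_def)
  have B1: "1 \<le> card BB" using one_BB fins by (metis card_0_eq empty_iff less_one linorder_not_less)
  have "card BB = 1" using S1 ST kT deg DDn B1 by linarith
  then have BB: "BB = {1}" using one_BB by (metis card_1_singletonE singletonD)
  have "R - 2 \<in> BB" using S2 ST kT deg DDn BB by (cases "R - 2 \<in> BB") auto
  then have R3': "R = 3" using BB by simp
  have Sg: "Sg = {2, 4}" using R3' BB by (auto simp: Sg_def)
  have kn: "k = n + 1" "card DD = 2 * card EE" "card T = n + 1"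
    using S1 ST kT deg DDn BB even_DD by (auto simp: n_def)
  have OLT: "(\<lambda>t. M + t) ` T = OL"
    using card_subset_eq[OF finite_OL sub] cT kn card_OL card_mono[OF finite_OL sub] by simp
  have ge4: "4 \<le> d" if "EV d" for d using EV_ge[OF that] R3' by simp
  \<comment> \<open>As \<open>M\<close> is a length, some detour is as long as an even arc, and even
    arcs have length at least 4.\<close>
  have "M \<in> (\<lambda>t. M + t) ` T" using OLT M_OL by simp
  then have "0 \<in> T" by auto
  then have E4: "4 \<in> EE" using ge4 EE_EV by (fastforce simp: T_def Sg)
  have S4: "S 4" "S (- 4)" using card_DD(2)[OF kn(2) E4] by auto
  define X where "X = Max EE"
  have X: "X \<in> EE" "\<And>E. E \<in> EE \<Longrightarrow> E \<le> X" using fins EE_ne by (auto simp: X_def)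
  have T': "T = insert (2 - X) ((\<lambda>E. 4 - E) ` EE)"
  proof -
    have sb: "insert (2 - X) ((\<lambda>E. 4 - E) ` EE) \<subseteq> T" using X(1) by (auto simp: T_def Sg image_iff)
    have "2 - X \<notin> (\<lambda>E. 4 - E) ` EE" using X(2) by force
    then have "card (insert (2 - X) ((\<lambda>E. 4 - E) ` EE)) = n + 1"
      using fins by (simp add: card_image inj_on_def n_def)
    then show ?thesis using card_subset_eq[OF fT sb] kn(3) by simp
  qed
  show False
  proof (cases "X = 4")
    case False
    have "2 - 4 \<in> T" using E4 unfolding T_def Sg by (intro image_eqI[of _ _ "(2, 4)"]) auto
    then have "2 - 4 \<in> insert (2 - X) ((\<lambda>E. 4 - E) ` EE)" using T' by metis
    then have "2 - 4 \<in> (\<lambda>E. 4 - E) ` EE" using False by simp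
    then obtain E where "E \<in> EE" "2 - 4 = 4 - E" by (rule imageE)
    moreover from this have "E = 6" by simp
    ultimately have 6: "6 \<in> EE" by simp
    then have "6 < M" by (simp add: EE_def)
    moreover have "S 6" using card_DD(2)[OF kn(2) 6] by simp
    ultimately have "S 6" "6 < M" by auto
    then have "EV 2" using EV_I(1)[of 4 6] S4 by simp
    then show False using ge4 by fastforce
  next
    case True
    have "E = 4" if "E \<in> EE" for E using X(2)[OF that] True ge4[OF EE_EV[OF that]] by simp
    then have EE4: "EE = {4}" using E4 by blast
    have OL': "OL = {M, M - 2}" using OLT[symmetric] T' EE4 True by auto
    have M4: "4 < M" using E4 by (simp add: EE_def)
    have m: "S (M - 4)" using S4(2) S_per[of "- 4"] by simp
    \<comment> \<open>The attachments at \<open>4\<close> and \<open>- 4\<close> are joined by an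
      even arc of length 8, or of length 2 or 6 for small \<open>M\<close>; each is
      impossible.\<close>
    have "8 < M \<or> M = 5 \<or> M = 7" using M4 M_odd by presburger
    then consider "8 < M" | "M = 5" | "M = 7" by blast
    then show False
    proof cases
      case 1
      have "EV 8" using EV_I(1)[of "- 4" 4] S4 1 by simp
      then show False using EV_OL(1)[of 8] OL' by auto
    next
      case 2
      have "EV 2" using EV_I(2)[of 1 4] m S4 2 by simp
      then show False using ge4 by fastforce
    next
      case 3
      have "EV 6" using EV_I(2)[of 3 4] m S4 3 by simp
      then show False using EV_OL(1)[of 6] OL' 3 by auto
    qed
  qed
qed

text \<open>Chords of the ear give the lengths \<open>I + 2\<close>, at most \<open>R\<close>; the
  ear with arcs of the cycle gives the lengths \<open>H\<close>, above \<open>R\<close>. The degree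
  bound makes \<open>OL\<close> exactly their union. Lengths above \<open>R\<close> then force
  \<open>EE\<close> to consist of multiples of \<open>R + 1\<close>, and one numerical arrangement
  is left to refute.\<close>

lemma even_chord_case:
  assumes "AA \<noteq> {}" shows False
proof -
  define n where "n = card EE"
  define I where "I = (\<lambda>(a, b). \<bar>a - b\<bar>) ` (AA \<times> insert R BB)"
  \<comment> \<open>With the attachment \<open>c 0\<close> appended, position \<open>R\<close> is a
    further odd neighbour of \<open>e 0\<close>.\<close>
  define q where "q = (\<lambda>i. if i < R then e i else c 0)"
  have q: "ipath q R" unfolding ipath_def
  proof (intro conjI allI impI)
    show "inj_on q {0..R}"
    proof (rule inj_onI)
      fix i j assume a: "i \<in> {0..R}" "j \<in> {0..R}" "q i = q j"
      have "e x \<noteq> c 0" if "0 \<le> x" "x < R" for x using out[OF that] by (metis rangeI)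
      then show "i = j" using a ipath_eq[OF p, of i j] by (auto simp: q_def split: if_splits)
    qed
    fix i assume i: "0 \<le> i \<and> i < R"
    show "E (q i) (q (i + 1))"
    proof (cases "i + 1 = R")
      case True
      then have "i = R - 1" by simp
      then show ?thesis using twin[of 0] S0 by (simp add: q_def)
    next
      case False then show ?thesis using ipath_edge[OF p, of i] i by (simp add: q_def)
    qed
  qed (use R_nonneg in simp)
  have q0: "q 0 = e 0" using R3 by (simp add: q_def)
  have star': "\<bar>a - b\<bar> + 2 \<in> OL" if "a \<in> AA" "b \<in> insert R BB" for a b
  proof (rule star[OF q])
    show "E (q 0) (q a)" using that(1) q0 by (simp add: AA_def q_def)
    show "E (q 0) (q b)" using that(2) q0 S0 by (auto simp: BB_def q_def)
  qed (use that R3 Rodd in \<open>auto simp: AA_def BB_def\<close>)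
  have I: "(\<lambda>x. x + 2) ` I \<subseteq> OL" using star' by (auto simp: I_def)
  have I_le: "x + 2 \<le> R" if "x \<in> I" for x
    using that R3 Rodd by (auto simp: I_def AA_def BB_def abs_if)
  define H where "H = (\<lambda>E. M - E + (R + 1)) ` EE"
  have H: "H \<subseteq> OL" using EV_OL(3) EE_EV by (auto simp: H_def)
  have H_ge: "R + 2 \<le> x" if "x \<in> H" for x using that by (auto simp: H_def EE_def)
  have fI: "finite I" using fins by (simp add: I_def)
  have cI: "card ((\<lambda>x. x + 2) ` I) = card I" by (simp add: card_image)
  have cH: "card H = n" by (simp add: H_def n_def card_image inj_on_def)
  have disj: "(\<lambda>x. x + 2) ` I \<inter> H = {}" using I_le H_ge by fastforce
  have cU: "card ((\<lambda>x. x + 2) ` I \<union> H) = card I + n"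
    using card_Un_disjoint[OF _ _ disj] fI fins cI cH by (simp add: H_def)
  have kI: "card I + n \<le> k"
    using card_mono[OF finite_OL, of "(\<lambda>x. x + 2) ` I \<union> H"] I H cU card_OL by simp
  have "R \<notin> BB" by (simp add: BB_def)
  then have AB: "card AA + card BB \<le> 2 * card I"
    using card_abs_differences[OF fins(3) _ assms, of "insert R BB"] fins by (simp add: I_def)
  have DDn: "card DD \<le> 2 * n" using card_DD(1) by (simp add: n_def)
  \<comment> \<open>The parity of \<open>card DD\<close> removes the one unit of slack in the degree
    count.\<close>
  have kn: "card DD = 2 * card EE" "k = card I + n"
    using degree kI AB DDn even_DD by (auto simp: n_def elim!: evenE)
  have OLU: "(\<lambda>x. x + 2) ` I \<union> H = OL"
    using card_subset_eq[OF finite_OL, of "(\<lambda>x. x + 2) ` I \<union> H"] I H cU kn(2) card_OL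
      card_mono[OF finite_OL, of "(\<lambda>x. x + 2) ` I \<union> H"] by simp
  have OLH: "\<exists>E\<in>EE. m = M - E + (R + 1)" if "m \<in> OL" "R < m" for m
  proof -
    have "m \<in> (\<lambda>x. x + 2) ` I \<union> H" using that(1) OLU by simp
    then have "m \<in> H" using I_le[of "m - 2"] that(2) by auto
    then show ?thesis by (auto simp: H_def)
  qed
  have OLI: "m - 2 \<in> I" if "m \<in> OL" "m \<le> R" for m
  proof -
    have "m \<in> (\<lambda>x. x + 2) ` I \<union> H" using that(1) OLU by simp
    then have "m \<in> (\<lambda>x. x + 2) ` I" using H_ge[of m] that(2) by auto
    then show ?thesis by auto
  qed
  have EVEE: "d \<in> EE" if h: "EV d" for d
  proof -
    have "R < M - d + (R + 1)" using h by (simp add: EV_def)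
    then obtain E where "E \<in> EE" "M - d + (R + 1) = M - E + (R + 1)" using OLH[OF EV_OL(3)[OF h]] by blast
    then show ?thesis by simp
  qed
  \<comment> \<open>The least length that \<open>EV_ge\<close> permits for an even arc.\<close>
  define \<mu> where "\<mu> = R + 1"
  have \<mu>: "\<mu> \<in> EE"
  proof -
    obtain E where E: "E \<in> EE" using EE_ne by blast
    then have "M - E + (R + 1) \<le> M" using EV_OL(3)[OF EE_EV[OF E]] OL_le by blast
    moreover have "E < M" using E by (simp add: EE_def)
    ultimately have "R < M" by simp
    then obtain E where "E \<in> EE" "M = M - E + (R + 1)" using OLH[OF M_OL] by blast
    then show ?thesis by (simp add: \<mu>_def)
  qed
  have SS: "S d" "S (- d)" if "d \<in> EE" for d using card_DD(2)[OF kn(1) that] by auto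
  have lt: "d < M" "even d" "0 < d" if "d \<in> EE" for d using that by (auto simp: EE_def)
  \<comment> \<open>The attachments at \<open>\<mu>\<close> and \<open>d\<close> are at even
    distance \<open>d - \<mu>\<close>, again an element of \<open>EE\<close>: a Euclidean
    descent.\<close>
  have mult: "d \<in> EE \<Longrightarrow> \<mu> dvd d" for d
  proof (induction "nat d" arbitrary: d rule: less_induct)
    case less
    have "\<mu> \<le> d" using EV_ge[OF EE_EV[OF less.prems]] by (simp add: \<mu>_def)
    show ?case
    proof (cases "d = \<mu>")
      case False
      then have "EV (d - \<mu>)" using EV_I(1)[of \<mu> d] SS \<mu> less.prems \<open>\<mu> \<le> d\<close> lt[OF \<mu>] lt[OF less.prems] by auto
      then have "d - \<mu> \<in> EE" by (rule EVEE)
      moreover have "nat (d - \<mu>) < nat d" using lt[OF \<mu>] \<open>\<mu> \<le> d\<close> by auto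
      ultimately have "\<mu> dvd d - \<mu>" using less.hyps by blast
      then show ?thesis by (metis dvd_add_triv_right_iff diff_add_cancel)
    qed simp
  qed
  define X where "X = Max EE"
  have X: "X \<in> EE" "\<And>E. E \<in> EE \<Longrightarrow> E \<le> X" using fins EE_ne by (auto simp: X_def)
  have "\<not> X + \<mu> < M"
  proof
    assume "X + \<mu> < M"
    then have "EV (X + \<mu>)" using EV_I(1)[of "- \<mu>" X] SS X(1) \<mu> lt[OF X(1)] lt[OF \<mu>] by auto
    then show False using X(2)[OF EVEE] lt[OF \<mu>] by fastforce
  qed
  moreover have "X + \<mu> \<noteq> M"
  proof -
    have "even (X + \<mu>)" using lt(2)[OF X(1)] lt(2)[OF \<mu>] by simp
    then show ?thesis using M_odd by metis
  qed
  ultimately have XM: "M < X + \<mu>" by simp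
  \<comment> \<open>The attachments at \<open>M - \<mu>\<close> and \<open>X\<close> are at odd
    distance, so the even arc between them goes the other way round.\<close>
  have XX: "2 * M - X - \<mu> \<in> EE"
  proof -
    have "S (M - \<mu>)" using SS(2)[OF \<mu>] S_per[of "- \<mu>"] by simp
    moreover have "odd (X - (M - \<mu>))" using lt[OF X(1)] lt[OF \<mu>] M_odd by auto
    ultimately have "EV (M - (X - (M - \<mu>)))" using EV_I(2)[of "M - \<mu>" X] SS(1)[OF X(1)] XM lt[OF \<mu>] lt[OF X(1)] by simp
    moreover have "M - (X - (M - \<mu>)) = 2 * M - X - \<mu>" by simp
    ultimately show ?thesis using EVEE by metis
  qed
  have dvd2M: "\<mu> dvd 2 * M"
  proof -
    have "2 * M = (2 * M - X - \<mu>) + X + \<mu>" by simp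
    then show ?thesis using mult[OF XX] mult[OF X(1)] by (metis dvd_add dvd_refl)
  qed
  have "\<mu> \<le> X" "\<mu> \<le> 2 * M - X - \<mu>"
    using EV_ge[OF EE_EV[OF X(1)]] EV_ge[OF EE_EV[OF XX]] by (simp_all add: \<mu>_def)
  then have M3\<mu>: "3 * \<mu> \<le> 2 * M" by simp
  \<comment> \<open>The length from the even chord exceeds \<open>R\<close>, hence lies in
    \<open>H\<close>. This makes \<open>2 * (a - 1)\<close> a multiple of \<open>\<mu>\<close>
    strictly between \<open>0\<close> and \<open>2 * \<mu>\<close>.\<close>
  have AA1: "R = 2 * a - 3" if a: "a \<in> AA" for a
  proof -
    have a': "0 < a" "a < R" "even a" using a by (auto simp: AA_def)
    have o: "\<mu> + (R + 2 - a) \<in> OL" using EV_OL(5)[OF EE_EV[OF \<mu>] a] .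
    obtain E where E: "E \<in> EE" "\<mu> + (R + 2 - a) = M - E + (R + 1)" using OLH[OF o] a' by (auto simp: \<mu>_def)
    have "2 * (a - 1) = 2 * E + 2 * \<mu> - 2 * M" using E(2) by simp
    then have "\<mu> dvd 2 * (a - 1)" using mult[OF E(1)] dvd2M by (metis dvd_add dvd_diff dvd_mult dvd_triv_right)
    then obtain t where t: "2 * (a - 1) = \<mu> * t" by blast
    have "\<mu> * 0 < \<mu> * t" "\<mu> * t < \<mu> * 2" "0 < \<mu>" using t a' \<mu>_def by auto
    then have "0 < t" "t < 2" by (simp_all only: mult_less_cancel_left_pos)
    then have "t = 1" by simp
    then show ?thesis using t \<mu>_def by simp
  qed
  obtain a where a: "a \<in> AA" using assms by blast
  have Ra: "R = 2 * a - 3" "even a" "0 < a" using AA1[OF a] a by (auto simp: AA_def)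
  have a4: "4 \<le> a" using Ra R3 by presburger
  have "a' = a" if "a' \<in> AA" for a' using AA1[OF that] Ra(1) by simp
  then have AAa: "AA = {a}" using a by blast
  have \<mu>a: "\<mu> = 2 * a - 2" using Ra by (simp add: \<mu>_def)
  have o4: "M - \<mu> + 4 \<in> OL" "M - \<mu> + 2 \<in> OL" using EV_OL[OF EE_EV[OF \<mu>]] by auto
  have small: "M - \<mu> + 4 \<le> R"
  proof (rule ccontr)
    assume "\<not> ?thesis"
    then obtain E where E: "E \<in> EE" "M - \<mu> + 4 = M - E + (R + 1)" using OLH[OF o4(1)] by auto
    then have "E = 2 * \<mu> - 4" by (simp add: \<mu>_def)
    then have "\<mu> dvd 2 * \<mu> - 4" using mult[OF E(1)] by simp
    then have "\<mu> dvd 4" by (metis dvd_diff_right_iff dvd_triv_right)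
    then have "\<mu> \<le> 4" using zdvd_imp_le[of \<mu> 4] by simp
    then show False using \<mu>a a4 by simp
  qed
  have M3: "2 * M = 3 * \<mu>"
  proof -
    obtain t where t: "2 * M = \<mu> * t" using dvd2M by blast
    have "2 * M < 4 * \<mu>" using small \<mu>_def by simp
    then have "\<mu> * t < \<mu> * 4" "\<mu> * 3 \<le> \<mu> * t" "0 < \<mu>" using t M3\<mu> \<mu>a a4 by linarith+
    then have "t < 4" "3 \<le> t" by (simp_all only: mult_less_cancel_left_pos mult_le_cancel_left_pos)
    then have "t = 3" by simp
    then show ?thesis using t by simp
  qed
  have Ma: "M = 3 * a - 3" using M3 \<mu>a by simp
  have EE1: "EE = {\<mu>}"
  proof -
    have "d = \<mu>" if "d \<in> EE" for d
    proof -
      have md: "\<mu> dvd d" using mult[OF that] .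
      obtain t where t: "d = \<mu> * t" using md by blast
      have "\<mu> * t < \<mu> * 2" "\<mu> * 0 < \<mu> * t" "0 < \<mu>" using t lt[OF that] M3 lt(3)[OF \<mu>] by linarith+
      then have "t < 2" "0 < t" by (simp_all only: mult_less_cancel_left_pos)
      then have "t = 1" by simp
      then show ?thesis using t by simp
    qed
    then show ?thesis using \<mu> by blast
  qed
  have n1: "n = 1" by (simp add: n_def EE1)
  have I1: "a - 1 \<in> I" "a + 1 \<in> I"
    using OLI[OF o4(2)] OLI[OF o4(1)] small Ma \<mu>a by (auto simp: algebra_simps)
  \<comment> \<open>The only length above \<open>R\<close> is now \<open>M\<close>, attained for
    \<open>b = 1\<close>; the other odd chords give lengths from \<open>I + 2\<close>.\<close>
  have bI: "M - 1 - b \<in> I" if b: "b \<in> BB" "b \<noteq> 1" for b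
  proof -
    have o: "M - \<mu> + (R + 2 - b) \<in> OL" using EV_OL(4)[OF EE_EV[OF \<mu>] b(1)] .
    have e: "M - \<mu> + (R + 2 - b) = M + 1 - b" by (simp add: \<mu>_def)
    have "M + 1 - b \<le> R"
    proof (rule ccontr)
      assume "\<not> ?thesis"
      then obtain E where "E \<in> EE" "M + 1 - b = M - E + (R + 1)" using OLH[of "M + 1 - b"] o e by auto
      then show False using EE1 b(2) by (simp add: \<mu>_def)
    qed
    then have "M + 1 - b - 2 \<in> I" using OLI[of "M + 1 - b"] o e by simp
    then show ?thesis by (simp add: algebra_simps)
  qed
  have "insert (a - 1) ((\<lambda>b. M - 1 - b) ` (BB - {1})) \<subseteq> I" using I1 bI by auto
  then have "card (insert (a - 1) ((\<lambda>b. M - 1 - b) ` (BB - {1}))) \<le> card I" by (intro card_mono[OF fI])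
  moreover have "a - 1 \<notin> (\<lambda>b. M - 1 - b) ` (BB - {1})" using Ma Ra by (auto simp: BB_def)
  ultimately have cB: "card BB \<le> card I"
    using fins one_BB by (simp add: card_image inj_on_def card_Diff_singleton)
  have deg: "2 * (card I + 1) \<le> card BB + 4" using degree kn AAa EE1 n1 by simp
  have "card {a - 1, a + 1} \<le> card I" using I1 by (intro card_mono[OF fI]) auto
  then have c2: "card I = 2" "card BB = 2" using deg cB by auto
  have II: "I = {a - 1, a + 1}" using card_subset_eq[OF fI, of "{a - 1, a + 1}"] I1 c2 by simp
  obtain b where b: "b \<in> BB" "b \<noteq> 1"
    using c2(2) one_BB by (metis card_2_iff insertI1 insertI2)
  have "M - 1 - b = a + 1"
  proof -
    have "b \<noteq> R" using b by (simp add: BB_def)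
    then show ?thesis using bI[OF b] II Ma Ra by auto
  qed
  then have ba: "b = 2 * a - 5" using Ma by simp
  have "\<bar>a - b\<bar> \<in> I" using a b by (auto simp: I_def)
  then have "\<bar>a - b\<bar> = a - 1 \<or> \<bar>a - b\<bar> = a + 1" using II by simp
  then show False using ba Ra(2) a4 by (auto simp: abs_if split: if_splits)
qed

end

context odd_critical
begin

text \<open>\<open>meet_odd\<close> and \<open>both_iff\<close> make the attachments of the two ends
  equal and \<open>R\<close> odd. Shifting \<open>s\<close> to \<open>0\<close> gives a
  \<open>twin_ear\<close>, both of whose cases are refuted.\<close>

lemma no_ear:
  assumes ear: "ear c e" and R2: "2 \<le> R" and s: "E (e 0) (c s)" and x: "E (e (R - 1)) (c x)" and ne: "c s \<noteq> c x"
  shows False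
proof -
  have c: "cyc c M" using ear by (simp add: ear_def)
  interpret n: near "\<lambda>i. E (e 0) (c i)" "\<lambda>i. E (e (R - 1)) (c i)" M R
    using ear_near_locale[OF ear R2] .
  define y where "y = s + (x - s) mod M"
  have "y mod M = x mod M" by (simp add: y_def mod_add_right_eq)
  then have y: "c y = c x" using c by (simp add: cyc_def)
  have "0 \<le> (x - s) mod M" "(x - s) mod M < M" using M3 by auto
  moreover have "y \<noteq> s" using ne y by auto
  ultimately have sy: "s < y" "y < s + M" by (auto simp: y_def)
  have m: "odd R" "\<exists>i. E (e 0) (c i) \<and> E (e (R - 1)) (c i)"
    using n.meet_odd[OF s _ sy] x y by auto
  then obtain z where z: "E (e 0) (c z)" "E (e (R - 1)) (c z)" by blast
  have iff: "E (e 0) (c i) \<longleftrightarrow> E (e (R - 1)) (c i)" for i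
    using n.both_iff[OF m(1) z] M3 by simp
  define d where "d = (\<lambda>i. c (i + s))"
  have "E (e 0) (c x)" using iff x by simp
  moreover have "d (x - s) = c x" "d 0 = c s" by (simp_all add: d_def)
  ultimately have ex: "\<exists>t. E (e 0) (d t) \<and> d t \<noteq> d 0" using ne by metis
  interpret t: twin_ear V E k d e
  proof
    show "ear d e" unfolding d_def by (rule ear_shift[OF ear])
    show "E (e (R - 1)) (d i) = E (e 0) (d i)" for i using iff by (simp add: d_def)
    show "E (e 0) (d 0)" using s by (simp add: d_def)
  qed (fact R2 m(1) ex)+
  show False using t.no_even_chord_case t.even_chord_case by blast
qed

lemma tail_end_nbrs:
  assumes t: "tail c e R" and R2: "2 \<le> R" and u: "E (e 0) u"
  shows "u \<in> e ` {1..R}"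
proof (rule ccontr)
  assume n: "u \<notin> e ` {1..R}"
  have p: "ipath e R" and c: "cyc c M" using t by (auto simp: tail_def)
  have "u \<noteq> e 0" using u irr by auto
  moreover have "{0..R} = insert 0 {1..R}" using R_nonneg by auto
  ultimately have "u \<in> range c" using tail_nbrs[OF t u] n by auto
  then obtain s where s: "u = c s" by auto
  obtain x where x: "e R = c x" using t by (auto simp: tail_def)
  have ear: "ear c e" using tail_ear[OF t] R2 u s by auto
  have "E (e (R - 1)) (c x)" using ipath_edge[OF p, of "R - 1"] R2 x by simp
  moreover have "e R \<in> e ` {1..R}" using R2 by auto
  then have "c s \<noteq> c x" using n s x by metis
  ultimately show False using no_ear[OF ear R2] u s by auto
qed

end

section \<open>Tails whose end has no neighbour on the cycle\<close>

lemma card_sums_le: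
  fixes A B L :: "int set"
  assumes "finite A" "finite B" "finite L" "A \<noteq> {}" "B \<noteq> {}" "inj_on f A" "inj_on g B"
    and sub: "\<And>a b. a \<in> A \<Longrightarrow> b \<in> B \<Longrightarrow> f a + g b \<in> L"
  shows "card A + card B \<le> card L + 1"
proof -
  have "inj_on (\<lambda>b. - g b) B" using assms(7) by (auto simp: inj_on_def)
  then have c: "card (f ` A) = card A" "card ((\<lambda>b. - g b) ` B) = card B" using assms(6) by (simp_all add: card_image)
  have "(\<lambda>(a, b). a - b) ` (f ` A \<times> (\<lambda>b. - g b) ` B) \<subseteq> L" using sub by auto
  then have "card ((\<lambda>(a, b). a - b) ` (f ` A \<times> (\<lambda>b. - g b) ` B)) \<le> card L" using assms(3) by (rule card_mono[rotated])
  then show ?thesis using card_differences[of "f ` A" "(\<lambda>b. - g b) ` B"] assms(1,2,4,5) c by simp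
qed

lemma int_card_2:
  fixes S :: "int set"
  assumes "card S = 2" obtains a b where "a < b" "S = {a, b}"
proof -
  obtain a b where "a \<noteq> b" "S = {a, b}" using assms by (meson card_2_iff)
  then show ?thesis using that[of a b] that[of b a] by (cases "a < b") auto
qed

text \<open>The neighbour patterns \<open>I\<close> of the end of a path with exits at positions \<open>i < j\<close> that survive
  the count of path lengths between the exits.\<close>

definition formA :: "int set \<Rightarrow> int \<Rightarrow> int \<Rightarrow> bool" where
  "formA I i j \<longleftrightarrow> 3 \<le> i \<and> 2 * i + 1 \<le> j \<and> I = {1, 2 * i - 1, 2 * j - 2 * i - 1, 2 * j - 2 * i + 1}"
definition formB :: "int set \<Rightarrow> int \<Rightarrow> int \<Rightarrow> bool" where
  "formB I i j \<longleftrightarrow> 3 \<le> i \<and> 2 * i + 3 \<le> j \<and> I = {1, 2 * i - 1, 2 * i + 1, 2 * j - 2 * i - 1}"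
definition formC :: "nat \<Rightarrow> int set \<Rightarrow> int \<Rightarrow> int \<Rightarrow> bool" where
  "formC k I i j \<longleftrightarrow> 3 \<le> i \<and> 2 * i + 1 \<le> j \<and>
     I = (if k = 2 then {1, 3, 2 * i - 1, 2 * j - 2 * i + 1}
          else {1, 3, 2 * i - 3, 2 * i - 1, 2 * j - 2 * i + 1, 2 * j - 2 * i + 3})"

text \<open>The exits cut \<open>I\<close> into \<open>P\<close>, \<open>Q\<close>,
  \<open>T\<close>. Sums over any two nonempty parts lie in \<open>L\<close>, so two parts have at
  most \<open>k + 1\<close> elements; with at least \<open>2 * k\<close> in all,
  \<open>4 * k \<le> 3 * (k + 1)\<close> and \<open>k \<le> 3\<close>. Then the listed sums exhaust
  \<open>L\<close>, and the positions can be solved for.\<close>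

lemma attachment_forms:
  fixes I L :: "int set"
  assumes k: "2 \<le> k" and I: "finite I" "2 * k \<le> card I" "1 \<in> I" "\<And>b. b \<in> I \<Longrightarrow> 1 \<le> b"
    and ij: "0 \<le> i" "i < j" "i + 1 \<notin> I" "j + 1 \<notin> I" and b: "b \<in> I" "i < b"
    and L: "finite L" "card L \<le> k" and d: "j - i \<in> L"
    and PQ: "\<And>a b. a \<in> I \<Longrightarrow> b \<in> I \<Longrightarrow> a \<le> i \<Longrightarrow> i < b \<Longrightarrow> b \<le> j \<Longrightarrow> (i - a) + (j - b) + 2 \<in> L"
    and PR: "\<And>a c. a \<in> I \<Longrightarrow> c \<in> I \<Longrightarrow> a \<le> i \<Longrightarrow> j \<le> c \<Longrightarrow> (i - a) + (c - j) + 2 \<in> L"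
    and QR: "\<And>b c. b \<in> I \<Longrightarrow> c \<in> I \<Longrightarrow> i < b \<Longrightarrow> b < j \<Longrightarrow> j \<le> c \<Longrightarrow> (b - i) + (c - j) + 2 \<in> L"
  shows "formC k I i j \<or> k = 2 \<and> (formA I i j \<or> formB I i j)"
proof -
  have i1: "1 \<le> i" using ij(1,3) I(3) by (cases "i = 0") auto
  define P where "P = {a \<in> I. a \<le> i}"
  define Q where "Q = {a \<in> I. i < a \<and> a < j}"
  define T where "T = {a \<in> I. j \<le> a}"
  have f: "finite P" "finite Q" "finite T" using I(1) by (auto simp: P_def Q_def T_def)
  have IU: "I = P \<union> Q \<union> T" by (auto simp: P_def Q_def T_def)
  have "P \<inter> Q = {}" "(P \<union> Q) \<inter> T = {}" using ij by (auto simp: P_def Q_def T_def)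
  then have cI: "2 * k \<le> card P + card Q + card T" using f I(2) unfolding IU by (simp add: card_Un_disjoint)
  have P1: "1 \<in> P" using I(3) i1 by (simp add: P_def)
  then have Pn: "P \<noteq> {}" "0 < card P" using f by (auto simp: card_gt_0_iff)
  have pq: "card P + card Q \<le> k + 1" if "Q \<noteq> {}"
    using card_sums_le[OF f(1,2) L(1) Pn(1) that, of "\<lambda>a. i - a" "\<lambda>b. j - b + 2"] PQ L(2)
    by (fastforce simp: P_def Q_def inj_on_def add.assoc)
  have pr: "card P + card T \<le> k + 1" if "T \<noteq> {}"
    using card_sums_le[OF f(1,3) L(1) Pn(1) that, of "\<lambda>a. i - a" "\<lambda>b. b - j + 2"] PR L(2)
    by (fastforce simp: P_def T_def inj_on_def add.assoc)
  have qr: "card Q + card T \<le> k + 1" if "Q \<noteq> {}" "T \<noteq> {}"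
    using card_sums_le[OF f(2,3) L(1) that, of "\<lambda>b. b - i" "\<lambda>b. b - j + 2"] QR L(2)
    by (fastforce simp: Q_def T_def inj_on_def add.assoc)
  have "b \<in> Q \<or> b \<in> T" using b by (auto simp: Q_def T_def)
  then have "Q \<noteq> {} \<or> T \<noteq> {}" by blast
  have ne: "Q \<noteq> {}" "T \<noteq> {}"
  proof -
    show "Q \<noteq> {}"
    proof
      assume 0: "Q = {}"
      then have "card P + card T \<le> k + 1" using pr \<open>Q \<noteq> {} \<or> T \<noteq> {}\<close> by blast
      then show False using cI k by (simp add: 0)
    qed
    from pq[OF this] show "T \<noteq> {}" using cI k by (cases "T = {}") auto
  qed
  then have c0: "0 < card Q" "0 < card T" using f by (auto simp: card_gt_0_iff)
  have le: "card P + card Q \<le> k + 1" "card P + card T \<le> k + 1" "card Q + card T \<le> k + 1"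
    using pq pr qr ne by auto
  then have "k = 2 \<or> k = 3" using cI k by linarith
  then show ?thesis
  proof
    assume k: "k = 2"
    have two: "z = x \<or> z = y" if "x \<in> L" "y \<in> L" "x < y" "z \<in> L" for x y z
    proof (rule ccontr)
      assume "\<not> ?thesis"
      then have "card {x, y, z} = 3" using that by auto
      then show False using card_mono[OF L(1), of "{x, y, z}"] that L(2) k by simp
    qed
    \<comment> \<open>The part with two elements decides the pattern: \<open>P\<close> gives C,
      \<open>Q\<close> gives B, \<open>T\<close> gives A.\<close>
    consider "card P = 2" "card Q = 1" "card T = 1" | "card P = 1" "card Q = 2" "card T = 1"
      | "card P = 1" "card Q = 1" "card T = 2" using le cI k Pn c0 by linarith
    then show ?thesis
    proof cases
      case 1
      obtain a0 a where P: "a0 < a" "P = {a0, a}" using int_card_2[OF 1(1)] .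
      have "a0 \<in> P" "1 \<in> {a0, a}" using P1 P(2) by blast+
      then have a0: "a0 = 1" using P(1) I(4)[of a0] by (auto simp: P_def)
      obtain b where Q: "Q = {b}" using 1(2) card_1_singletonE by blast
      obtain c where T: "T = {c}" using 1(3) card_1_singletonE by blast
      have m: "1 \<in> I" "a \<in> I" "b \<in> I" "c \<in> I" and o: "a \<le> i" "1 < a" "i < b" "b < j" "j \<le> c"
        using P Q T a0 unfolding P_def Q_def T_def by blast+
      have n: "b \<noteq> i + 1" "c \<noteq> j + 1" using m ij by auto
      have l: "(i - a) + (c - j) + 2 \<in> L" "(i - 1) + (c - j) + 2 \<in> L"
        "(i - a) + (j - b) + 2 \<in> L" "(i - 1) + (j - b) + 2 \<in> L" "(b - i) + (c - j) + 2 \<in> L"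
        by (intro PR PQ QR; use m o i1 in simp)+
      have lt: "(i - a) + (c - j) + 2 < (i - 1) + (c - j) + 2" using o by simp
      note w = two[OF l(1,2) lt]
      have bc: "j - b = c - j" using w[OF l(3)] w[OF l(4)] o by linarith
      have "a = 3" "b = 2 * i - 1" using w[OF l(5)] w[OF d] bc o by linarith+
      then have "c = 2 * j - 2 * i + 1" using bc by simp
      then show ?thesis using k \<open>a = 3\<close> \<open>b = _\<close> o n unfolding formC_def IU P(2) Q T a0 by auto
    next
      case 2
      obtain b b' where Q: "b < b'" "Q = {b, b'}" using int_card_2[OF 2(2)] .
      obtain c where T: "T = {c}" using 2(3) card_1_singletonE by blast
      have P: "P = {1}" using 2(1) P1 card_1_singletonE by (metis singletonD)
      have m: "1 \<in> I" "b \<in> I" "b' \<in> I" "c \<in> I" and o: "i < b" "b' < j" "j \<le> c"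
        using P Q T unfolding P_def Q_def T_def by blast+
      have n: "b \<noteq> i + 1" "c \<noteq> j + 1" using m ij by auto
      have l: "(b - i) + (c - j) + 2 \<in> L" "(b' - i) + (c - j) + 2 \<in> L"
        "(i - 1) + (j - b) + 2 \<in> L" "(i - 1) + (j - b') + 2 \<in> L" "(i - 1) + (c - j) + 2 \<in> L"
        by (intro PR PQ QR; use m o Q i1 in simp)+
      have lt: "(b - i) + (c - j) + 2 < (b' - i) + (c - j) + 2" using Q by simp
      note w = two[OF l(1,2) lt]
      have e: "i - 1 + j = b - i + c - j + b'" using w[OF l(3)] w[OF l(4)] Q by linarith
      have "b = 2 * i - 1" "b' = 2 * i + 1" using w[OF l(5)] w[OF d] e o Q by linarith+
      moreover from this have "c = 2 * j - 2 * i - 1" using e by simp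
      ultimately show ?thesis using k o n unfolding formB_def IU P Q(2) T by auto
    next
      case 3
      obtain c c' where T: "c < c'" "T = {c, c'}" using int_card_2[OF 3(3)] .
      obtain b where Q: "Q = {b}" using 3(2) card_1_singletonE by blast
      have P: "P = {1}" using 3(1) P1 card_1_singletonE by (metis singletonD)
      have m: "1 \<in> I" "b \<in> I" "c' \<in> I" "c \<in> I" and o: "i < b" "b < j" "j \<le> c"
        using P Q T unfolding P_def Q_def T_def by blast+
      have n: "b \<noteq> i + 1" "c \<noteq> j + 1" using m ij by auto
      have l: "(b - i) + (c - j) + 2 \<in> L" "(b - i) + (c' - j) + 2 \<in> L"
        "(i - 1) + (j - b) + 2 \<in> L" "(i - 1) + (c - j) + 2 \<in> L" "(i - 1) + (c' - j) + 2 \<in> L"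
        by (intro PR PQ QR; use m o T i1 in simp)+
      have lt: "(b - i) + (c - j) + 2 < (b - i) + (c' - j) + 2" using T by simp
      note w = two[OF l(1,2) lt]
      have e: "b = 2 * i - 1" using w[OF l(4)] w[OF l(5)] T by linarith
      have "c' = c + 2" "c = 2 * j - 2 * i - 1" using w[OF l(3)] w[OF d] e T(1) by linarith+
      then show ?thesis using k o n e unfolding formA_def IU P Q T(2) by auto
    qed
  next
    assume k: "k = 3"
    have three: "z = x \<or> z = y \<or> z = w" if "x \<in> L" "y \<in> L" "w \<in> L" "x < y" "y < w" "z \<in> L" for x y z w
    proof (rule ccontr)
      assume "\<not> ?thesis"
      then have "card {x, y, w, z} = 4" using that by auto
      then show False using card_mono[OF L(1), of "{x, y, w, z}"] that L(2) k by simp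
    qed
    have c2: "card P = 2" "card Q = 2" "card T = 2" using le cI k Pn c0 by linarith+
    obtain a0 a where P: "a0 < a" "P = {a0, a}" using int_card_2[OF c2(1)] .
    have "a0 \<in> P" "1 \<in> {a0, a}" using P1 P(2) by blast+
      then have a0: "a0 = 1" using P(1) I(4)[of a0] by (auto simp: P_def)
    obtain b b' where Q: "b < b'" "Q = {b, b'}" using int_card_2[OF c2(2)] .
    obtain c c' where T: "c < c'" "T = {c, c'}" using int_card_2[OF c2(3)] .
    have m: "1 \<in> I" "a \<in> I" "b \<in> I" "b' \<in> I" "c' \<in> I" "c \<in> I" and o: "1 < a" "a \<le> i" "i < b" "b' < j" "j \<le> c"
      using P Q T a0 unfolding P_def Q_def T_def by blast+
    have n: "b \<noteq> i + 1" "c \<noteq> j + 1" using m ij by auto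
    have l: "(i - a) + (c - j) + 2 \<in> L" "(i - a) + (c' - j) + 2 \<in> L" "(i - 1) + (c' - j) + 2 \<in> L"
      "(i - 1) + (c - j) + 2 \<in> L"
      "(b - i) + (c - j) + 2 \<in> L" "(b - i) + (c' - j) + 2 \<in> L" "(b' - i) + (c' - j) + 2 \<in> L"
      "(b' - i) + (c - j) + 2 \<in> L"
      "(i - a) + (j - b') + 2 \<in> L" "(i - a) + (j - b) + 2 \<in> L" "(i - 1) + (j - b) + 2 \<in> L"
      by (intro PR PQ QR; use m o T Q i1 in simp)+
    have lt: "(i - a) + (c - j) + 2 < (i - a) + (c' - j) + 2" "(i - a) + (c' - j) + 2 < (i - 1) + (c' - j) + 2"
      using T o by simp_all
    note w = three[OF l(1,2,3) lt]
    have da: "a - 1 = c' - c" using w[OF l(4)] T o by linarith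
    have s: "(b - i) + (c - j) + 2 < (b - i) + (c' - j) + 2" "(b - i) + (c' - j) + 2 < (b' - i) + (c' - j) + 2"
      using T Q by simp_all
    have db: "b - i = i - a" using w[OF l(5)] w[OF l(6)] w[OF l(7)] s lt by linarith
    have db': "b' - b = c' - c" using w[OF l(7)] w[OF l(6)] w[OF l(5)] s lt db da by linarith
    have u: "(i - a) + (j - b') + 2 < (i - a) + (j - b) + 2" "(i - a) + (j - b) + 2 < (i - 1) + (j - b) + 2"
      using Q o by simp_all
    have e: "(i - a) + (j - b) + 2 = (i - a) + (c' - j) + 2"
      using w[OF l(9)] w[OF l(10)] w[OF l(11)] u lt by linarith
    have "c' - c = 2" using w[OF d] e da db T by linarith
    then have "a = 3" "b' = b + 2" "c' = c + 2" "b = 2 * i - 3" "c = 2 * j - 2 * i + 1" using da db db' e by linarith+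
    then show ?thesis using k o n unfolding formC_def IU P(2) Q(2) T(2) a0 by auto
  qed
qed

section \<open>Paths by positions, odd neighbours of tail ends, rotations\<close>

context odd_critical
begin

lemma pth_join:
  assumes "pth X a b l" "E b c" "pth Y c d n" "X \<inter> Y = {}"
  shows "pth (X \<union> Y) a d (l + 1 + n)"
proof -
  have "b \<notin> Y" using assms(1,4) pth_ends by blast
  from pth_cons[OF assms(2,3) this] have p: "pth (insert b Y) b d (n + 1)" .
  have "X \<inter> insert b Y \<subseteq> {b}" using assms(4) by auto
  from pth_trans[OF assms(1) p this] have "pth (X \<union> insert b Y) a d (l + (n + 1))" .
  moreover have "X \<union> insert b Y = X \<union> Y" using pth_ends[OF assms(1)] by auto
  ultimately show ?thesis by (simp add: add_ac)
qed

text \<open>Disjointness of paths becomes disjointness of sets of positions, which is plain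
  arithmetic.\<close>

definition ip :: "(int \<Rightarrow> 'a) \<Rightarrow> int \<Rightarrow> int set \<Rightarrow> int \<Rightarrow> int \<Rightarrow> int \<Rightarrow> bool" where
  "ip q n S s t l \<longleftrightarrow> S \<subseteq> {0..n} \<and> pth (q ` S) (q s) (q t) l"

lemma ip_up: "ipath q n \<Longrightarrow> 0 \<le> s \<Longrightarrow> s \<le> t \<Longrightarrow> t \<le> n \<Longrightarrow> ip q n {s..t} s t (t - s)"
  unfolding ip_def using ipath_seg by auto

lemma ip_down: "ipath q n \<Longrightarrow> 0 \<le> t \<Longrightarrow> t \<le> s \<Longrightarrow> s \<le> n \<Longrightarrow> ip q n {t..s} s t (s - t)"
  unfolding ip_def using ipath_seg pth_sym by auto

lemma ip_pt: "0 \<le> s \<Longrightarrow> s \<le> n \<Longrightarrow> ip q n {s} s s 0"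
  unfolding ip_def by (auto intro: pth_refl)

lemma ip_join:
  assumes "ipath q n" "ip q n S s t l" "E (q t) (q s')" "ip q n S' s' t' l'" "S \<inter> S' = {}"
  shows "ip q n (S \<union> S') s t' (l + 1 + l')"
proof -
  have sub: "S \<subseteq> {0..n}" "S' \<subseteq> {0..n}" using assms(2,4) by (auto simp: ip_def)
  have "inj_on q {0..n}" using assms(1) by (simp add: ipath_def)
  then have "q ` S \<inter> q ` S' = {}" using inj_on_image_Int[OF _ sub] assms(5) by auto
  moreover have "pth (q ` S) (q s) (q t) l" "pth (q ` S') (q s') (q t') l'" using assms(2,4) by (simp_all add: ip_def)
  ultimately have "pth (q ` S \<union> q ` S') (q s) (q t') (l + 1 + l')" using pth_join assms(3) by metis
  then show ?thesis using sub by (simp add: ip_def image_Un)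
qed

text \<open>Neighbours at positions of both parities would give \<open>k\<close> odd lengths and so
  all of them, by cycles inside the tail. One of length \<open>M\<close> would meet \<open>c\<close>
  at most in \<open>e R\<close>, against \<open>longest_odd_cycles_meet\<close>.\<close>

lemma tail_pure:
  assumes t: "tail c e R" and R2: "2 \<le> R" and a: "E (e 0) (e a)" "1 \<le> a" "a \<le> R"
  shows "odd a"
proof
  assume "even a"
  have p: "ipath e R" and c: "cyc c M" and out: "\<And>i. 0 \<le> i \<Longrightarrow> i < R \<Longrightarrow> e i \<notin> range c"
    using t by (auto simp: tail_def)
  define A where "A = {a. 1 \<le> a \<and> a \<le> R \<and> even a \<and> E (e 0) (e a)}"
  define B where "B = {a. 1 \<le> a \<and> a \<le> R \<and> odd a \<and> E (e 0) (e a)}"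
  have f: "finite A" "finite B" by (rule finite_subset[of _ "{0..R}"]; auto simp: A_def B_def)+
  have "a \<in> A" using a \<open>even a\<close> by (simp add: A_def)
  moreover have "1 \<in> B" using ipath_edge[OF p, of 0] R2 by (simp add: B_def)
  ultimately have ne: "A \<noteq> {}" "B \<noteq> {}" by auto
  have "{u. E (e 0) u} \<subseteq> e ` (A \<union> B)"
  proof
    fix u assume "u \<in> {u. E (e 0) u}"
    then have u: "E (e 0) u" by simp
    from tail_end_nbrs[OF t R2 u] obtain i where "i \<in> {1..R}" "u = e i" by auto
    then show "u \<in> e ` (A \<union> B)" using u by (auto simp: A_def B_def)
  qed
  then have "card {u. E (e 0) u} \<le> card (A \<union> B)"
    using f by (meson card_image_le card_mono finite_UnI finite_imageI order_trans)
  moreover have "2 * k \<le> card {u. E (e 0) u}" using mindeg EV[OF a(1)] .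
  moreover have "card (A \<union> B) \<le> card A + card B" by (rule card_Un_le)
  ultimately have AB: "2 * k \<le> card A + card B" by simp
  define D where "D = (\<lambda>(a, b). \<bar>a - b\<bar>) ` (A \<times> B)"
  have fD: "finite D" using f by (simp add: D_def)
  have "k \<le> card D" using card_abs_differences[OF f ne] AB unfolding D_def by linarith
  have sub: "(\<lambda>d. d + 2) ` D \<subseteq> OL"
  proof
    fix x assume "x \<in> (\<lambda>d. d + 2) ` D"
    then obtain a b where ab: "a \<in> A" "b \<in> B" "x = \<bar>a - b\<bar> + 2" by (auto simp: D_def)
    then show "x \<in> OL" using star[OF p, of a b] by (auto simp: A_def B_def)
  qed
  have "card OL \<le> card ((\<lambda>d. d + 2) ` D)" using card_OL \<open>k \<le> card D\<close> by (simp add: card_image)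
  then have "card ((\<lambda>d. d + 2) ` D) = card OL" using card_mono[OF finite_OL sub] by (rule le_antisym[rotated])
  then have "(\<lambda>d. d + 2) ` D = OL" using card_subset_eq[OF finite_OL sub] by blast
  then have "M \<in> (\<lambda>d. d + 2) ` D" using M_OL by simp
  then obtain x y where xy: "x \<in> A" "y \<in> B" "M = \<bar>x - y\<bar> + 2" by (auto simp: D_def)
  have xyE: "E (e 0) (e x)" "E (e 0) (e y)" "1 \<le> x" "1 \<le> y" "x \<le> R" "y \<le> R" using xy by (auto simp: A_def B_def)
  have "\<exists>d. cyc d M \<and> range d \<subseteq> e ` {0..R}"
  proof (cases "x < y")
    case True
    then show ?thesis using star_cyc[OF p xyE(1,2)] xyE xy(3) by simp
  next
    case False
    moreover have "x \<noteq> y" using xy by (auto simp: A_def B_def)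
    ultimately show ?thesis using star_cyc[OF p xyE(2,1)] xyE xy(3) by simp
  qed
  then obtain d where d: "cyc d M" "range d \<subseteq> e ` {0..R}" by blast
  have "range c \<inter> range d \<subseteq> {e R}"
  proof
    fix v assume "v \<in> range c \<inter> range d"
    then have "v \<in> e ` {0..R}" "v \<in> range c" using d(2) by blast+
    then obtain i where "0 \<le> i" "i \<le> R" "v = e i" "v \<in> range c" by auto
    then show "v \<in> {e R}" using out[of i] by (cases "i = R") auto
  qed
  then show False using longest_odd_cycles_meet[OF c d(1)] by blast
qed

text \<open>Replacing the initial segment up to \<open>b - 1\<close> by its reversal turns a chord from \<open>q 0\<close> to \<open>q b\<close>
  into an edge of the path, with new end \<open>q (b - 1)\<close>.\<close>

definition rot :: "(int \<Rightarrow> 'a) \<Rightarrow> int \<Rightarrow> int \<Rightarrow> 'a" where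
  "rot q b i = (if i < b then q (b - 1 - i) else q i)"

lemma tail_rot:
  assumes t: "tail c q R" and b: "E (q 0) (q b)" "1 \<le> b" "b \<le> R"
  shows "tail c (rot q b) R"
proof -
  have p: "ipath q R" and c: "cyc c M" and out: "\<And>i. 0 \<le> i \<Longrightarrow> i < R \<Longrightarrow> q i \<notin> range c" and x: "q R \<in> range c"
    using t by (auto simp: tail_def)
  have "ipath (rot q b) R" unfolding ipath_def
  proof (intro conjI allI impI)
    show "0 \<le> R" by (rule R_nonneg)
    show "inj_on (rot q b) {0..R}"
      by (intro inj_onI) (use ipath_eq[OF p] b in \<open>auto simp: rot_def split: if_splits\<close>)
    fix i assume i: "0 \<le> i \<and> i < R"
    consider "i + 1 < b" | "i + 1 = b" | "b \<le> i" by linarith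
    then show "E (rot q b i) (rot q b (i + 1))"
    proof cases
      case 1
      then show ?thesis using ipath_edge[OF p, of "b - 1 - (i + 1)"] i b sym by (simp add: rot_def algebra_simps)
    next
      case 2
      have "rot q b i = q 0" "rot q b (i + 1) = q b" using 2 by (auto simp: rot_def)
      then show ?thesis using b by simp
    next
      case 3 then show ?thesis using ipath_edge[OF p, of i] i by (simp add: rot_def)
    qed
  qed
  then show ?thesis using c x out b unfolding tail_def by (auto simp: rot_def)
qed

end

text \<open>Maximality of \<open>m\<close> keeps the neighbours of all ends obtained by rotation inside the set \<open>Z\<close>.\<close>

locale pocket = odd_critical V E k for V :: "'a set" and E k +
  fixes c e :: "int \<Rightarrow> 'a" and m :: int
  assumes R2: "2 \<le> R" and t: "tail c e R" and m: "1 \<le> m" "m \<le> R" "E (e 0) (e m)"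
    and max: "\<And>c' e' m'. tail c' e' R \<Longrightarrow> 1 \<le> m' \<Longrightarrow> m' \<le> R \<Longrightarrow> E (e' 0) (e' m') \<Longrightarrow> m' \<le> m"
begin

definition Z :: "'a set" where "Z = e ` {0..m}"
definition order :: "(int \<Rightarrow> 'a) \<Rightarrow> bool" where "order q \<longleftrightarrow> tail c q R \<and> q ` {0..m} = Z"
definition I :: "(int \<Rightarrow> 'a) \<Rightarrow> int set" where "I q = {b. 1 \<le> b \<and> b \<le> m \<and> E (q 0) (q b)}"

lemma order_e: "order e" using t by (simp add: order_def Z_def)

lemma order_ipath: "order q \<Longrightarrow> ipath q m"
  using m R_nonneg unfolding order_def tail_def ipath_def
  by (auto intro: inj_on_subset[of q "{0..R}"])

lemma order_nbr: "order q \<Longrightarrow> E (q 0) v \<Longrightarrow> \<exists>b\<in>I q. v = q b"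
proof -
  assume q: "order q" and v: "E (q 0) v"
  have t: "tail c q R" using q by (simp add: order_def)
  obtain b where b: "b \<in> {1..R}" "v = q b" using tail_end_nbrs[OF t R2 v] by auto
  then have "b \<le> m" using max[OF t] v by auto
  then show ?thesis using b v by (auto simp: I_def)
qed

lemma finite_I: "finite (I q)" by (rule finite_subset[of _ "{0..m}"]) (auto simp: I_def)

lemma I_odd: "order q \<Longrightarrow> b \<in> I q \<Longrightarrow> odd b"
  using tail_pure[of c q b] R2 m by (auto simp: order_def I_def)

lemma order_V: "order q \<Longrightarrow> 0 \<le> i \<Longrightarrow> i \<le> m \<Longrightarrow> q i \<in> V"
  using ipath_V[OF order_ipath] m by blast

lemma I_card: assumes "order q" shows "2 * k \<le> card (I q)"
proof -
  have "{u. E (q 0) u} \<subseteq> q ` I q" using order_nbr[OF assms] by auto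
  then have "card {u. E (q 0) u} \<le> card (I q)"
    using finite_I by (meson card_image_le card_mono finite_imageI order_trans)
  moreover have "q 0 \<in> V" using order_V[OF assms] m by simp
  ultimately show ?thesis using mindeg le_trans by blast
qed

lemma one_I: "order q \<Longrightarrow> 1 \<in> I q"
  using ipath_edge[OF order_ipath, of q 0] m by (auto simp: I_def)

lemma order_rot: assumes q: "order q" and b: "b \<in> I q" shows "order (rot q b)"
proof -
  have b': "1 \<le> b" "b \<le> m" "E (q 0) (q b)" using b by (auto simp: I_def)
  have "rot q b ` {0..m} = q ` {0..m}"
  proof
    show "rot q b ` {0..m} \<subseteq> q ` {0..m}" using b' by (auto simp: rot_def)
    show "q ` {0..m} \<subseteq> rot q b ` {0..m}"
    proof
      fix v assume "v \<in> q ` {0..m}"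
      then obtain i where i: "0 \<le> i" "i \<le> m" "v = q i" by auto
      show "v \<in> rot q b ` {0..m}"
      proof (cases "i < b")
        case True
        then show ?thesis using i b' by (intro image_eqI[of _ _ "b - 1 - i"]) (auto simp: rot_def)
      next
        case False
        then show ?thesis using i by (intro image_eqI[of _ _ i]) (auto simp: rot_def)
      qed
    qed
  qed
  then show ?thesis using q tail_rot[of c q b] b' m unfolding order_def by auto
qed

text \<open>Rotation at \<open>b\<close> makes \<open>q (b - 1)\<close> a free end, and the
  maximality of \<open>m\<close> keeps its neighbours in the pocket.\<close>

lemma order_closed: assumes "order q" "b \<in> I q" "E (q (b - 1)) v" shows "v \<in> Z"
proof -
  have b: "1 \<le> b" using assms(2) by (simp add: I_def)
  then have "E (rot q b 0) v" using assms(3) by (simp add: rot_def)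
  from order_nbr[OF order_rot[OF assms(1,2)] this] obtain s where s: "s \<in> I (rot q b)" "v = rot q b s" by blast
  then have "v \<in> rot q b ` {0..m}" by (auto simp: I_def)
  then show ?thesis using order_rot[OF assms(1,2)] by (simp add: order_def)
qed

text \<open>Two disjoint paths lead from the pocket to the longest odd cycle, and the choice of the
  arc between them decides the parity. If \<open>m = R\<close>, one of these paths is the single
  vertex \<open>e R\<close>.\<close>

lemma exits:
  "\<exists>u w X X' l l'. u \<in> Z \<and> w \<in> Z \<and> u \<noteq> w \<and> pth X u w l \<and> pth X' u w l' \<and> X \<inter> Z \<subseteq> {u, w} \<and> X' \<inter> Z \<subseteq> {u, w} \<and> odd (l + l')"
proof -
  have p: "ipath e R" and c: "cyc c M" and out: "\<And>i. 0 \<le> i \<Longrightarrow> i < R \<Longrightarrow> e i \<notin> range c" and x: "e R \<in> range c"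
    using t by (auto simp: tail_def)
  have CV: "range c \<subseteq> V" using cyc_in_V[OF c] .
  have ZV: "Z \<subseteq> V" using order_V[OF order_e] by (auto simp: Z_def)
  have C2: "\<And>z. \<exists>y\<in>range c. y \<noteq> z" using cyc_two_points[OF c] .
  have ZC: "Z \<inter> range c \<subseteq> {e R}"
  proof
    fix v assume "v \<in> Z \<inter> range c"
    then obtain i where "0 \<le> i" "i \<le> m" "v = e i" "v \<in> range c" by (auto simp: Z_def)
    then show "v \<in> {e R}" using out[of i] m by (cases "i = R") auto
  qed
  have "\<exists>a b x y P Q. link Z (range c) P a x Q b y \<and> Z \<inter> range c \<subseteq> {b}"
  proof (cases "m = R")
    case False
    have "e R \<notin> Z"
    proof
      assume "e R \<in> Z"
      then obtain i where "0 \<le> i" "i \<le> m" "e R = e i" by (auto simp: Z_def)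
      then show False using ipath_eq[OF p, of R i] m False R2 by auto
    qed
    then have d: "range c \<inter> Z = {}" using ZC by auto
    have "e 0 \<noteq> e 1" using ipath_eq[OF p, of 0 1] R2 by simp
    moreover have "e 0 \<in> Z" "e 1 \<in> Z" using m by (auto simp: Z_def)
    ultimately have "\<And>z. \<exists>y\<in>Z. y \<noteq> z" by metis
    from two_disjoint_paths[OF CV ZV d C2 this] show ?thesis using d by blast
  next
    case True
    obtain y where y: "y \<in> range c" "y \<noteq> e R" using C2 by blast
    have "e 0 \<in> Z" "e m \<in> Z" using m by (auto simp: Z_def)
    then have e0: "e 0 \<in> Z" "e 0 \<noteq> e R" "e R \<in> Z" using R2 ipath_eq[OF p, of 0 R] True by auto
    obtain n where "pth (V - {e R}) (e 0) y n"
      using conn[of "e 0" "e R" y] e0 y CV ZV by blast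
    from pth_first_hit[OF this, of "range c"] y obtain Y w l where
      Y: "Y \<subseteq> V - {e R}" "pth Y (e 0) w l" "Y \<inter> range c = {w}" by blast
    from pth_first_hit[OF pth_sym[OF Y(2)], of Z] e0 obtain P a l' where
      P: "P \<subseteq> Y" "pth P w a l'" "P \<inter> Z = {a}" by blast
    have "w \<in> P" "a \<in> P" using pth_ends[OF P(2)] by auto
    then have "P \<inter> range c = {w}" using P(1) Y(3) by auto
    moreover have "pth P a w l'" using pth_sym[OF P(2)] .
    moreover have "a \<noteq> e R" "w \<noteq> e R" using \<open>w \<in> P\<close> \<open>a \<in> P\<close> P(1) Y(1) by auto
    moreover have "pth {e R} (e R) (e R) 0" by (rule pth_refl) simp
    ultimately have "link Z (range c) P a w {e R} (e R) (e R)"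
      unfolding link_def using P Y x e0 ZV by auto
    with ZC show ?thesis by (intro exI conjI) assumption+
  qed
  then obtain a b x y P Q where l: "link Z (range c) P a x Q b y" and Zb: "Z \<inter> range c \<subseteq> {b}" by (elim exE conjE)
  have ne: "a \<noteq> b" "x \<noteq> y" "P \<inter> Q = {}" "P \<inter> Z = {a}" "P \<inter> range c = {x}"
       "Q \<inter> Z = {b}" "Q \<inter> range c = {y}" and ex: "\<exists>l. pth P a x l" "\<exists>m. pth Q b y m"
    using l unfolding link_def by auto
  obtain l l' where P: "pth P a x l" and Q: "pth Q b y l'" using ex by (elim exE)
  have xy: "x \<in> range c" "y \<in> range c" using ne by auto
  obtain g where g: "pth (range c) x y g" "pth (range c) x y (M - g)"
    using two_arcs[OF c xy ne(2)] by blast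
  have pt: "pth (P \<union> range c \<union> Q) a b (l + h + l')" if "pth (range c) x y h" for h
  proof -
    have "pth (P \<union> range c) a y (l + h)" using pth_trans[OF P that] ne by simp
    moreover have "(P \<union> range c) \<inter> Q \<subseteq> {y}" using ne by blast
    ultimately show ?thesis by (rule pth_trans[OF _ pth_sym[OF Q]])
  qed
  have "(P \<union> range c \<union> Q) \<inter> Z \<subseteq> {a, b}" using ne Zb by auto
  moreover have "odd ((l + g + l') + (l + (M - g) + l'))" using M_odd by auto
  moreover have "a \<in> Z" "b \<in> Z" using ne by auto
  ultimately show ?thesis using pt[OF g(1)] pt[OF g(2)] ne(1) by blast
qed

end

section \<open>Lengths of paths between the exits of the pocket\<close>

locale pocket_exits = pocket V E k c e m for V :: "'a set" and E k c e m +
  fixes u w :: 'a and X X' :: "'a set" and l l' :: int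
  assumes uw: "u \<in> Z" "w \<in> Z" "u \<noteq> w" and X: "pth X u w l" "X \<inter> Z \<subseteq> {u, w}"
    and X': "pth X' u w l'" "X' \<inter> Z \<subseteq> {u, w}" and par: "odd (l + l')"
begin

definition Lam :: "bool \<Rightarrow> int set" where "Lam p = {t. pth Z u w t \<and> (even t \<longleftrightarrow> p)}"

text \<open>An outside path of the other parity, of length \<open>L\<close>, closes every path
  counted by \<open>Lam p\<close>; \<open>t \<mapsto> t + L\<close> is injective into
  \<open>OL\<close>.\<close>

lemma Lam: "finite (Lam p)" "card (Lam p) \<le> k"
proof -
  have "\<exists>Y L. pth Y u w L \<and> Y \<inter> Z \<subseteq> {u, w} \<and> (odd L \<longleftrightarrow> p)"
    using X X' par by (cases "odd l \<longleftrightarrow> p") auto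
  then obtain Y L where Y: "pth Y u w L" "Y \<inter> Z \<subseteq> {u, w}" "odd L \<longleftrightarrow> p" by blast
  have sub: "(\<lambda>t. t + L) ` Lam p \<subseteq> OL"
  proof
    fix x assume "x \<in> (\<lambda>t. t + L) ` Lam p"
    then obtain t where t: "x = t + L" "pth Z u w t" "even t \<longleftrightarrow> p" by (auto simp: Lam_def)
    have o: "odd (t + L)" using t(3) Y(3) by auto
    have "1 \<le> t" "1 \<le> L" using pth_pos[OF t(2) uw(3)] pth_pos[OF Y(1) uw(3)] by auto
    then have "3 \<le> t + L" using o by (cases "t + L = 2") auto
    moreover have "Z \<inter> Y \<subseteq> {u, w}" using Y(2) by auto
    ultimately obtain d where "cyc d (t + L)" using cyc_close2[OF t(2) Y(1) _ uw(3)] by auto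
    then show "x \<in> OL" using cyc_OL o t(1) by simp
  qed
  have inj: "inj_on (\<lambda>t. t + L) (Lam p)" by simp
  show "finite (Lam p)" using inj_on_finite[OF inj sub finite_OL] .
  show "card (Lam p) \<le> k" using card_inj_on_le[OF inj sub finite_OL] card_OL by simp
qed

lemma pth_leaves: assumes "pth Y x y n" "2 \<le> n" "Y \<inter> Z \<subseteq> {x, y}" shows "\<exists>v. E x v \<and> v \<notin> Z"
proof -
  obtain f where f: "inj_on f {0..n}" "f ` {0..n} \<subseteq> Y" "f 0 = x" "f n = y"
     "\<And>i. 0 \<le> i \<Longrightarrow> i < n \<Longrightarrow> E (f i) (f (i + 1))"
    using assms(1) unfolding pth_def by blast
  have "f 1 \<noteq> f 0" "f 1 \<noteq> f n" using inj_onD[OF f(1), of 1 0] inj_onD[OF f(1), of 1 n] assms(2) by auto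
  moreover have "f 1 \<in> Y" using f(2) assms(2) by (simp add: image_subset_iff)
  ultimately have "f 1 \<notin> Z" using assms(3) f(3,4) by blast
  moreover have "E x (f 1)" using f(5)[of 0] f(3) assms(2) by simp
  ultimately show ?thesis by blast
qed

text \<open>One of the two outside paths has even length, so it is not a single edge and leaves the
  pocket right after either exit.\<close>

lemma exit_leaves: assumes "y = u \<or> y = w" shows "\<exists>v. E y v \<and> v \<notin> Z"
proof -
  have "\<exists>Y L. pth Y u w L \<and> Y \<inter> Z \<subseteq> {u, w} \<and> even L"
    using X X' par by (cases "even l") auto
  then obtain Y L where Y: "pth Y u w L" "Y \<inter> Z \<subseteq> {u, w}" "even L" by blast
  have "2 \<le> L" using pth_pos[OF Y(1) uw(3)] Y(3) by (cases "L = 1") auto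
  moreover have "Y \<inter> Z \<subseteq> {w, u}" using Y(2) by auto
  ultimately show ?thesis using pth_leaves[OF Y(1)] pth_leaves[OF pth_sym[OF Y(1)]] Y(2) assms by blast
qed

lemma exit_not_I: "order q \<Longrightarrow> q i = u \<or> q i = w \<Longrightarrow> i + 1 \<notin> I q"
  using exit_leaves[of "q i"] order_closed[of q "i + 1"] by auto

definition exits_at :: "(int \<Rightarrow> 'a) \<Rightarrow> int \<Rightarrow> int \<Rightarrow> bool" where
  "exits_at q i j \<longleftrightarrow> order q \<and> 0 \<le> i \<and> i < j \<and> j \<le> m \<and> (q i = u \<or> q i = w) \<and> (q j = u \<or> q j = w)"

lemma exits_atD: assumes "exits_at q i j"
  shows "order q" "ipath q m" "0 \<le> i" "i < j" "j \<le> m" "q i = u \<or> q i = w" "q j = u \<or> q j = w"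
    "i + 1 \<notin> I q" "j + 1 \<notin> I q" "q i \<noteq> q j"
proof -
  show a: "order q" "0 \<le> i" "i < j" "j \<le> m" "q i = u \<or> q i = w" "q j = u \<or> q j = w"
    using assms by (auto simp: exits_at_def)
  then show p: "ipath q m" using order_ipath by blast
  show "i + 1 \<notin> I q" "j + 1 \<notin> I q" using exit_not_I a by blast+
  show "q i \<noteq> q j" using ipath_eq[OF p] a by simp
qed

lemma ip_Lam: assumes a: "exits_at q i j" and p: "ip q m S i j t" and e: "even t \<longleftrightarrow> even (j - i)"
  shows "t \<in> Lam (even (j - i))"
proof -
  have "q ` {0..m} = Z" using exits_atD(1)[OF a] by (simp add: order_def)
  then have "q ` S \<subseteq> Z" using p by (auto simp: ip_def)
  then have "pth Z (q i) (q j) t" using p pth_mono by (auto simp: ip_def)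
  then have "pth Z u w t" using pth_sym exits_atD(6,7,10)[OF a] by metis
  then show ?thesis using e by (simp add: Lam_def)
qed

text \<open>The lengths in \<open>attachment_forms\<close> belong to paths from \<open>q i\<close>
  to a neighbour of \<open>q 0\<close>, through \<open>q 0\<close> to another neighbour, and on to
  \<open>q j\<close>. All elements of \<open>I q\<close> are odd, so these lengths have the parity
  of \<open>j - i\<close>.\<close>

lemma exits_at_forms:
  assumes a: "exits_at q i j" and b: "b \<in> I q" "i < b"
  shows "formC k (I q) i j \<or> k = 2 \<and> (formA (I q) i j \<or> formB (I q) i j)"
proof -
  note A = exits_atD[OF a]
  have ID: "E (q 0) (q x)" "E (q x) (q 0)" "1 \<le> x" "x \<le> m" "odd x" if "x \<in> I q" for x
    using that sym I_odd[OF A(1) that] by (auto simp: I_def)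
  note pt = ip_pt[of 0 m]
  show ?thesis
  proof (rule attachment_forms[OF k2 finite_I I_card[OF A(1)] one_I[OF A(1)] _ A(3,4,8,9) b Lam])
    show "1 \<le> x" if "x \<in> I q" for x using ID that by blast
    show "j - i \<in> Lam (even (j - i))"
      using ip_Lam[OF a ip_up[OF A(2), of i j]] A by simp
  next
    fix x y assume xy: "x \<in> I q" "y \<in> I q" "x \<le> i" "i < y" "y \<le> j"
    note x = ID[OF xy(1)] and y = ID[OF xy(2)]
    have "ip q m ({x..i} \<union> {0}) i 0 (i - x + 1 + 0)"
      using ip_join[OF A(2) ip_down[OF A(2), of x i] x(2) pt] x xy A m by simp
    from ip_join[OF A(2) this y(1) ip_up[OF A(2), of y j]] x y xy A
    have "ip q m (({x..i} \<union> {0}) \<union> {y..j}) i j (i - x + 1 + 0 + 1 + (j - y))" by simp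
    from ip_Lam[OF a this] x y show "(i - x) + (j - y) + 2 \<in> Lam (even (j - i))" by (simp add: add_ac)
  next
    fix x y assume xy: "x \<in> I q" "y \<in> I q" "x \<le> i" "j \<le> y"
    note x = ID[OF xy(1)] and y = ID[OF xy(2)]
    have "ip q m ({x..i} \<union> {0}) i 0 (i - x + 1 + 0)"
      using ip_join[OF A(2) ip_down[OF A(2), of x i] x(2) pt] x xy A m by simp
    from ip_join[OF A(2) this y(1) ip_down[OF A(2), of j y]] x y xy A
    have "ip q m (({x..i} \<union> {0}) \<union> {j..y}) i j (i - x + 1 + 0 + 1 + (y - j))" by simp
    from ip_Lam[OF a this] x y show "(i - x) + (y - j) + 2 \<in> Lam (even (j - i))" by (simp add: add_ac)
  next
    fix x y assume xy: "x \<in> I q" "y \<in> I q" "i < x" "x < j" "j \<le> y"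
    note x = ID[OF xy(1)] and y = ID[OF xy(2)]
    have "i \<noteq> 0" using A(8) one_I[OF A(1)] by auto
    then have i1: "1 \<le> i" using A by simp
    have "ip q m ({i..x} \<union> {0}) i 0 (x - i + 1 + 0)"
      using ip_join[OF A(2) ip_up[OF A(2), of i x] x(2) pt] x xy A m i1 by simp
    from ip_join[OF A(2) this y(1) ip_down[OF A(2), of j y]] x y xy A
    have "ip q m (({i..x} \<union> {0}) \<union> {j..y}) i j (x - i + 1 + 0 + 1 + (y - j))" by simp
    from ip_Lam[OF a this] x y show "(x - i) + (y - j) + 2 \<in> Lam (even (j - i))" by (simp add: add_ac)
  qed
qed

text \<open>The position \<open>b - 1\<close> of the new end is even, so it is not adjacent to
  \<open>q 0\<close>; equal neighbourhoods contradict \<open>no_twin\<close>.\<close>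

lemma twin_ends:
  assumes q: "order q" and b: "b \<in> I q" "3 \<le> b" and eq: "rot q b ` I (rot q b) = q ` I q"
  shows False
proof -
  have b': "b \<le> m" "odd b" using b I_odd[OF q] by (auto simp: I_def)
  have "q (b - 1) \<in> V" "q 0 \<in> V" using order_V[OF q] b b' by auto
  moreover have "q 0 \<noteq> q (b - 1)" using ipath_eq[OF order_ipath[OF q], of 0 "b - 1"] b b' by simp
  moreover have "\<not> E (q 0) (q (b - 1))"
  proof
    assume "E (q 0) (q (b - 1))"
    then have "b - 1 \<in> I q" using b b' by (auto simp: I_def)
    then have "odd (b - 1)" by (rule I_odd[OF q])
    then show False using b' by simp
  qed
  moreover have "{x. E (q 0) x} \<subseteq> {x. E (q (b - 1)) x}"
  proof
    fix x assume "x \<in> {x. E (q 0) x}"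
    then have "x \<in> q ` I q" using order_nbr[OF q] by auto
    then obtain s where "s \<in> I (rot q b)" "x = rot q b s" using eq by blast
    moreover have "rot q b 0 = q (b - 1)" using b by (simp add: rot_def)
    ultimately show "x \<in> {x. E (q (b - 1)) x}" by (auto simp: I_def)
  qed
  ultimately show False using no_twin by blast
qed

text \<open>In pattern C the ends \<open>q 0\<close> and \<open>q 2\<close> are twins, in pattern B the ends \<open>q 0\<close> and \<open>q (2 * i)\<close>.
  Pattern A passes to another end, and the chords of both ends give a path that is too long.\<close>

lemma not_formC: assumes a: "exits_at q i j" and C: "formC k (I q) i j" shows False
proof -
  note A = exits_atD[OF a]
  have c: "3 \<le> i" "2 * i + 1 \<le> j" using C by (auto simp: formC_def)
  have mem: "3 \<in> I q" "2 * i - 1 \<in> I q" "2 \<notin> I q" using C I_odd[OF A(1), of 2] by (auto simp: formC_def split: if_splits)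
  define q' where "q' = rot q 3"
  have q': "order q'" unfolding q'_def by (rule order_rot[OF A(1) mem(1)])
  have q'v: "q' 0 = q 2" "q' 1 = q 1" "q' 2 = q 0" "\<And>x. 3 \<le> x \<Longrightarrow> q' x = q x" by (auto simp: q'_def rot_def)
  have a': "exits_at q' i j" using a q' c unfolding exits_at_def by (simp add: q'v)
  have 3: "3 \<in> I q'" using ipath_edge[OF A(2), of 2] A c by (simp add: I_def q'v)
  show False
  proof (cases "\<exists>b\<in>I q'. i < b")
    case True
    then obtain b where "b \<in> I q'" "i < b" by blast
    note F = exits_at_forms[OF a' this]
    have "\<not> formA (I q') i j" "\<not> formB (I q') i j" using 3 c unfolding formA_def formB_def by auto
    then have "formC k (I q') i j" using F by blast
    then have I: "I q' = I q" using C by (simp add: formC_def)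
    have "q' x = q x" if "x \<in> I q" for x
    proof -
      have "x = 1 \<or> 3 \<le> x" using that I_odd[OF A(1) that] by (cases "x = 2") (auto simp: I_def)
      then show ?thesis using q'v by auto
    qed
    then have "q' ` I q' = q ` I q" unfolding I by simp
    then show False using twin_ends[OF A(1) mem(1)] by (simp add: q'_def)
  next
    case False
    \<comment> \<open>Now all neighbours of \<open>q 2\<close> are at positions up to
      \<open>i\<close>. Each except \<open>q 1\<close> gives a path from \<open>q i\<close> to it,
      over \<open>q 2, q 1, q 0\<close> to \<open>q (2 * i - 1)\<close> and on to
      \<open>q j\<close>: at least \<open>2 * k - 1\<close> lengths.\<close>
    define T where "T = (\<lambda>x. (i - x) + 4 + (j - (2 * i - 1))) ` (I q' - {1})"
    have "T \<subseteq> Lam (even (j - i))"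
    proof
      fix z assume "z \<in> T"
      then obtain x where x: "x \<in> I q'" "x \<noteq> 1" "z = (i - x) + 4 + (j - (2 * i - 1))" by (auto simp: T_def)
      have xo: "odd x" using I_odd[OF q' x(1)] .
      have x3: "3 \<le> x" "x \<le> i" using x False xo by (cases "x = 2"; auto simp: I_def not_less)+
      have e: "E (q x) (q 2)" "E (q 0) (q (2 * i - 1))" using x(1) mem(2) sym q'v x3 by (auto simp: I_def)
      have "ip q m ({x..i} \<union> {0..2}) i 0 (i - x + 1 + (2 - 0))"
        using ip_join[OF A(2) ip_down[OF A(2), of x i] e(1) ip_down[OF A(2), of 0 2]] x3 A by simp
      moreover have up: "ip q m {2 * i - 1..j} (2 * i - 1) j (j - (2 * i - 1))"
        using ip_up[OF A(2), of "2 * i - 1" j] A(5) c by simp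
      moreover have "({x..i} \<union> {0..2}) \<inter> {2 * i - 1..j} = {}" using x3 c by auto
      ultimately
      have "ip q m ({x..i} \<union> {0..2} \<union> {2 * i - 1..j}) i j (i - x + 1 + (2 - 0) + 1 + (j - (2 * i - 1)))"
        using ip_join[OF A(2) _ e(2)] up by blast
      moreover have "z = i - x + 1 + (2 - 0) + 1 + (j - (2 * i - 1))" using x(3) by simp
      moreover from this have "even z \<longleftrightarrow> even (j - i)" using xo by presburger
      ultimately show "z \<in> Lam (even (j - i))" using ip_Lam[OF a] by metis
    qed
    then have "card T \<le> k" using card_mono[OF Lam(1)] Lam(2) order_trans by blast
    moreover have "card T = card (I q' - {1})" unfolding T_def by (rule card_image) (simp add: inj_on_def)
    moreover have "card (I q' - {1}) = card (I q') - 1" using one_I[OF q'] finite_I by simp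
    ultimately show False using I_card[OF q'] k2 by linarith
  qed
qed

lemma not_formB: assumes a: "exits_at q i j" and k: "k = 2" and B: "formB (I q) i j" shows False
proof -
  note A = exits_atD[OF a]
  have c: "3 \<le> i" "2 * i + 3 \<le> j" and I: "I q = {1, 2 * i - 1, 2 * i + 1, 2 * j - 2 * i - 1}" using B by (auto simp: formB_def)
  define b where "b = 2 * i + 1"
  have b: "b \<in> I q" by (simp add: I b_def)
  define q' where "q' = rot q b"
  have q': "order q'" unfolding q'_def by (rule order_rot[OF A(1) b])
  have q'v: "\<And>x. x < b \<Longrightarrow> q' x = q (b - 1 - x)" "\<And>x. b \<le> x \<Longrightarrow> q' x = q x" by (auto simp: q'_def rot_def)
  have a': "exits_at q' i j" using a q' c unfolding exits_at_def by (simp add: q'v b_def)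
  have b': "b \<in> I q'" using ipath_edge[OF A(2), of "b - 1"] A c by (simp add: I_def q'v b_def)
  have "\<not> formC k (I q') i j" using not_formC[OF a'] by blast
  moreover have "\<not> formA (I q') i j" using b' c unfolding formA_def b_def by auto
  ultimately have "formB (I q') i j" using exits_at_forms[OF a' b'] c by (auto simp: b_def)
  then have I': "I q' = I q" using B by (simp add: formB_def)
  have "q' ` I q' = q ` I q" unfolding I' unfolding I using c by (auto simp: q'v b_def)
  then show False using twin_ends[OF A(1) b] c by (simp add: q'_def b_def)
qed

lemma not_formA: assumes a: "exits_at q i j" and k: "k = 2" and F: "formA (I q) i j" shows False
proof -
  note A = exits_atD[OF a]
  have c: "3 \<le> i" "2 * i + 1 \<le> j" and I: "I q = {1, 2 * i - 1, 2 * j - 2 * i - 1, 2 * j - 2 * i + 1}" using F by (auto simp: formA_def)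
  define n where "n = 2 * j - 2 * i + 1"
  have n: "n \<in> I q" "n - 2 \<in> I q" "2 * i - 1 \<in> I q" by (simp_all add: I n_def)
  then have nm: "n \<le> m" "odd n" by (auto simp: I_def n_def)
  define q' where "q' = rot q n"
  have q': "order q'" unfolding q'_def by (rule order_rot[OF A(1) n(1)])
  have q'v: "\<And>x. x < n \<Longrightarrow> q' x = q (n - 1 - x)" "\<And>x. n \<le> x \<Longrightarrow> q' x = q x" by (auto simp: q'_def rot_def)
  \<comment> \<open>The same two exits after the reversal, in exchanged order.\<close>
  define i' j' where "i' = n - 1 - j" and "j' = n - 1 - i"
  have a': "exits_at q' i' j'" using a q' c nm unfolding exits_at_def by (simp add: q'v i'_def j'_def n_def)
  have n': "n \<in> I q'" using ipath_edge[OF A(2), of "n - 1"] A c nm by (simp add: I_def q'v n_def)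
  have "i' < n" using c A by (simp add: i'_def n_def)
  have "formA (I q') i' j'" using exits_at_forms[OF a' n' \<open>i' < n\<close>] not_formC[OF a'] not_formB[OF a' k] by blast
  then have i': "3 \<le> i'" "2 * i' - 1 \<in> I q'" by (auto simp: formA_def)
  moreover have "n - 1 - (2 * i' - 1) = 2 * i + 1" by (simp add: i'_def n_def)
  \<comment> \<open>Pattern A of the rotated order, read in the old positions; this chord yields the
    third length \<open>j - i + 4\<close>.\<close>
  ultimately have "E (q (n - 1)) (q (2 * i + 1))" using c A by (simp add: I_def q'v n_def i'_def)
  then have e: "E (q (2 * i + 1)) (q (n - 1))" "E (q n) (q 0)" "E (q 0) (q (n - 2))" "E (q (2 * i - 1)) (q 0)"
    using sym n \<open>2 * i - 1 \<in> I q\<close> by (auto simp: I_def)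
  have ij: "2 * i + 3 \<le> j" "j \<le> n - 2" using i'(1) c by (auto simp: i'_def n_def)
  have "ip q m ({i..2 * i + 1} \<union> {n - 1..n}) i n (2 * i + 1 - i + 1 + (n - (n - 1)))"
    using ip_join[OF A(2) ip_up[OF A(2), of i "2 * i + 1"] e(1) ip_up[OF A(2), of "n - 1" n]] ij c A nm by simp
  from ip_join[OF A(2) this e(2) ip_pt[of 0 m]] ij c A nm
  have "ip q m ({i..2 * i + 1} \<union> {n - 1..n} \<union> {0}) i 0 (2 * i + 1 - i + 1 + (n - (n - 1)) + 1 + 0)" by simp
  moreover have "ip q m {j..n - 2} (n - 2) j (n - 2 - j)" using ip_down[OF A(2), of j "n - 2"] ij c A nm by simp
  moreover have "({i..2 * i + 1} \<union> {n - 1..n} \<union> {0}) \<inter> {j..n - 2} = {}" using ij c by auto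
  ultimately have "ip q m ({i..2 * i + 1} \<union> {n - 1..n} \<union> {0} \<union> {j..n - 2}) i j
    (2 * i + 1 - i + 1 + (n - (n - 1)) + 1 + 0 + 1 + (n - 2 - j))" by (rule ip_join[OF A(2) _ e(3)])
  from ip_Lam[OF a this] have L4: "(j - i) + 4 \<in> Lam (even (j - i))" by (simp add: n_def algebra_simps)
  have "ip q m ({i..2 * i - 1} \<union> {0}) i 0 (2 * i - 1 - i + 1 + 0)"
    using ip_join[OF A(2) ip_up[OF A(2), of i "2 * i - 1"] e(4) ip_pt[of 0 m]] ij c A nm by simp
  from ip_join[OF A(2) this e(3) ip_down[OF A(2), of j "n - 2"]] ij c A nm
  have "ip q m ({i..2 * i - 1} \<union> {0} \<union> {j..n - 2}) i j (2 * i - 1 - i + 1 + 0 + 1 + (n - 2 - j))" by simp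
  from ip_Lam[OF a this] have L2: "(j - i) \<in> Lam (even (j - i))" by (simp add: n_def algebra_simps)
  have "E (q 0) (q n)" using e(2) sym by blast
  have "ip q m ({i..2 * i - 1} \<union> {0} \<union> {j..n}) i j (2 * i - 1 - i + 1 + 0 + 1 + (n - j))"
    using ip_join[OF A(2) \<open>ip q m ({i..2 * i - 1} \<union> {0}) i 0 (2 * i - 1 - i + 1 + 0)\<close>
       \<open>E (q 0) (q n)\<close> ip_down[OF A(2), of j n]] ij c A nm by simp
  from ip_Lam[OF a this] have L0: "(j - i) + 2 \<in> Lam (even (j - i))" by (simp add: n_def algebra_simps)
  have "card {j - i, (j - i) + 2, (j - i) + 4} \<le> card (Lam (even (j - i)))"
    using L4 L2 L0 by (intro card_mono[OF Lam(1)]) auto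
  then show False using Lam(2)[of "even (j - i)"] k by simp
qed

lemma no_pocket: False
proof -
  obtain i j where ij: "0 \<le> i" "i \<le> m" "0 \<le> j" "j \<le> m" "u = e i" "w = e j" using uw(1,2) by (auto simp: Z_def)
  have "i \<noteq> j" using uw ij by auto
  then have "exits_at e i j \<or> exits_at e j i" unfolding exits_at_def using order_e ij by auto
  then obtain i j where a: "exits_at e i j" by blast
  have "m \<in> I e" "i < m" using m exits_atD[OF a] by (auto simp: I_def)
  from exits_at_forms[OF a this] show False using not_formA[OF a] not_formB[OF a] not_formC[OF a] by blast
qed

end

context odd_critical
begin

lemma R_le_1: "R \<le> 1"
proof (rule ccontr)
  assume "\<not> R \<le> 1"
  then have R2: "2 \<le> R" by simp
  define S where "S = {m. 1 \<le> m \<and> m \<le> R \<and> (\<exists>c e. tail c e R \<and> E (e 0) (e m))}"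
  have fS: "finite S" by (rule finite_subset[of _ "{0..R}"]) (auto simp: S_def)
  obtain c e where ce: "tail c e R" using ex_tail by blast
  then have "E (e 0) (e 1)" using ipath_edge[of e R 0] R2 by (simp add: tail_def)
  then have "1 \<in> S" using ce R2 by (auto simp: S_def)
  then have "Max S \<in> S" using fS Max_in by blast
  then obtain c e where m: "1 \<le> Max S" "Max S \<le> R" "tail c e R" "E (e 0) (e (Max S))" by (auto simp: S_def)
  interpret p: pocket V E k c e "Max S"
  proof
    show "m' \<le> Max S" if "tail c' e' R" "1 \<le> m'" "m' \<le> R" "E (e' 0) (e' m')" for c' e' m'
      using that by (intro Max_ge[OF fS]) (auto simp: S_def)
  qed (use R2 m in auto)
  obtain u w X X' l l' where x: "u \<in> p.Z" "w \<in> p.Z" "u \<noteq> w" "pth X u w l" "pth X' u w l'"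
    "X \<inter> p.Z \<subseteq> {u, w}" "X' \<inter> p.Z \<subseteq> {u, w}" "odd (l + l')"
    using p.exits by (elim exE conjE) (rule that; assumption)
  interpret pocket_exits V E k c e "Max S" u w X X' l l'
    by unfold_locales (use x in auto)
  show False by (rule no_pocket)
qed

end

section \<open>Tails of length at most one\<close>

lemma up_closed_lower_bound:
  fixes P :: "int set"
  assumes f: "finite P" "card P \<le> k" and step: "\<And>p. p \<in> P \<Longrightarrow> p < T \<Longrightarrow> p + 2 \<in> P"
    and p: "p \<in> P" "p \<le> T" "even (T - p)"
  shows "T + 2 - 2 * int k \<le> p"
proof -
  have "p + 2 * int n \<le> T \<Longrightarrow> p + 2 * int n \<in> P" for n
  proof (induction n)
    case (Suc n)
    then have "p + 2 * int n \<in> P" "p + 2 * int n < T" by auto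
    from step[OF this] show ?case by (simp add: algebra_simps)
  qed (use p in simp)
  moreover obtain N where N: "T - p = 2 * int N" using p by (elim evenE) (metis nonneg_int_cases zero_le_mult_iff diff_ge_0_iff_ge zero_less_numeral not_less)
  ultimately have "(\<lambda>n. p + 2 * int n) ` {0..N} \<subseteq> P" by auto
  then have "card ((\<lambda>n. p + 2 * int n) ` {0..N}) \<le> card P" by (rule card_mono[OF f(1)])
  moreover have "card ((\<lambda>n. p + 2 * int n) ` {0..N}) = N + 1" by (simp add: card_image inj_on_def)
  ultimately have "N + 1 \<le> k" using f(2) by simp
  then show ?thesis using N by simp
qed

context odd_critical
begin

lemma ex_nbr: assumes "v \<in> V" shows "\<exists>u. E v u"
proof (rule ccontr)
  assume "\<not> ?thesis"
  then have "{u. E v u} = {}" by simp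
  then have "card {u. E v u} = 0" by (simp only: card.empty)
  then show False using mindeg[OF assms] k2 by simp
qed

text \<open>A path from \<open>v\<close>, stopped at its first vertex on the cycle, is a tail. By
  \<open>R \<le> 1\<close> it is a single edge, so \<open>v\<close> is the free end of a longest
  tail.\<close>

lemma outside_nbr:
  assumes c: "cyc c M" and v: "v \<in> V" "v \<notin> range c" and R: "R \<le> 1"
  shows "R = 1" and "E v u \<Longrightarrow> u \<in> range c"
proof -
  have ne: "c 0 \<noteq> c 1" using cyc_ne[OF c, of 0 1] M3 by simp
  have "c 0 \<in> V" using cyc_in_V[OF c] by auto
  then obtain n where "pth (V - {c 1}) v (c 0) n" using conn[of v "c 1" "c 0"] v ne by auto
  from pth_first_hit[OF this, of "range c"] obtain Y w r where Y: "pth Y v w r" "Y \<inter> range c = {w}" by auto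
  have w: "w \<in> range c" using Y(2) by auto
  have r1: "1 \<le> r" using pth_pos[OF Y(1)] w v by auto
  obtain f where f: "inj_on f {0..r}" "f ` {0..r} \<subseteq> Y" "f 0 = v" "f r = w"
     "\<And>i. 0 \<le> i \<Longrightarrow> i < r \<Longrightarrow> E (f i) (f (i + 1))"
    using Y(1) unfolding pth_def by blast
  have "f i \<notin> range c" if "0 \<le> i" "i < r" for i
  proof
    assume "f i \<in> range c"
    moreover have "f i \<in> Y" using f(2) that by auto
    ultimately have "f i = f r" using Y(2) f(4) by blast
    then show False using inj_onD[OF f(1), of i r] that by simp
  qed
  then have t: "tail c f r" unfolding tail_def ipath_def using c f w r1 by auto
  then have r: "r = 1" "R = 1" using tail_le[OF t] R r1 by auto
  show "R = 1" by (rule r)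
  show "u \<in> range c" if "E v u"
  proof -
    have "u \<in> f ` {0..R} \<or> u \<in> range c" using tail_nbrs[of c f u] t r f(3) that by simp
    moreover have "{0..R} = {0, 1}" using r by auto
    moreover have "u \<noteq> v" using that irr by auto
    ultimately show ?thesis using f(3,4) w r by auto
  qed
qed

lemma outside_chords:
  assumes c: "cyc c M" and v: "v \<notin> range c" and E: "E v (c i)" "E v (c j)" "i < j" "j < i + M"
  shows "odd (j - i) \<Longrightarrow> j - i + 2 \<in> OL" and "even (j - i) \<Longrightarrow> M - (j - i) + 2 \<in> OL"
proof -
  have p: "pth {c i, v, c j} (c i) (c j) 2" using path_via[OF E(1,2) cyc_ne[OF c E(3,4)]] .
  have s: "{c i, v, c j} \<inter> range c \<subseteq> {c i, c j}" using v by auto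
  show "odd (j - i) \<Longrightarrow> j - i + 2 \<in> OL" using ext_arc(1)[OF c p s E(3,4)] by simp
  show "even (j - i) \<Longrightarrow> M - (j - i) + 2 \<in> OL" using ext_arc(2)[OF c p s E(3,4)] M_odd by simp
qed

lemma shifted_nbr_count:
  assumes c: "cyc c M" and v: "v \<in> V" and N: "\<And>u. E v u \<Longrightarrow> u \<in> range c"
  shows "2 * k \<le> card {i. 0 \<le> i \<and> i < M \<and> E v (c (x + i))}"
proof -
  have c': "cyc (\<lambda>i. c (i + x)) M" using cyc_shift[OF c] .
  have "{u. E v u} \<subseteq> (\<lambda>i. c (x + i)) ` {i. 0 \<le> i \<and> i < M \<and> E v (c (x + i))}"
  proof
    fix u assume "u \<in> {u. E v u}"
    then have u: "E v u" by simp
    then obtain j where "u = c j" using N by blast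
    then have "u \<in> range (\<lambda>i. c (i + x))" by (intro image_eqI[of _ _ "j - x"]) auto
    then obtain i where "0 \<le> i" "i < M" "u = c (i + x)" using cyc_rep[OF c'] by blast
    then show "u \<in> (\<lambda>i. c (x + i)) ` {i. 0 \<le> i \<and> i < M \<and> E v (c (x + i))}"
      using u by (auto simp: add.commute)
  qed
  moreover have "finite {i. 0 \<le> i \<and> i < M \<and> E v (c (x + i))}" by (rule finite_subset[of _ "{0..M}"]) auto
  ultimately have "card {u. E v u} \<le> card {i. 0 \<le> i \<and> i < M \<and> E v (c (x + i))}"
    by (meson card_image_le card_mono finite_imageI order_trans)
  then show ?thesis using mindeg[OF v] by simp
qed

text \<open>The lengths \<open>d + 2\<close> exhaust \<open>OL\<close>, and \<open>M\<close> itself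
  yields the position \<open>M - 2\<close>. Pairing a position with \<open>M - 2\<close> shows that
  positions are closed under adding two, so \<open>OL\<close> is a block of at most \<open>k\<close>
  consecutive odd numbers ending in \<open>M\<close>.\<close>

lemma OL_lower_bound_of_odd_chords:
  assumes c: "cyc c M" and v: "v \<notin> range c" and v0: "E v (c 0)"
    and P: "k \<le> card {d. 0 < d \<and> d < M \<and> odd d \<and> E v (c d)}"
    and q: "q \<in> OL"
  shows "M + 2 - 2 * int k \<le> q"
proof -
  define P where "P = {d. 0 < d \<and> d < M \<and> odd d \<and> E v (c d)}"
  have sub: "(\<lambda>d. d + 2) ` P \<subseteq> OL" using outside_chords(1)[OF c v v0] by (auto simp: P_def)
  have cP: "card ((\<lambda>d. d + 2) ` P) = card P" by (simp add: card_image)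
  have "k \<le> card P" using P by (simp add: P_def)
  then have "card ((\<lambda>d. d + 2) ` P) = card OL" using card_OL card_mono[OF finite_OL sub] cP by linarith
  then have OL: "OL = (\<lambda>d. d + 2) ` P" using card_subset_eq[OF finite_OL sub] by simp
  have iff: "p + 2 \<in> OL \<Longrightarrow> p \<in> P" for p using OL by auto
  have top: "M - 2 \<in> P" using iff[of "M - 2"] M_OL by simp
  have step: "p + 2 \<in> P" if p: "p \<in> P" "p < M - 2" for p
  proof -
    have "E v (c p)" "E v (c (M - 2))" "p < M - 2" "M - 2 < p + M" "even (M - 2 - p)"
      using p top M_odd by (auto simp: P_def)
    from outside_chords(2)[OF c v this(1,2,3,4,5)] have "(p + 2) + 2 \<in> OL" by simp
    then show ?thesis by (rule iff)
  qed
  obtain p where p: "p \<in> P" "q = p + 2" using q OL by auto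
  have "finite P" by (rule finite_subset[of _ "{0..M}"]) (auto simp: P_def)
  moreover have "card P \<le> k" using card_OL OL cP by simp
  moreover have "p \<le> M - 2" "even (M - 2 - p)" using OL_le[OF q] p M_odd by (auto simp: P_def)
  ultimately show ?thesis using up_closed_lower_bound[OF _ _ step p(1)] p(2) by fastforce
qed

text \<open>Each further neighbour of \<open>v\<close> is at odd distance from \<open>c s\<close> in
  exactly one direction, so one direction has at least \<open>k\<close> of them.\<close>

lemma OL_lower_bound:
  assumes c: "cyc c M" and v: "v \<in> V" "v \<notin> range c" and N: "\<And>u. E v u \<Longrightarrow> u \<in> range c"
    and q: "q \<in> OL"
  shows "M + 2 - 2 * int k \<le> q"
proof -
  obtain s where s: "E v (c s)" using ex_nbr[OF v(1)] N by blast
  define d where "d = (\<lambda>i. c (i + s))"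
  have d: "cyc d M" unfolding d_def by (rule cyc_shift[OF c])
  have rd: "range d = range c" unfolding d_def by (auto simp: image_iff) (metis diff_add_cancel)
  have d0: "E v (d 0)" using s by (simp add: d_def)
  define r where "r = (\<lambda>i. d (- i))"
  have r: "cyc r M" unfolding r_def by (rule cyc_reflect[OF d])
  have rr: "range r = range c" unfolding r_def rd[symmetric] by (auto simp: image_iff) (metis minus_minus)
  have r0: "E v (r 0)" using d0 by (simp add: r_def)
  define P where "P = {i. 0 < i \<and> i < M \<and> odd i \<and> E v (d i)}"
  define Q where "Q = {i. 0 < i \<and> i < M \<and> odd i \<and> E v (r i)}"
  have f: "finite P" "finite Q" by (rule finite_subset[of _ "{0..M}"]; auto simp: P_def Q_def)+
  have rM: "r (M - i) = d i" for i
    using cyc_period[OF d, of "i - M"] by (simp add: r_def)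
  have "{i. 0 \<le> i \<and> i < M \<and> E v (d (0 + i))} \<subseteq> insert 0 (P \<union> (\<lambda>i. M - i) ` Q)"
  proof
    fix i assume "i \<in> {i. 0 \<le> i \<and> i < M \<and> E v (d (0 + i))}"
    then have i: "0 \<le> i" "i < M" "E v (d i)" by auto
    show "i \<in> insert 0 (P \<union> (\<lambda>i. M - i) ` Q)"
    proof (cases "i = 0 \<or> odd i")
      case True then show ?thesis using i by (auto simp: P_def)
    next
      case False
      then have "M - i \<in> Q" using i rM M_odd by (auto simp: Q_def)
      then have "M - (M - i) \<in> (\<lambda>i. M - i) ` Q" by blast
      then show ?thesis by simp
    qed
  qed
  then have "card {i. 0 \<le> i \<and> i < M \<and> E v (d (0 + i))} \<le> card (insert 0 (P \<union> (\<lambda>i. M - i) ` Q))"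
    using f by (intro card_mono) auto
  also have "\<dots> \<le> card (P \<union> (\<lambda>i. M - i) ` Q) + 1" using f by (simp add: card_insert_if)
  also have "\<dots> \<le> card P + card Q + 1"
    using card_Un_le[of P "(\<lambda>i. M - i) ` Q"] card_image_le[OF f(2), of "\<lambda>i. M - i"] by linarith
  finally have "2 * k \<le> card P + card Q + 1"
    using shifted_nbr_count[OF d v(1), of 0] N rd by fastforce
  then have "k \<le> card P \<or> k \<le> card Q" by linarith
  then show ?thesis
    using OL_lower_bound_of_odd_chords[OF d _ d0 _ q] OL_lower_bound_of_odd_chords[OF r _ r0 _ q] v(2) rd rr unfolding P_def Q_def by auto
qed

text \<open>By the bound on \<open>OL\<close>, all neighbours of \<open>v\<close> lie at
  \<open>x + 2 * a\<close> with \<open>\<bar>a\<bar> \<le> k\<close>, for any neighbour position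
  \<open>x\<close>; at most one of these \<open>2 * k + 1\<close> slots is empty. If
  \<open>M \<ge> 2 * k + 3\<close>, one of the slots \<open>x + 2 * k\<close> and
  \<open>x - 2 * k\<close> is filled and empties the two slots nearest to \<open>x\<close> on the
  other side.\<close>

lemma M_eq_of_outside_vertex:
  assumes c: "cyc c M" and v: "v \<in> V" "v \<notin> range c" and N: "\<And>u. E v u \<Longrightarrow> u \<in> range c"
  shows "M = 2 * int k + 1"
proof -
  define S where "S = (\<lambda>i. E v (c i))"
  have per: "S (i + M) \<longleftrightarrow> S i" for i using cyc_period[OF c] by (simp add: S_def)
  have lb: "M + 2 - 2 * int k \<le> q" if "q \<in> OL" for q using OL_lower_bound[OF c v N that] .
  have slots: "odd (j - i) \<longrightarrow> M - 2 * int k \<le> j - i" "even (j - i) \<longrightarrow> j - i \<le> 2 * int k"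
    if "S i" "S j" "i < j" "j < i + M" for i j
    using outside_chords[OF c v(2), of i j] that lb unfolding S_def by fastforce+
  have "M < 2 * int k + 3"
  proof (rule ccontr)
    assume "\<not> ?thesis"
    then have Mk: "2 * int k + 3 \<le> M" by simp
    have miss: "\<not> (\<not> S (x + 2 * a) \<and> \<not> S (x + 2 * b))"
      if "S x" "a \<noteq> b" "a \<noteq> 0" "b \<noteq> 0" "- int k \<le> a" "- int k \<le> b" "a \<le> int k" "b \<le> int k" for x a b
    proof
      assume n: "\<not> S (x + 2 * a) \<and> \<not> S (x + 2 * b)"
      define h where "h = (\<lambda>y. if y < 0 then y + M else y)"
      have hS: "S (x + h y) \<longleftrightarrow> S (x + y)" for y using per[of "x + y"] by (simp add: h_def add.assoc)

      have "{i. 0 \<le> i \<and> i < M \<and> E v (c (x + i))} \<subseteq> (\<lambda>y. h (2 * y)) ` ({- int k..int k} - {a, b})"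
      proof
        fix i assume "i \<in> {i. 0 \<le> i \<and> i < M \<and> E v (c (x + i))}"
        then have i: "0 \<le> i" "i < M" "S (x + i)" by (auto simp: S_def)
        have "\<exists>y. - int k \<le> y \<and> y \<le> int k \<and> i = h (2 * y)"
        proof (cases "i = 0")
          case True then show ?thesis by (intro exI[of _ 0]) (auto simp: h_def)
        next
          case False
          note sl = slots[OF that(1) i(3)]
          show ?thesis
          proof (cases "even i")
            case True
            then show ?thesis using sl False i by (intro exI[of _ "i div 2"]) (auto simp: h_def)
          next
            case odd: False
            then have "M - 2 * int k \<le> i" using sl False i by auto
            moreover have "even (i - M)" using odd M_odd by auto
            ultimately show ?thesis using i by (intro exI[of _ "(i - M) div 2"]) (auto simp: h_def)
          qed
        qed
        then obtain y where y: "- int k \<le> y" "y \<le> int k" "i = h (2 * y)" by blast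
        then have "S (x + 2 * y)" using i(3) hS by simp
        then have "y \<noteq> a" "y \<noteq> b" using n by auto
        then show "i \<in> (\<lambda>y. h (2 * y)) ` ({- int k..int k} - {a, b})" using y by auto
      qed
      then have "card {i. 0 \<le> i \<and> i < M \<and> E v (c (x + i))} \<le> card ((\<lambda>y. h (2 * y)) ` ({- int k..int k} - {a, b}))"
        by (intro card_mono) auto
      also have "\<dots> \<le> card ({- int k..int k} - {a, b})" by (intro card_image_le) auto
      also have "\<dots> = card {- int k..int k} - card {a, b}" using that by (intro card_Diff_subset) auto
      also have "\<dots> = 2 * k - 1" using that(2) by simp
      finally show False using shifted_nbr_count[OF c v(1) N, of x] k2 by simp
    qed
    obtain x where x: "S x" using ex_nbr[OF v(1)] N unfolding S_def by blast
    have k4: "4 \<le> 2 * int k" using k2 by simp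
    have "S (x + 2 * int k) \<or> S (x + 2 * (- int k))" using miss[OF x, of "int k" "- int k"] k2 by auto
    then show False
    proof
      assume y: "S (x + 2 * int k)"
      have "\<not> S (x + 2 * (- 1))" using slots[OF _ y, of "x - 2"] Mk M_odd by auto
      moreover have "\<not> S (x + 2 * (- 2))"
      proof
        assume 4: "S (x + 2 * (- 2))"
        show False
        proof (cases "M = 2 * int k + 3")
          case True
          have "S (x + 2 * (-2) + M)" using 4 per by blast
          then show False using slots[OF _ y, of "x - 4 + M"] True k2 by simp
        next
          case False
          then have "2 * int k + 4 < M" using Mk M_odd by presburger
          then show False using slots[OF _ y, of "x - 4"] 4 by auto
        qed
      qed
      ultimately show False using miss[OF x, of "-1" "-2"] k2 by simp
    next
      assume y: "S (x + 2 * (- int k))"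
      have "\<not> S (x + 2 * 1)" using slots[OF y, of "x + 2"] Mk M_odd by auto
      moreover have "\<not> S (x + 2 * 2)"
      proof
        assume 4: "S (x + 2 * 2)"
        show False
        proof (cases "M = 2 * int k + 3")
          case True
          have "S (x + 2 * (- int k) + M)" using y per by blast
          then show False using slots[OF _ 4, of "x + 2 * (- int k) + M"] True k2 by simp
        next
          case False
          then have "2 * int k + 4 < M" using Mk M_odd by presburger
          then show False using slots[OF y, of "x + 4"] 4 by auto
        qed
      qed
      ultimately show False using miss[OF x, of 1 2] k2 by simp
    qed
  qed
  moreover have "2 * k \<le> card {i. 0 \<le> i \<and> i < M \<and> E v (c (0 + i))}" by (rule shifted_nbr_count[OF c v(1) N])
  moreover have "card {i. 0 \<le> i \<and> i < M \<and> E v (c (0 + i))} \<le> card {0..<M}" by (intro card_mono) auto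
  ultimately have "2 * k \<le> nat M" "M < 2 * int k + 3" by simp_all
  then have "2 * int k \<le> M" "M < 2 * int k + 3" using M3 by linarith+
  then show ?thesis using M_odd by presburger
qed

text \<open>Inserting the two vertices into different edges of the longest odd cycle would give a
  cycle of length \<open>M + 2\<close>.\<close>

lemma double_insert:
  assumes c: "cyc c M" and st: "0 \<le> s" "s < t" "t < M - 1"
    and out: "v \<notin> range c" "w \<notin> range c" "v \<noteq> w"
    and E: "E v (c s)" "E v (c (s + 1))" "E w (c t)" "E w (c (t + 1))"
  shows False
proof -
  have inj: "inj_on c {0..M-1}" using cyc_eq[OF c] by (intro inj_onI) auto
  have dis: "c ` A \<inter> c ` B = {}" if "A \<subseteq> {0..M-1}" "B \<subseteq> {0..M-1}" "A \<inter> B = {}" for A B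
    using inj_on_image_Int[OF inj that(1,2)] that(3) by auto
  have sg: "pth (c ` {i..j}) (c i) (c j) (j - i)" if "0 \<le> i" "i \<le> j" "j \<le> M - 1" for i j
    using cyc_seg[OF c, of i j] that by simp
  have p1: "pth (c ` {0..s} \<union> {v}) (c 0) v (s - 0 + 1 + 0)"
    using pth_join[OF sg[of 0 s] sym[OF E(1)] pth_refl[of v "{v}"]] st out by auto
  have "(c ` {0..s} \<union> {v}) \<inter> c ` {s+1..t} = {}" using dis[of "{0..s}" "{s+1..t}"] out st by auto
  then have p2: "pth (c ` {0..s} \<union> {v} \<union> c ` {s+1..t}) (c 0) (c t) (s - 0 + 1 + 0 + 1 + (t - (s + 1)))"
    using pth_join[OF p1 E(2) sg[of "s+1" t]] st by auto
  have p3: "pth (c ` {0..s} \<union> {v} \<union> c ` {s+1..t} \<union> {w}) (c 0) w (s - 0 + 1 + 0 + 1 + (t - (s + 1)) + 1 + 0)"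
    using pth_join[OF p2 sym[OF E(3)] pth_refl[of w "{w}"]] out by auto
  have "(c ` {0..s} \<union> {v} \<union> c ` {s+1..t} \<union> {w}) \<inter> c ` {t+1..M-1} = {}"
    using dis[of "{0..s}" "{t+1..M-1}"] dis[of "{s+1..t}" "{t+1..M-1}"] out st by auto
  then have p4: "pth (c ` {0..s} \<union> {v} \<union> c ` {s+1..t} \<union> {w} \<union> c ` {t+1..M-1}) (c 0) (c (M - 1))
     (s - 0 + 1 + 0 + 1 + (t - (s + 1)) + 1 + 0 + 1 + (M - 1 - (t + 1)))"
    using pth_join[OF p3 E(4) sg[of "t+1" "M-1"]] st by auto
  have "E (c (M - 1)) (c (M - 1 + 1))" using c unfolding cyc_def by blast
  then have "E (c (M - 1)) (c 0)" using cyc_period[OF c, of 0] by simp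
  from cyc_close[OF p4 this] obtain d where "cyc d (M + 2)" using st M3 by (auto simp: add_ac)
  then show False using cyc_OL[of d "M + 2"] M_odd OL_le[of "M + 2"] by auto
qed

text \<open>With \<open>M = 2 * k + 1\<close> an outside vertex misses at most one vertex of the
  cycle, so two outside vertices would allow \<open>double_insert\<close>. Hence there are
  \<open>2 * k + 2\<close> vertices; two nonadjacent vertices of the cycle are adjacent to all
  others and so are twins.\<close>

lemma R_not_1: "R \<noteq> 1"
proof
  assume R1: "R = 1"
  obtain c e where t: "tail c e 1" using ex_tail R1 by auto
  have c: "cyc c M" and v0: "e 0 \<notin> range c" and "E (e 0) (e 1)"
    using t ipath_edge[of e 1 0] by (auto simp: tail_def)
  then have vV: "e 0 \<in> V" using EV by blast
  have N: "E v u \<Longrightarrow> u \<in> range c" if "v \<in> V" "v \<notin> range c" for v u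
    using outside_nbr(2)[OF c that] R1 by simp
  have M: "M = 2 * int k + 1" using M_eq_of_outside_vertex[OF c vV v0 N[OF vV v0]] .
  have one_miss: "E v (c (x + i)) \<or> E v (c (x + j))" if v: "v \<in> V" "v \<notin> range c" and ij: "0 \<le> i" "i < j" "j < M" for v x i j
  proof (rule ccontr)
    assume "\<not> ?thesis"
    then have "{i. 0 \<le> i \<and> i < M \<and> E v (c (x + i))} \<subseteq> {0..<M} - {i, j}" by auto
    then have "card {i. 0 \<le> i \<and> i < M \<and> E v (c (x + i))} \<le> card ({0..<M} - {i, j})" by (intro card_mono) auto
    also have "\<dots> = card {0..<M} - card {i, j}" using ij by (intro card_Diff_subset) auto
    also have "\<dots> = 2 * k - 1" using ij M by simp
    finally show False using shifted_nbr_count[OF c v(1) N[OF v], of x] k2 by simp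
  qed
  have k4: "4 < M" using M k2 by simp
  have single: "w = v" if v: "v \<in> V" "v \<notin> range c" and w: "w \<in> V" "w \<notin> range c" for v w
  proof (rule ccontr)
    assume ne: "w \<noteq> v"
    obtain x where x: "E v (c (x + i))" if "1 \<le> i" "i < M" for i
    proof (cases "\<exists>x. \<not> E v (c x)")
      case True
      then obtain x where x: "\<not> E v (c (x + 0))" by auto
      show thesis using that[of x] one_miss[OF v, of 0 _ x] x by auto
    next
      case False then show thesis using that by blast
    qed
    define d where "d = (\<lambda>i. c (i + x))"
    have d: "cyc d M" unfolding d_def by (rule cyc_shift[OF c])
    have rd: "range d = range c" unfolding d_def by (auto simp: image_iff) (metis diff_add_cancel)
    have vd: "E v (d i)" if "1 \<le> i" "i < M" for i using x[OF that] by (simp add: d_def add.commute)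
    have wd: "E w (d i) \<or> E w (d j)" if "0 \<le> i" "i < j" "j < M" for i j
      using one_miss[OF w that, of x] by (simp add: d_def add.commute)
    have out: "v \<notin> range d" "w \<notin> range d" using v w rd by auto
    show False
    proof (cases "E w (d 0) \<and> E w (d 1)")
      case True
      then show False using double_insert[OF d, of 0 2 w v] out ne vd k4 by auto
    next
      case False
      then have "E w (d 2) \<and> E w (d 3)" using wd[of 0 2] wd[of 0 3] wd[of 1 2] wd[of 1 3] k4 by auto
      then show False using double_insert[OF d, of 2 3 w v] out ne vd k4 by auto
    qed
  qed
  have V: "V = insert (e 0) (range c)" using single[OF vV v0] cyc_in_V[OF c] vV by blast
  have cc: "range c = c ` {0..<M}" using cyc_rep[OF c] by fastforce
  have "inj_on c {0..<M}" using cyc_eq[OF c] by (intro inj_onI) auto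
  then have card_c: "card (range c) = 2 * k + 1" unfolding cc using M by (simp add: card_image)
  then have card_V: "card V = 2 * k + 2" unfolding V using v0 cc by simp
  obtain u w where uw: "u \<in> range c" "w \<in> range c" "u \<noteq> w" "\<not> E u w"
    using no_clique[OF cyc_in_V[OF c] card_c] by blast
  have uwV: "u \<in> V" "w \<in> V" using uw V by auto
  have full: "{x. E y x} = V - {u, w}" if "y \<in> {u, w}" for y
  proof -
    have sub: "{x. E y x} \<subseteq> V - {u, w}" using that uw(4) irr sym EV2 by auto
    have "card (V - {u, w}) = card V - card {u, w}" using uwV by (intro card_Diff_subset) auto
    then have "card (V - {u, w}) \<le> card {x. E y x}" using card_V uw(3) mindeg[of y] that uwV by auto
    then show ?thesis using card_subset_eq[OF _ sub] card_mono[OF _ sub] fin by (simp add: le_antisym)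
  qed
  show False using no_twin[OF uwV uw(3,4)] full by simp
qed

text \<open>The adjacency is invariant under rotation, so a chord from \<open>0\<close> to \<open>x\<close> gives the cycle
  \<open>0, x, x - 1, ..., 2, x + 2, ..., M - 1\<close> of length \<open>M - 2\<close>.\<close>

lemma R_not_0: "R \<noteq> 0"
proof
  assume R0: "R = 0"
  obtain c where c: "cyc c M" using ex_longest by blast
  have V: "V = range c" using outside_nbr(1)[OF c] R0 cyc_in_V[OF c] by fastforce
  have p: "ipath (\<lambda>i. c (s + i)) (M - 1)" for s
  proof -
    have "cyc (\<lambda>i. c (i + s)) M" by (rule cyc_shift[OF c])
    then have d: "cyc (\<lambda>i. c (s + i)) M" by (simp add: add.commute)
    have "inj_on (\<lambda>i. c (s + i)) {0..M - 1}" using cyc_eq[OF d] by (intro inj_onI) auto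
    moreover have "E (c (s + i)) (c (s + (i + 1)))" for i using d by (simp add: cyc_def)
    ultimately show ?thesis using M3 by (simp add: ipath_def)
  qed
  have nb: "{u. E (c (s + 0)) u} \<subseteq> (\<lambda>i. c (s + i)) ` {1..M - 1}" for s
  proof
    fix u assume "u \<in> {u. E (c (s + 0)) u}"
    then have u: "E (c s) u" by simp
    have "cyc (\<lambda>i. c (i + s)) M" by (rule cyc_shift[OF c])
    moreover obtain j where "u = c j" using EV2[OF u] V by auto
    then have "u = c (j - s + s)" by simp
    then have "u \<in> range (\<lambda>i. c (i + s))" by blast
    ultimately obtain i where i: "0 \<le> i" "i < M" "u = c (i + s)" using cyc_rep[of "\<lambda>i. c (i + s)" M u] by blast
    have "i \<noteq> 0" using i u irr by auto
    then show "u \<in> (\<lambda>i. c (s + i)) ` {1..M - 1}" using i by (intro image_eqI[of _ _ i]) (auto simp: add.commute)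
  qed
  have last: "E (c (s + 0)) (c (s + (M - 1)))" for s
  proof -
    have "E (c (s - 1)) (c (s - 1 + 1))" using c unfolding cyc_def by blast
    then show ?thesis using cyc_period[OF c, of "s - 1"] sym by (simp add: algebra_simps)
  qed
  note g = good_vertex[OF p nb last]
  have Me: "even (M - 1)" "0 < M - 1" using M_odd M3 by auto
  have ev: "E (c s) (c (s + a)) \<longleftrightarrow> a + 1 \<in> OL" if "0 < a" "a < M" "even a" for s a
    using g(2)[OF Me that, of s] by simp
  have od: "E (c s) (c (s + a)) \<longleftrightarrow> M - a + 1 \<in> OL" if "0 < a" "a < M" "odd a" for s a
    using g(3)[OF Me that, of s] by simp
  have cl: "a + 1 \<in> OL \<Longrightarrow> b + 1 \<in> OL \<Longrightarrow> \<bar>a + b - M\<bar> + 2 \<in> OL" for a b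
    using g(4)[OF Me] by simp
  have circ: "E (c s) (c (s + a))" if "E (c 0) (c a)" "0 < a" "a < M" for s a
    using ev[of a s] ev[of a 0] od[of a s] od[of a 0] that by (cases "even a") auto
  define S where "S = {i. 0 \<le> i \<and> i < M \<and> E (c 0) (c (0 + i))}"
  have S: "2 * k \<le> card S" unfolding S_def by (rule shifted_nbr_count[OF c]) (use V EV2 in auto)
  have M2: "M - 2 \<in> OL"
  proof (cases "\<exists>x. 3 \<le> x \<and> x \<le> M - 3 \<and> E (c 0) (c x)")
    case True
    then obtain x where x: "3 \<le> x" "x \<le> M - 3" "E (c 0) (c x)" by blast
    have inj: "inj_on c {0..M-1}" using cyc_eq[OF c] by (intro inj_onI) auto
    have dis: "c ` A \<inter> c ` B = {}" if "A \<subseteq> {0..M-1}" "B \<subseteq> {0..M-1}" "A \<inter> B = {}" for A B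
      using inj_on_image_Int[OF inj that(1,2)] that(3) by auto
    have sg: "pth (c ` {i..j}) (c i) (c j) (j - i)" if "0 \<le> i" "i \<le> j" "j \<le> M - 1" for i j
      using cyc_seg[OF c, of i j] that by simp
    have p1: "pth (c ` {0..0} \<union> c ` {2..x}) (c 0) (c 2) (0 - 0 + 1 + (x - 2))"
      using pth_join[OF sg[of 0 0] x(3) pth_sym[OF sg[of 2 x]] dis] x by auto
    have "E (c 2) (c (2 + x))" using circ[OF x(3)] x by simp
    moreover have "(c ` {0..0} \<union> c ` {2..x}) \<inter> c ` {2 + x..M - 1} = {}"
      using dis[of "{0..0}" "{2 + x..M - 1}"] dis[of "{2..x}" "{2 + x..M - 1}"] x by auto
    ultimately have p2: "pth (c ` {0..0} \<union> c ` {2..x} \<union> c ` {2 + x..M - 1}) (c 0) (c (M - 1))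
       (0 - 0 + 1 + (x - 2) + 1 + (M - 1 - (2 + x)))"
      using pth_join[OF p1 _ sg[of "2 + x" "M - 1"]] x by auto
    have "E (c (M - 1)) (c 0)" using last[of 0] sym by simp
    from cyc_close[OF p2 this] obtain d where "cyc d (M - 2)" using x by (auto simp: add_ac)
    then show ?thesis using cyc_OL M_odd by simp
  next
    case False
    \<comment> \<open>Without long chords the degree forces all four neighbours at distance one or
      two. The chord of length two gives \<open>3 \<in> OL\<close>, and closure with
      \<open>a = b = 2\<close> gives \<open>M - 2\<close>.\<close>
    have sub: "S \<subseteq> {1, 2, M - 2, M - 1}"
    proof
      fix i assume i: "i \<in> S"
      then have "i \<noteq> 0" using irr by (auto simp: S_def)
      then show "i \<in> {1, 2, M - 2, M - 1}" using i False unfolding S_def by (cases "3 \<le> i \<and> i \<le> M - 3") auto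
    qed
    have c4: "card {1, 2, M - 2, M - 1} \<le> card S" using S k2 card_length[of "[1, 2, M - 2, M - 1]"] by simp
    then have "S = {1, 2, M - 2, M - 1}" using sub card_seteq[of "{1, 2, M - 2, M - 1}" S] by auto
    then have "2 \<in> S" by simp
    moreover have "5 \<le> M"
    proof (rule ccontr)
      assume "\<not> ?thesis"
      then have "M = 3" using M3 M_odd by presburger
      then have "S \<subseteq> {1, 2}" using sub by auto
      then have "card S \<le> card {1, 2 :: int}" by (intro card_mono) auto
      then show False using S k2 by simp
    qed
    ultimately have "2 + 1 \<in> OL" using ev[of 2 0] by (simp add: S_def)
    from cl[OF this this] show ?thesis using \<open>5 \<le> M\<close> by simp
  qed
  \<comment> \<open>Closure with \<open>b = M - 3\<close> lowers a length by two.\<close>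
  have all: "3 \<le> M - 2 * int n \<Longrightarrow> M - 2 * int n \<in> OL" for n
  proof (induction n)
    case 0 then show ?case using M_OL by simp
  next
    case (Suc n)
    then have "M - 2 * int n - 1 + 1 \<in> OL" by simp
    moreover have "M - 3 + 1 \<in> OL" using M2 by simp
    ultimately have "\<bar>(M - 2 * int n - 1) + (M - 3) - M\<bar> + 2 \<in> OL" by (rule cl)
    then show ?case using Suc.prems by (simp add: algebra_simps)
  qed
  have inOL: "q \<in> OL" if "odd q" "3 \<le> q" "q \<le> M" for q
  proof -
    have "even (M - q)" using that M_odd by simp
    then have "q = M - 2 * int (nat ((M - q) div 2))" using that by auto
    then show ?thesis using all that by metis
  qed
  have adj: "E (c s) (c (s + a))" if "0 < a" "a < M" for s a
  proof (cases "even a")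
    case True
    then have "3 \<le> a + 1" using that by presburger
    then have "a + 1 \<in> OL" using True that by (intro inOL) auto
    then show ?thesis using ev that True by simp
  next
    case False
    then have "3 \<le> M - a + 1" using that M_odd by presburger
    then have "M - a + 1 \<in> OL" using False that M_odd by (intro inOL) auto
    then show ?thesis using od that False by simp
  qed
  have "S \<subseteq> {0..<M} - {0}" using irr by (auto simp: S_def)
  then have "card S \<le> card ({0..<M} - {0})" by (intro card_mono) auto
  then have "2 * k + 1 \<le> nat M" using S M3 by simp
  have cc: "V = c ` {0..<M}" using cyc_rep[OF c] V by fastforce
  have "inj_on c {0..<M}" using cyc_eq[OF c] by (intro inj_onI) auto
  then have "2 * k + 1 \<le> card V" unfolding cc using \<open>2 * k + 1 \<le> nat M\<close> by (simp add: card_image)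
  then obtain T where T: "T \<subseteq> V" "card T = 2 * k + 1" using obtain_subset_with_card_n by metis
  obtain u w where uw: "u \<in> T" "w \<in> T" "u \<noteq> w" "\<not> E u w" using no_clique[OF T] by blast
  then have "u \<in> c ` {0..<M}" "w \<in> c ` {0..<M}" using T(1) cc by blast+
  then obtain i j where ij: "0 \<le> i" "i < M" "u = c i" "0 \<le> j" "j < M" "w = c j" by auto
  have "i \<noteq> j" using ij(3,6) uw(3) by blast
  then show False using adj[of "j - i" i] adj[of "i - j" j] ij uw(4) sym by (cases "i < j") auto
qed

theorem odd_critical_False: False
  using R_nonneg R_le_1 R_not_0 R_not_1 by linarith

end

section \<open>Transfer to digraphs\<close>

context sgraph
begin

definition E_on :: "'a set \<Rightarrow> 'a \<Rightarrow> 'a \<Rightarrow> bool" where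
  "E_on W u v \<longleftrightarrow> u \<in> W \<and> v \<in> W \<and> E u v"

lemma sgraph_on: "W \<subseteq> V \<Longrightarrow> sgraph W (E_on W)"
  using fin sym irr finite_subset by unfold_locales (auto simp: E_on_def)

lemma colourable_if_few_odd_cycles:
  assumes k: "2 \<le> k" and OL: "card OL \<le> k"
    and cl: "\<And>S. S \<subseteq> V \<Longrightarrow> card S = 2 * k + 1 \<Longrightarrow> \<exists>u\<in>S. \<exists>v\<in>S. u \<noteq> v \<and> \<not> E u v"
  shows "colb (2 * k) V"
proof (rule ccontr)
  assume "\<not> ?thesis"
  then obtain U where U: "vcrit (2 * k) U" using ex_vcrit[of V] by blast
  then have UV: "U \<subseteq> V" by (simp add: vcrit_def)
  interpret H: sgraph U "E_on U" by (rule sgraph_on[OF UV])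
  have col: "H.colb q T \<longleftrightarrow> colb q T" if "T \<subseteq> U" for q T
  proof -
    have "E_on U u v \<longleftrightarrow> E u v" if "u \<in> T" "v \<in> T" for u v
      using \<open>T \<subseteq> U\<close> that by (auto simp: E_on_def)
    then show ?thesis unfolding H.colb_def colb_def by (simp cong: ball_cong)
  qed
  have nc: "\<not> colb (2 * k) U" using U by (simp add: vcrit_def)
  have HU: "H.vcrit (2 * k) U"
    unfolding H.vcrit_def using U by (simp add: vcrit_def col Diff_subset)
  have "H.cyc c m \<Longrightarrow> cyc c m" for c m unfolding H.cyc_def cyc_def E_on_def by blast
  then have sub: "H.OL \<subseteq> OL" unfolding H.OL_def OL_def by blast
  have "odd_critical U (E_on U) k"
  proof
    show "2 \<le> k" by (rule k)
    show "\<exists>n. H.pth (U - {z}) u v n" if "u \<in> U - {z}" "v \<in> U - {z}" for u v z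
      using H.vcrit_connected[OF HU that] .
    show "card H.OL \<le> k" using card_mono[OF finite_OL sub] OL by simp
    have "\<not> colb 2 U"
    proof
      assume "colb 2 U"
      then obtain f :: "'a \<Rightarrow> nat" where f: "\<forall>v\<in>U. f v < 2" "\<forall>u\<in>U. \<forall>v\<in>U. E u v \<longrightarrow> f u \<noteq> f v" unfolding colb_def by blast
      have "\<forall>v\<in>U. f v < 2 * k" using f(1) k by fastforce
      then have "colb (2 * k) U" unfolding colb_def using f(2) by blast
      then show False using nc by simp
    qed
    then show "H.OL \<noteq> {}" using H.odd_cycle_if_not_bipartite[of U] col by simp
    show "2 * k \<le> card {u. E_on U v u}" if "v \<in> U" for v
    proof -
      have "{u \<in> U. E_on U v u} = {u. E_on U v u}" by (auto simp: E_on_def)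
      then show ?thesis using H.vcrit_deg[OF HU that] by simp
    qed
    show "\<not> {x. E_on U u x} \<subseteq> {x. E_on U v x}" if "u \<in> U" "v \<in> U" "u \<noteq> v" "\<not> E_on U u v" for u v
    proof -
      have "{x \<in> U. E_on U y x} = {x. E_on U y x}" for y by (auto simp: E_on_def)
      then show ?thesis using H.vcrit_no_twin[OF HU that] by simp
    qed
    show "\<exists>u\<in>S. \<exists>v\<in>S. u \<noteq> v \<and> \<not> E_on U u v" if "S \<subseteq> U" "card S = 2 * k + 1" for S
      using cl[of S] that UV by (auto simp: E_on_def)
  qed
  then show False by (rule odd_critical.odd_critical_False)
qed

end

section \<open>Cycles of the digraph from periodic maps\<close>

context graph
begin

lemma sgraph_adj: "sgraph (verts G) (\<lambda>u v. u \<rightarrow>\<^bsub>G\<^esub> v)"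
proof
  show "v \<rightarrow>\<^bsub>G\<^esub> u" if "u \<rightarrow>\<^bsub>G\<^esub> v" for u v using that graph_symmetric by blast
qed (use adj_in_verts adj_not_same in auto)

text \<open>An arc is chosen for every edge of the periodic map; one period of these arcs is a
  closed walk whose vertices after the first are distinct.\<close>

lemma cycle_of_cyc:
  assumes "sgraph.cyc (\<lambda>u v. u \<rightarrow>\<^bsub>G\<^esub> v) c m" shows "has_cycle_of_length G (nat m)"
proof -
  interpret s: sgraph "verts G" "\<lambda>u v. u \<rightarrow>\<^bsub>G\<^esub> v" by (rule sgraph_adj)
  have c: "3 \<le> m" "\<And>i j. c i = c j \<longleftrightarrow> i mod m = j mod m" "\<And>i. c i \<rightarrow>\<^bsub>G\<^esub> c (i + 1)"
    using assms by (auto simp: s.cyc_def)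
  have "\<exists>e. e \<in> arcs G \<and> tail G e = c (int i) \<and> head G e = c (int (Suc i))" for i
    using c(3)[of "int i"] by (auto simp: arcs_ends_def arc_to_ends_def add.commute)
  then obtain a where a: "\<And>i. a i \<in> arcs G" "\<And>i. tail G (a i) = c (int i)" "\<And>i. head G (a i) = c (int (Suc i))"
    by metis
  have vs: "awalk_verts (c (int i)) (map a [i..<i + n]) = map (\<lambda>i. c (int i)) [i..<Suc (i + n)]
      \<and> cas (c (int i)) (map a [i..<i + n]) (c (int (i + n)))" for i n
  proof (induction n arbitrary: i)
    case (Suc n)
    have "[i..<i + Suc n] = i # [Suc i..<Suc i + n]" by (simp add: upt_rec)
    moreover have "[i..<Suc (i + Suc n)] = i # [Suc i..<Suc (Suc i + n)]" by (simp add: upt_rec)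
    ultimately show ?case using Suc[of "Suc i"] a by simp
  qed simp
  define n where "n = nat m"
  have n: "int n = m" "3 \<le> n" using c(1) by (auto simp: n_def)
  have "awalk (c 0) (map a [0..<n]) (c 0)"
    unfolding awalk_def using vs[of 0 n] a(1) n c(2)[of 0 m] adj_in_verts(1)[OF c(3)[of 0]] by auto
  moreover have "distinct (tl (awalk_verts (c 0) (map a [0..<n])))"
  proof -
    have "tl (awalk_verts (c 0) (map a [0..<n])) = map (\<lambda>i. c (int i)) [1..<Suc n]"
      using vs[of 0 n] by (simp add: tl_upt flip: map_tl)
    moreover have "inj_on (\<lambda>i. c (int i)) {1..<Suc n}"
    proof (rule inj_onI)
      fix i j assume ij: "i \<in> {1..<Suc n}" "j \<in> {1..<Suc n}" "c (int i) = c (int j)"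
      then have "m dvd int i - int j" using c(2) by (simp add: mod_eq_dvd_iff)
      moreover have "\<bar>int i - int j\<bar> < m" using ij n by auto
      ultimately show "i = j" using dvd_imp_le_int[of "int i - int j" m] by fastforce
    qed
    ultimately show ?thesis by (simp add: distinct_map del: upt_Suc)
  qed
  ultimately have "cycle (map a [0..<n])" unfolding cycle_def using n by auto
  then show ?thesis using n unfolding has_cycle_of_length_def n_def[symmetric]
    by (auto intro!: exI[of _ "map a [0..<n]"])
qed

end

theorem theorem5:
  fixes G :: "('a, 'b) pre_digraph"
  assumes "graph G"
    and "connected G"
    and "card (odd_cycle_lengths G) \<ge> 2"
    and "clique_number G \<le> 2 * card (odd_cycle_lengths G)"
  shows "chromatic_number G \<le> 2 * card (odd_cycle_lengths G)"
proof -
  interpret graph G by (rule assms(1))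
  interpret s: sgraph "verts G" "\<lambda>u v. u \<rightarrow>\<^bsub>G\<^esub> v" by (rule sgraph_adj)
  let ?k = "card (odd_cycle_lengths G)"
  have "s.colb (2 * ?k) (verts G)"
  proof (rule s.colourable_if_few_odd_cycles)
    show "2 \<le> ?k" by (rule assms(3))
    \<comment> \<open>One inclusion suffices, as only an upper bound on the number of odd lengths is
      required.\<close>
    have "inj_on nat s.OL" using s.OL_ge3 by (fastforce intro: inj_onI)
    moreover have "nat ` s.OL \<subseteq> odd_cycle_lengths G"
    proof
      fix x assume "x \<in> nat ` s.OL"
      then obtain m c where m: "x = nat m" "odd m" "s.cyc c m" by (auto simp: s.OL_def)
      then have "odd x" using m by (simp add: s.cyc_def even_nat_iff)
      then show "x \<in> odd_cycle_lengths G" using cycle_of_cyc[OF m(3)] m(1) by (simp add: odd_cycle_lengths_def)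
    qed
    ultimately show "card s.OL \<le> ?k" using finite_odd_cycle_lengths by (rule card_inj_on_le)
    show "\<exists>u\<in>S. \<exists>v\<in>S. u \<noteq> v \<and> \<not> u \<rightarrow>\<^bsub>G\<^esub> v" if "S \<subseteq> verts G" "card S = 2 * ?k + 1" for S
    proof (rule ccontr)
      assume "\<not> ?thesis"
      then have "clique G S" using that(1) by (auto simp: clique_def)
      then have "card S \<in> card ` {S. clique G S}" by blast
      then have "card S \<le> clique_number G" unfolding clique_number_def by (rule Max_ge[OF finite_cliques(1)])
      then show False using that(2) assms(4) by simp
    qed
  qed
  then obtain col where "\<forall>v\<in>verts G. col v < 2 * ?k" "\<forall>u\<in>verts G. \<forall>v\<in>verts G. u \<rightarrow>\<^bsub>G\<^esub> v \<longrightarrow> col u \<noteq> col v"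
    unfolding s.colb_def by blast
  then have "proper_coloring G (2 * ?k) col" using adj_in_verts unfolding proper_coloring_def by blast
  then show ?thesis unfolding chromatic_number_def by (intro Least_le) blast
qed

end
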